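(* Let $d\ge 3$ and $n\ge d+1$. Every $\lambda_2$-maximizer in $\mathcal{T}(n,d)$ is a caterpillar with at most two vertices of degree more than two. More precisely, it is isomorphic to a tree obtained from a path $v_0v_1\ldots v_d$ by attaching $k_1=\lfloor \frac{n-d-1}{2}\rfloor$ pendant vertices (leaves) at a vertex $v_i$ and $k_2=\lceil \frac{n-d-1}{2}\rceil$ pendant vertices (leaves) at a vertex $v_j$, for some indices $1\le i<j\le d-1$.
   Context: All graphs are finite and simple. For a graph $G$, $\lambda_2(G)$ is the second largest eigenvalue (with multiplicity) of the adjacency matrix of $G$. $\mathcal{T}(n,d)$ is the set of trees on $n$ vertices with diameter $d$. A $\lambda_2$-maximizer in $\mathcal{T}(n,d)$ is a tree $T\in\mathcal{T}(n,d)$ with $\lambda_2(H)\le\lambda_2(T)$ for all $H\in\mathcal{T}(n,d)$. A caterpillar is a tree in which removing all pendant vertices gives a path. *)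

theory Defs
  imports
    "Graph_Theory.Digraph_Isomorphism"
    "Graph_Theory.Shortest_Path"
    "Jordan_Normal_Form.Char_Poly"
begin

text \<open>
  A finite simple graph is a \<^locale>\<open>pair_graph\<close>: a finite vertex set with a symmetric, irreflexive
  set of ordered pairs, so that each edge is represented by its two orientations. In particular
  \<^const>\<open>out_degree\<close> is the usual degree.
\<close>

subsection \<open>Second largest adjacency eigenvalue\<close>

definition adj_matrix :: "'a pair_pre_digraph \<Rightarrow> 'a list \<Rightarrow> real mat" where
  "adj_matrix G vs = mat (length vs) (length vs) (\<lambda>(i, j). if (vs ! i, vs ! j) \<in> parcs G then 1 else 0)"

text \<open>
  The multiset of adjacency eigenvalues, with algebraic multiplicity. The choice of the enumeration
  of the vertices is immaterial, see \<open>char_poly_adj_matrix_cong\<close> below.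
\<close>

definition adj_eigenvalues :: "'a pair_pre_digraph \<Rightarrow> real multiset" where
  "adj_eigenvalues G =
     proots (char_poly (adj_matrix G (SOME vs. distinct vs \<and> set vs = pverts G)))"

text \<open>The list below is sorted in descending order and indexed from 0.\<close>

definition lambda2 :: "'a pair_pre_digraph \<Rightarrow> real" where
  "lambda2 G = rev (sorted_list_of_multiset (adj_eigenvalues G)) ! 1"

lemma char_poly_adj_matrix_cong:
  assumes "distinct vs" "distinct ws" "set vs = set ws"
  shows "char_poly (adj_matrix G vs) = char_poly (adj_matrix G ws)"
proof -
  define m where "m = length vs"
  have lv: "length vs = m" by (simp add: m_def)
  have lw: "length ws = m" using assms distinct_card[of vs] distinct_card[of ws] by (simp add: m_def)
  have "\<forall>i. \<exists>k. i < m \<longrightarrow> k < m \<and> ws ! k = vs ! i"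
    by (metis assms(3) in_set_conv_nth lv lw)
  then obtain p where p: "\<And>i. i < m \<Longrightarrow> p i < m" "\<And>i. i < m \<Longrightarrow> ws ! p i = vs ! i" by metis
  have "\<forall>i. \<exists>k. i < m \<longrightarrow> k < m \<and> vs ! k = ws ! i"
    by (metis assms(3) in_set_conv_nth lv lw)
  then obtain q where q: "\<And>i. i < m \<Longrightarrow> q i < m" "\<And>i. i < m \<Longrightarrow> vs ! q i = ws ! i" by metis
  define P where "P = mat m m (\<lambda>(i, j). if vs ! i = ws ! j then 1 else (0 :: real))"
  define Q where "Q = mat m m (\<lambda>(i, j). if ws ! i = vs ! j then 1 else (0 :: real))"
  have ep: "vs ! i = ws ! l \<longleftrightarrow> l = p i" if "i < m" "l < m" for i l
    using nth_eq_iff_index_eq[OF assms(2), of l "p i"] p that lw by metis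
  have eq: "ws ! i = vs ! l \<longleftrightarrow> l = q i" if "i < m" "l < m" for i l
    using nth_eq_iff_index_eq[OF assms(1), of l "q i"] q that lv by metis
  have sp: "(\<Sum>l = 0..<m. (if vs ! i = ws ! l then 1 else 0) * f l) = f (p i)"
    if "i < m" for i and f :: "nat \<Rightarrow> real"
  proof -
    have "(\<Sum>l = 0..<m. (if vs ! i = ws ! l then 1 else 0) * f l) =
        (\<Sum>l = 0..<m. if l = p i then f l else 0)"
      by (rule sum.cong[OF refl]) (simp add: ep that)
    also have "\<dots> = f (p i)" using p(1)[OF that] by (simp add: sum.delta)
    finally show ?thesis .
  qed
  have sq: "(\<Sum>l = 0..<m. (if ws ! i = vs ! l then 1 else 0) * f l) = f (q i)"
    if "i < m" for i and f :: "nat \<Rightarrow> real"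
  proof -
    have "(\<Sum>l = 0..<m. (if ws ! i = vs ! l then 1 else 0) * f l) =
        (\<Sum>l = 0..<m. if l = q i then f l else 0)"
      by (rule sum.cong[OF refl]) (simp add: eq that)
    also have "\<dots> = f (q i)" using q(1)[OF that] by (simp add: sum.delta)
    finally show ?thesis .
  qed
  have iv: "vs ! i = vs ! j \<longleftrightarrow> i = j" if "i < m" "j < m" for i j
    using nth_eq_iff_index_eq[OF assms(1)] that lv by blast
  have iw: "ws ! i = ws ! j \<longleftrightarrow> i = j" if "i < m" "j < m" for i j
    using nth_eq_iff_index_eq[OF assms(2)] that lw by blast
  have PQ: "P * Q = 1\<^sub>m m"
    by (rule eq_matI) (simp_all add: P_def Q_def scalar_prod_def sp p iv)
  have QP: "Q * P = 1\<^sub>m m"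
    by (rule eq_matI) (simp_all add: P_def Q_def scalar_prod_def sq q iw)
  have PA: "P * adj_matrix G ws = mat m m (\<lambda>(i, j). if (vs ! i, ws ! j) \<in> parcs G then 1 else 0)"
    by (rule eq_matI) (simp_all add: P_def adj_matrix_def lw scalar_prod_def sp p)
  have AP: "adj_matrix G vs * P = mat m m (\<lambda>(i, j). if (vs ! i, ws ! j) \<in> parcs G then 1 else 0)"
  proof (rule eq_matI, goal_cases)
    case (1 i j)
    have "(\<Sum>l = 0..<m. (if (vs ! i, vs ! l) \<in> parcs G then 1 else 0) *
            (if vs ! l = ws ! j then 1 else (0 :: real))) =
          (\<Sum>l = 0..<m. (if ws ! j = vs ! l then 1 else 0) *
            (if (vs ! i, vs ! l) \<in> parcs G then 1 else (0 :: real)))"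
      by (rule sum.cong) auto
    also have "\<dots> = (if (vs ! i, ws ! j) \<in> parcs G then 1 else 0)"
      using 1 by (simp only: dim_row_mat dim_col_mat sq q)
    finally show ?case using 1 by (simp add: P_def adj_matrix_def lv scalar_prod_def)
  qed (simp_all add: P_def adj_matrix_def lv)
  have carr: "adj_matrix G vs \<in> carrier_mat m m" "adj_matrix G ws \<in> carrier_mat m m"
    "P \<in> carrier_mat m m" "Q \<in> carrier_mat m m"
    by (simp_all add: adj_matrix_def P_def Q_def lv lw)
  have "P * adj_matrix G ws * Q = adj_matrix G vs * P * Q" by (simp add: PA AP)
  also have "\<dots> = adj_matrix G vs"
    using carr PQ by (simp add: assoc_mult_mat[of _ m m _ m _ m])
  finally have "similar_mat (adj_matrix G vs) (adj_matrix G ws)"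
    using PQ QP carr unfolding similar_mat_def similar_mat_wit_def
    by (intro exI[of _ P] exI[of _ Q]) (auto simp: Let_def)
  then show ?thesis by (rule char_poly_similar)
qed

subsection \<open>Trees of given order and diameter\<close>

text \<open>
  The library's \<^const>\<open>forest\<close> counts the closed walk \<open>u, v, u\<close> along the two orientations of an
  edge as a cycle; cycles of an undirected simple graph are those of length at least 3.
\<close>

definition undirected_tree :: "'a pair_pre_digraph \<Rightarrow> bool" where
  "undirected_tree G \<longleftrightarrow> pair_graph G \<and> Digraph_Component.connected (with_proj G) \<and>
     \<not> (\<exists>p. pre_digraph.cycle (with_proj G) p \<and> 3 \<le> length p)"

text \<open>With all arc weights equal to 1, \<open>\<mu>\<close> is the usual distance.\<close>

definition graph_diameter :: "'a pair_pre_digraph \<Rightarrow> ereal" where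
  "graph_diameter G =
     (SUP (u, v) \<in> pverts G \<times> pverts G. wf_digraph.\<mu> (with_proj G) (\<lambda>_. 1) u v)"

definition trees_of_diameter :: "nat \<Rightarrow> nat \<Rightarrow> 'a pair_pre_digraph set" where
  "trees_of_diameter n d =
     {G. undirected_tree G \<and> card (pverts G) = n \<and> graph_diameter G = ereal (real d)}"

text \<open>
  Competitors range over the same vertex type. This is no restriction: that type has at least
  \<open>n\<close> elements as soon as it carries \<open>T\<close>, so every tree on \<open>n\<close> vertices has a copy in it.
\<close>

definition lambda2_maximizer :: "nat \<Rightarrow> nat \<Rightarrow> 'a pair_pre_digraph \<Rightarrow> bool" where
  "lambda2_maximizer n d T \<longleftrightarrow>
     T \<in> trees_of_diameter n d \<and>
     (\<forall>H \<in> (trees_of_diameter n d :: 'a pair_pre_digraph set). lambda2 H \<le> lambda2 T)"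

subsection \<open>Caterpillars\<close>

definition path_arcs :: "nat \<Rightarrow> nat rel" where
  "path_arcs d = {(l, Suc l) | l. l < d}"

definition path_graph :: "nat \<Rightarrow> nat pair_pre_digraph" where
  "path_graph d = \<lparr> pverts = {0..d}, parcs = path_arcs d \<union> (path_arcs d)\<inverse> \<rparr>"

definition caterpillar :: "'a pair_pre_digraph \<Rightarrow> bool" where
  "caterpillar G \<longleftrightarrow> undirected_tree G \<and>
     (\<exists>m. digraph_iso (with_proj G \<restriction> {v \<in> pverts G. out_degree (with_proj G) v \<noteq> 1})
                      (with_proj (path_graph m)))"

text \<open>
  The path \<open>0, \<dots>, d\<close> with new leaves \<open>d + 1, \<dots>, d + k\<^sub>1\<close> attached at \<open>i\<close> and new leaves
  \<open>d + k\<^sub>1 + 1, \<dots>, d + k\<^sub>1 + k\<^sub>2\<close> attached at \<open>j\<close>.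
\<close>

definition path_with_leaves :: "nat \<Rightarrow> nat \<Rightarrow> nat \<Rightarrow> nat \<Rightarrow> nat \<Rightarrow> nat pair_pre_digraph" where
  "path_with_leaves d i k\<^sub>1 j k\<^sub>2 =
     (let E = path_arcs d \<union> {i} \<times> {d<..d + k\<^sub>1} \<union> {j} \<times> {d + k\<^sub>1<..d + k\<^sub>1 + k\<^sub>2}
      in \<lparr> pverts = {0..d + k\<^sub>1 + k\<^sub>2}, parcs = E \<union> E\<inverse> \<rparr>)"

end

theory Submission
  imports Defs "Jordan_Normal_Form.Schur_Decomposition"
begin

text \<open>
  Let \<open>x\<close> be an eigenvector of the maximizer for \<open>l = \<lambda>\<^sub>2\<close> and \<open>x = x\<^sub>A - x\<^sub>B\<close> its decomposition into
  positive and negative parts, arranged to be supported on subtrees \<open>A\<close> and \<open>B\<close>. Let \<open>w\<^sub>A\<close> and \<open>w\<^sub>B\<close>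
  be non-pendant vertices at which \<open>x\<close> is largest and smallest, and fix a diametral path.
  Rehang the tree: keep a path of length \<open>d\<close> through \<open>w\<^sub>A\<close> and \<open>w\<^sub>B\<close>, and attach every vertex off it to one
  of these two. This does not decrease the quadratic forms of \<open>x\<^sub>A\<close> and \<open>x\<^sub>B\<close>, so by the variational
  characterization \<open>\<lambda>\<^sub>2\<close> does not decrease, and by maximality some \<open>x\<^sub>A - \<beta> x\<^sub>B\<close> is an eigenvector
  of the new tree as well. The eigenvector equations at \<open>w\<^sub>A\<close> and \<open>w\<^sub>B\<close> then force the two trees to coincide
  if the diametral path meets \<open>A\<close> and \<open>B\<close>, and are contradictory otherwise.
  Finally, if the numbers of leaves at the hubs differed by at least 2, moving one leaf across would give a
  two-dimensional space on which the form with shift \<open>l\<close> is positive definite, contradicting maximality; this space is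
  spanned by the old profile and by its reflection between the two hubs.
\<close>

subsection \<open>Real symmetric matrices\<close>

text \<open>Little is known about \<open>x\<close>: \<open>\<lambda>\<^sub>2\<close> may be a
  multiple eigenvalue, and an eigenvector may vanish at vertices or have many sign components. So
  every comparison of trees uses two test functions with disjoint supports. By the eigenvector
  equation the form with shift \<open>l\<close> of \<open>xA\<close>, and likewise of
  \<open>xB\<close>, equals the mixed term coming from the edges between the supports; a rehanging
  is therefore harmless once it creates no such edge. The supports are made connected because then
  the parent of a positive vertex other than \<open>wA\<close> is positive and, being non-pendant or
  \<open>wA\<close> itself, has value at most that of \<open>wA\<close>: hanging a vertex at the hub
  cannot lower its product with its parent. Hubs are taken among the non-pendant vertices because
  these have distance less than \<open>d\<close> from every vertex, which leaves room for them at
  inner positions of a path of length \<open>d\<close>. The inequality of the variational principle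
  is not strict, so the information comes from its equality case, read off at the hubs, where a
  gained neighbour would violate the eigenvector equation.\<close>

lemma symmetric_eigenvalue_real:
  fixes A :: "real mat" and a :: complex
  assumes A: "A \<in> carrier_mat n n" and sym: "transpose_mat A = A"
    and ev: "eigenvalue (map_mat complex_of_real A) a"
  shows "complex_of_real (Re a) = a"
proof -
  let ?A = "map_mat complex_of_real A"
  from ev obtain v where v: "v \<in> carrier_vec n" "v \<noteq> 0\<^sub>v n" "?A *\<^sub>v v = a \<cdot>\<^sub>v v"
    using A unfolding eigenvalue_def eigenvector_def by auto
  have symA: "A $$ (i, j) = A $$ (j, i)" if "i < n" "j < n" for i j
    using sym A that by (metis carrier_matD index_transpose_mat(1))
  \<comment> \<open>\<open>S\<close> is the Hermitian form of \<open>v\<close>: the eigenvalue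
    equation makes it \<open>a\<close> times the squared norm \<open>N\<close>, the symmetry of
    \<open>A\<close> makes it real.\<close>
  define S where "S = (\<Sum>i<n. \<Sum>j<n. complex_of_real (A $$ (i, j)) * v $ j * cnj (v $ i))"
  define N where "N = (\<Sum>i<n. v $ i * cnj (v $ i))"
  have eq: "(\<Sum>j<n. complex_of_real (A $$ (i, j)) * v $ j) = a * v $ i" if "i < n" for i
  proof -
    have "(?A *\<^sub>v v) $ i = (\<Sum>j<n. complex_of_real (A $$ (i, j)) * v $ j)"
      using A v(1) that by (auto simp: scalar_prod_def atLeast0LessThan intro!: sum.cong)
    thus ?thesis using v(1,3) that by simp
  qed
  have "S = (\<Sum>i<n. a * v $ i * cnj (v $ i))"
    unfolding S_def by (intro sum.cong refl) (simp add: sum_distrib_right[symmetric] eq)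
  hence S: "S = a * N" by (simp add: N_def sum_distrib_left mult.assoc)
  have "cnj S = (\<Sum>i<n. \<Sum>j<n. complex_of_real (A $$ (i, j)) * v $ i * cnj (v $ j))"
    by (simp add: S_def mult_ac)
  also have "\<dots> = (\<Sum>j<n. \<Sum>i<n. complex_of_real (A $$ (i, j)) * v $ i * cnj (v $ j))"
    by (rule sum.swap)
  also have "\<dots> = S" unfolding S_def by (intro sum.cong refl) (auto simp: symA)
  finally have "cnj S = S" .
  moreover have "cnj N = N" by (simp add: N_def mult.commute)
  moreover have "N \<noteq> 0"
  proof
    assume "N = 0"
    have "N = complex_of_real (\<Sum>i<n. (cmod (v $ i))\<^sup>2)"
      by (simp only: N_def of_real_sum complex_norm_square)
    with \<open>N = 0\<close> have "(\<Sum>i<n. (cmod (v $ i))\<^sup>2) = 0" by (metis of_real_eq_0_iff)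
    hence "\<forall>i<n. v $ i = 0" by (subst (asm) sum_nonneg_eq_0_iff) auto
    hence "v = 0\<^sub>v n" using v(1) by (intro eq_vecI) auto
    with v(2) show False by simp
  qed
  ultimately have "cnj a = a" using S by (metis complex_cnj_mult mult_right_cancel)
  thus ?thesis by (metis Reals_cnj_iff of_real_Re)
qed

text \<open>Over the complex numbers the characteristic polynomial factors, and its roots are real.
  Splitting matters because \<open>proots\<close> sees only real roots: no eigenvalue is lost from
  the spectrum.\<close>

lemma symmetric_char_poly_splits:
  fixes A :: "real mat"
  assumes A: "A \<in> carrier_mat n n" and sym: "transpose_mat A = A"
  shows "\<exists>es. char_poly A = (\<Prod>e\<leftarrow>es. [:- e, 1:])"
proof -
  interpret of_real_poly_hom: map_poly_inj_comm_ring_hom complex_of_real ..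
  let ?A = "map_mat complex_of_real A"
  have cA: "?A \<in> carrier_mat n n" using A by simp
  from char_poly_factorized[OF this] obtain as where
    as: "char_poly ?A = (\<Prod>a\<leftarrow>as. [:- a, 1:])" by auto
  have real: "complex_of_real (Re a) = a" if "a \<in> set as" for a
  proof (rule symmetric_eigenvalue_real[OF A sym])
    show "eigenvalue ?A a"
      unfolding eigenvalue_root_char_poly[OF cA] as using that by (simp add: poly_prod_list prod_list_zero_iff)
  qed
  have "map_poly complex_of_real (\<Prod>e\<leftarrow>map Re as. [:- e, 1:]) = (\<Prod>a\<leftarrow>as. [:- a, 1:])"
    using real by (induct as) (simp_all add: of_real_poly_hom.hom_mult del: mult_pCons_left mult_pCons_right)
  also have "\<dots> = map_poly complex_of_real (char_poly A)"
    using as by (simp only: of_real_hom.char_poly_hom[OF A, symmetric])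
  finally have "char_poly A = (\<Prod>e\<leftarrow>map Re as. [:- e, 1:])"
    by (simp only: of_real_poly_hom.eq_iff)
  thus ?thesis by blast
qed

text \<open>Gram-Schmidt applied to a basis that starts with \<open>v\<close> keeps the direction of
  \<open>v\<close>; normalizing the columns gives an orthogonal matrix. This is the change of basis
  for the deflation below.\<close>

lemma orthonormal_completion:
  fixes v :: "real vec"
  assumes v: "v \<in> carrier_vec n" and v0: "v \<noteq> 0\<^sub>v n"
  shows "\<exists>W c. W \<in> carrier_mat n n \<and> transpose_mat W * W = 1\<^sub>m n \<and> col W 0 = c \<cdot>\<^sub>v v"
proof -
  interpret cof_vec_space n "TYPE(real)" .
  define b where "b = basis_completion v"
  define ws where "ws = gram_schmidt n b"
  note bc = basis_completion[OF v v0, folded b_def]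
  have n: "n \<noteq> 0" using v v0 by (cases n) auto
  from bc n obtain vs where bv: "b = v # vs" by (cases b) auto
  from gram_schmidt_result[OF bc(2,4,5) refl, folded ws_def]
  have ws: "set ws \<subseteq> carrier_vec n" "corthogonal ws" "length ws = n" by (auto simp: bc)
  have hd: "hd ws = v" using gram_schmidt_hd[OF v, of vs] bv unfolding ws_def by simp
  define f where "f w = (1 / sqrt (w \<bullet> w)) \<cdot>\<^sub>v w" for w :: "real vec"
  define W where "W = mat_of_cols n (map f ws)"
  have W: "W \<in> carrier_mat n n" using ws mat_of_cols_carrier(1)[of n "map f ws"] by (simp add: W_def)
  have wi: "ws ! i \<in> carrier_vec n" if "i < n" for i using ws that by auto
  have col: "col W i = f (ws ! i)" if "i < n" for i
    using that ws(3) wi[OF that] unfolding W_def by (subst col_mat_of_cols) (auto simp: f_def)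
  have orth: "ws ! i \<bullet> ws ! j = 0 \<longleftrightarrow> i \<noteq> j" if "i < n" "j < n" for i j
    using corthogonalD[OF ws(2), of i j] that ws(3) by (simp add: conjugate_vec_def vec_eq_iff)
  have "transpose_mat W * W = 1\<^sub>m n"
  proof (rule eq_matI)
    fix i j assume "i < dim_row (1\<^sub>m n)" "j < dim_col (1\<^sub>m n)"
    hence ij: "i < n" "j < n" by auto
    have pos: "ws ! i \<bullet> ws ! i > 0"
      using orth[OF ij(1) ij(1)] by (auto simp: less_le scalar_prod_def intro!: sum_nonneg)
    have "(transpose_mat W * W) $$ (i, j) = f (ws ! i) \<bullet> f (ws ! j)"
      using ij W col by simp
    also have "\<dots> = (1 / sqrt (ws ! i \<bullet> ws ! i)) * (1 / sqrt (ws ! j \<bullet> ws ! j)) * (ws ! i \<bullet> ws ! j)"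
      using wi[OF ij(1)] wi[OF ij(2)] unfolding f_def by (subst smult_scalar_prod_distrib[of _ n], simp, simp, subst scalar_prod_smult_distrib[of _ n]) simp_all
    also have "\<dots> = 1\<^sub>m n $$ (i, j)"
      using orth[OF ij] pos ij by auto
    finally show "(transpose_mat W * W) $$ (i, j) = 1\<^sub>m n $$ (i, j)" .
  qed (use W in auto)
  moreover have "col W 0 = (1 / sqrt (v \<bullet> v)) \<cdot>\<^sub>v v"
    using col[of 0] n hd ws(3) by (metis f_def hd_conv_nth length_0_conv neq0_conv)
  ultimately show ?thesis using W by blast
qed

text \<open>Induction on the list of roots: in an orthonormal basis that starts with an eigenvector
  of \<open>e\<close>, symmetry clears the first row as well as the first column, and the remaining
  block has the remaining roots. The order of \<open>es\<close> is arbitrary and is respected by the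
  diagonal, so that a descending list can be supplied later.\<close>

theorem real_symmetric_diagonalization:
  fixes A :: "real mat"
  assumes "A \<in> carrier_mat n n" and "transpose_mat A = A"
    and "char_poly A = (\<Prod>e\<leftarrow>es. [:- e, 1:])"
  shows "length es = n \<and> (\<exists>P \<in> carrier_mat n n. transpose_mat P * P = 1\<^sub>m n \<and>
           A * P = P * mat_diag n (\<lambda>i. es ! i))"
  using assms
proof (induct es arbitrary: n A)
  case Nil
  with degree_monic_char_poly[OF Nil(1)] have "n = 0" by simp
  thus ?case using Nil(1) by (auto intro!: bexI[of _ "1\<^sub>m 0"] eq_matI simp: mat_diag_def)
next
  case (Cons e es n A)
  note A = Cons(2) and sym = Cons(3)
  let ?n1 = "n - 1"
  have cp: "char_poly A = [: -e, 1 :] * (\<Prod>e\<leftarrow>es. [:- e, 1:])" using Cons(4) by simp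
  have ev: "eigenvalue A e" unfolding eigenvalue_root_char_poly[OF A] cp by simp
  then obtain v where v: "v \<in> carrier_vec n" "v \<noteq> 0\<^sub>v n" "A *\<^sub>v v = e \<cdot>\<^sub>v v"
    using A unfolding eigenvalue_def eigenvector_def by auto
  have n: "n \<noteq> 0" using v by (cases n) auto
  from orthonormal_completion[OF v(1,2)] obtain W c where
    W: "W \<in> carrier_mat n n" and WtW: "transpose_mat W * W = 1\<^sub>m n" and c: "col W 0 = c \<cdot>\<^sub>v v" by blast
  let ?Wt = "transpose_mat W"
  have Wt: "?Wt \<in> carrier_mat n n" using W by simp
  have WWt: "W * ?Wt = 1\<^sub>m n" by (rule mat_mult_left_right_inverse[OF Wt W WtW])
  define A' where "A' = ?Wt * A * W"
  have A': "A' \<in> carrier_mat n n" using W A by (simp add: A'_def)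
  have symA': "transpose_mat A' = A'"
    using W A sym by (simp add: A'_def transpose_mult[of _ n n _ n] assoc_mult_mat[of _ n n _ n _ n])
  have AW: "A * W = W * A'"
  proof -
    have "W * A' = (W * ?Wt) * (A * W)" using W A unfolding A'_def
      by (simp add: assoc_mult_mat[of _ n n _ n _ n])
    thus ?thesis using WWt A W by simp
  qed
  have cv: "col W 0 \<in> carrier_vec n" using W by auto
  have "col A' 0 = ?Wt *\<^sub>v (A *\<^sub>v col W 0)"
  proof -
    have "A' = ?Wt * (A * W)" using W A unfolding A'_def by (simp add: assoc_mult_mat[of _ n n _ n _ n])
    also have "col \<dots> 0 = ?Wt *\<^sub>v col (A * W) 0" using W A n by (intro col_mult2) auto
    also have "col (A * W) 0 = A *\<^sub>v col W 0" using W A n by (intro col_mult2) auto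
    finally show ?thesis .
  qed
  also have "A *\<^sub>v col W 0 = e \<cdot>\<^sub>v col W 0" using v A unfolding c
    by (simp add: mult_mat_vec[of _ n n] smult_smult_assoc mult.commute)
  also have "?Wt *\<^sub>v (e \<cdot>\<^sub>v col W 0) = e \<cdot>\<^sub>v (?Wt *\<^sub>v col W 0)"
    using W cv by (simp add: mult_mat_vec[of _ n n])
  also have "?Wt *\<^sub>v col W 0 = col (?Wt * W) 0" using W n by (intro col_mult2[symmetric]) auto
  also have "\<dots> = unit_vec n 0" using n by (simp add: WtW)
  finally have colA': "col A' 0 = e \<cdot>\<^sub>v unit_vec n 0" .
  hence col0: "A' $$ (i, 0) = (if i = 0 then e else 0)" if "i < n" for i
  proof -
    have "A' $$ (i, 0) = col A' 0 $ i" using that A' n by simp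
    thus ?thesis using colA' that by simp
  qed
  have row0: "A' $$ (0, i) = (if i = 0 then e else 0)" if "i < n" for i
  proof -
    have "A' $$ (0, i) = transpose_mat A' $$ (i, 0)" using A' that n by simp
    thus ?thesis using col0[OF that] by (simp only: symA')
  qed
  define A3 where "A3 = mat ?n1 ?n1 (\<lambda>(i, j). A' $$ (Suc i, Suc j))"
  define E where "E = mat 1 1 (\<lambda>_. e)"
  have A3: "A3 \<in> carrier_mat ?n1 ?n1" by (simp add: A3_def)
  have E: "E \<in> carrier_mat 1 1" by (simp add: E_def)
  have blk: "A' = four_block_mat E (0\<^sub>m 1 ?n1) (0\<^sub>m ?n1 1) A3"
    by (rule eq_matI) (use A' n col0 row0 in \<open>auto simp: E_def A3_def\<close>)
  have symA3: "transpose_mat A3 = A3"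
  proof (rule eq_matI)
    fix i j assume "i < dim_row A3" "j < dim_col A3"
    hence "Suc i < n" "Suc j < n" by (auto simp: A3_def)
    hence "A' $$ (Suc i, Suc j) = A' $$ (Suc j, Suc i)"
      using symA' A' by (metis carrier_matD index_transpose_mat(1))
    thus "transpose_mat A3 $$ (i, j) = A3 $$ (i, j)"
      using \<open>Suc i < n\<close> \<open>Suc j < n\<close> by (simp add: A3_def)
  qed (auto simp: A3_def)
  have "similar_mat A' A"
    unfolding similar_mat_def
    by (intro exI, rule similar_mat_witI[of ?Wt W n A' A])
      (use WtW WWt W A A' in \<open>auto simp: A'_def\<close>)
  hence "char_poly A' = char_poly A" by (rule char_poly_similar)
  moreover have "char_poly A' = char_poly E * char_poly A3"
    unfolding blk by (rule char_poly_four_block_zeros_col[OF E _ A3]) simp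
  moreover have "char_poly E = [: -e, 1 :]"
    by (simp add: char_poly_def char_poly_matrix_def E_def det_single)
  ultimately have "[: -e, 1 :] * char_poly A3 = [: -e, 1 :] * (\<Prod>e\<leftarrow>es. [:- e, 1:])"
    using cp by simp
  hence "char_poly A3 = (\<Prod>e\<leftarrow>es. [:- e, 1:])"
    by (subst (asm) mult_left_cancel) simp_all
  from Cons(1)[OF A3 symA3 this] obtain P3 where len: "length es = ?n1"
    and P3: "P3 \<in> carrier_mat ?n1 ?n1" "transpose_mat P3 * P3 = 1\<^sub>m ?n1"
      "A3 * P3 = P3 * mat_diag ?n1 (\<lambda>i. es ! i)" by blast
  let ?D3 = "mat_diag ?n1 (\<lambda>i. es ! i)"
  let ?D = "mat_diag n (\<lambda>i. (e # es) ! i)"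
  define P' where "P' = four_block_mat (1\<^sub>m 1) (0\<^sub>m 1 ?n1) (0\<^sub>m ?n1 1) P3"
  have P': "P' \<in> carrier_mat n n"
    using n P3(1) four_block_carrier_mat[of "1\<^sub>m 1" 1 1 P3 ?n1 ?n1] unfolding P'_def by simp
  have D3: "?D3 \<in> carrier_mat ?n1 ?n1" by simp
  have Dblk: "?D = four_block_mat E (0\<^sub>m 1 ?n1) (0\<^sub>m ?n1 1) ?D3"
    by (rule eq_matI) (use n in \<open>auto simp: E_def mat_diag_def nth_Cons'\<close>)
  have tP': "transpose_mat P' = four_block_mat (1\<^sub>m 1) (0\<^sub>m 1 ?n1) (0\<^sub>m ?n1 1) (transpose_mat P3)"
    unfolding P'_def using P3(1) by (subst transpose_four_block_mat) auto
  have one: "four_block_mat (1\<^sub>m 1) (0\<^sub>m 1 ?n1) (0\<^sub>m ?n1 1) (1\<^sub>m ?n1) = 1\<^sub>m n"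
    using n four_block_one_mat[of 1 ?n1] by simp
  have "transpose_mat P' * P' = four_block_mat (1\<^sub>m 1) (0\<^sub>m 1 ?n1) (0\<^sub>m ?n1 1) (transpose_mat P3 * P3)"
    unfolding tP' unfolding P'_def
    using mult_four_block_mat[of "1\<^sub>m 1" 1 1 "0\<^sub>m 1 ?n1" ?n1 "0\<^sub>m ?n1 1" ?n1 "transpose_mat P3" "1\<^sub>m 1" 1 "0\<^sub>m 1 ?n1" ?n1 "0\<^sub>m ?n1 1" P3]
      P3(1) by simp
  hence "transpose_mat P' * P' = 1\<^sub>m n" by (simp only: P3(2) one)
  moreover have "A' * P' = P' * ?D"
  proof -
    have "A' * P' = four_block_mat E (0\<^sub>m 1 ?n1) (0\<^sub>m ?n1 1) (A3 * P3)"
      unfolding blk P'_def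
      using mult_four_block_mat[of E 1 1 "0\<^sub>m 1 ?n1" ?n1 "0\<^sub>m ?n1 1" ?n1 A3 "1\<^sub>m 1" 1 "0\<^sub>m 1 ?n1" ?n1 "0\<^sub>m ?n1 1" P3]
        E A3 P3(1) by simp
    moreover have "P' * ?D = four_block_mat E (0\<^sub>m 1 ?n1) (0\<^sub>m ?n1 1) (P3 * ?D3)"
      unfolding Dblk P'_def
      using mult_four_block_mat[of "1\<^sub>m 1" 1 1 "0\<^sub>m 1 ?n1" ?n1 "0\<^sub>m ?n1 1" ?n1 P3 E 1 "0\<^sub>m 1 ?n1" ?n1 "0\<^sub>m ?n1 1" ?D3]
        E D3 P3(1) left_mult_zero_mat[OF D3, of 1] by (simp del: One_nat_def)
    ultimately show ?thesis using P3(3) by simp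
  qed
  moreover define P where "P = W * P'"
  ultimately have "transpose_mat P * P = 1\<^sub>m n" "A * P = P * ?D"
  proof -
    assume *: "transpose_mat P' * P' = 1\<^sub>m n" and **: "A' * P' = P' * ?D"
    have tP': "transpose_mat P' \<in> carrier_mat n n" using P' by simp
    have "transpose_mat P * P = transpose_mat P' * ?Wt * (W * P')"
      unfolding P_def by (subst transpose_mult[OF W P']) (rule refl)
    also have "\<dots> = transpose_mat P' * (?Wt * (W * P'))"
      using W P' by (intro assoc_mult_mat[OF tP' Wt]) auto
    also have "?Wt * (W * P') = ?Wt * W * P'" by (rule assoc_mult_mat[symmetric, OF Wt W P'])
    finally show "transpose_mat P * P = 1\<^sub>m n" using WtW * P' by simp
    have D: "?D \<in> carrier_mat n n" by simp
    have "A * P = (A * W) * P'" unfolding P_def by (rule assoc_mult_mat[symmetric, OF A W P'])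
    also have "\<dots> = W * (A' * P')" unfolding AW by (rule assoc_mult_mat[OF W A' P'])
    also have "\<dots> = W * (P' * ?D)" by (simp only: **)
    also have "\<dots> = P * ?D" unfolding P_def by (rule assoc_mult_mat[symmetric, OF W P' D])
    finally show "A * P = P * ?D" .
  qed
  moreover have "P \<in> carrier_mat n n" using W P' by (simp add: P_def)
  ultimately show ?case using len n by auto
qed

subsection \<open>Variational bounds for the second eigenvalue\<close>

text \<open>The diagonalization rewritten with sums, \<open>p k\<close> being the k-th eigenvector.
  The relation with summation over \<open>k\<close> expresses completeness of the basis.\<close>

lemma real_symmetric_eigenbasis:
  fixes A :: "real mat"
  assumes A: "A \<in> carrier_mat n n" and "transpose_mat A = A"
    and "char_poly A = (\<Prod>e\<leftarrow>es. [:- e, 1:])"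
  obtains p :: "nat \<Rightarrow> nat \<Rightarrow> real" where "length es = n"
    and "\<And>k l. k < n \<Longrightarrow> l < n \<Longrightarrow> (\<Sum>i<n. p k i * p l i) = of_bool (k = l)"
    and "\<And>i j. i < n \<Longrightarrow> j < n \<Longrightarrow> (\<Sum>k<n. p k i * p k j) = of_bool (i = j)"
    and "\<And>k i. k < n \<Longrightarrow> i < n \<Longrightarrow> (\<Sum>j<n. A $$ (i, j) * p k j) = es ! k * p k i"
proof -
  from real_symmetric_diagonalization[OF assms] obtain P where len: "length es = n"
    and P: "P \<in> carrier_mat n n" "transpose_mat P * P = 1\<^sub>m n" "A * P = P * mat_diag n (\<lambda>i. es ! i)"
    by blast
  have PPt: "P * transpose_mat P = 1\<^sub>m n"
    by (rule mat_mult_left_right_inverse[OF _ P(1,2)]) (use P in simp)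
  show ?thesis
  proof (rule that[of "\<lambda>k i. P $$ (i, k)"])
    fix k l assume kl: "k < n" "l < n"
    have "(transpose_mat P * P) $$ (k, l) = (\<Sum>i<n. P $$ (i, k) * P $$ (i, l))"
      using kl P(1) by (simp add: scalar_prod_def atLeast0LessThan)
    thus "(\<Sum>i<n. P $$ (i, k) * P $$ (i, l)) = of_bool (k = l)" using kl by (cases "k = l") (simp_all add: P(2))
  next
    fix i j assume ij: "i < n" "j < n"
    have "(P * transpose_mat P) $$ (i, j) = (\<Sum>k<n. P $$ (i, k) * P $$ (j, k))"
      using ij P(1) by (simp add: scalar_prod_def atLeast0LessThan)
    thus "(\<Sum>k<n. P $$ (i, k) * P $$ (j, k)) = of_bool (i = j)" using ij by (cases "i = j") (simp_all add: PPt)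
  next
    fix k i assume ki: "k < n" "i < n"
    have "(A * P) $$ (i, k) = (\<Sum>j<n. A $$ (i, j) * P $$ (j, k))"
      using ki P(1) A by (simp add: scalar_prod_def atLeast0LessThan)
    moreover have "(P * mat_diag n (\<lambda>i. es ! i)) $$ (i, k) = es ! k * P $$ (i, k)"
      using ki P(1) by (subst mat_diag_mult_right[of _ n n]) auto
    ultimately show "(\<Sum>j<n. A $$ (i, j) * P $$ (j, k)) = es ! k * P $$ (i, k)"
      using P(3) by simp
  qed (rule len)
qed

text \<open>The adjacency operator acting on functions on the vertices, which frees the graph
  arguments from an enumeration of the vertices.\<close>

definition nbr_sum :: "'a rel \<Rightarrow> ('a \<Rightarrow> real) \<Rightarrow> 'a \<Rightarrow> real" where
  "nbr_sum E x v = (\<Sum>u\<in>E `` {v}. x u)"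

lemma nbr_sum_linear:
  "nbr_sum E (\<lambda>v. a * x v + b * y v) v = a * nbr_sum E x v + b * nbr_sum E y v"
  by (simp add: nbr_sum_def sum.distrib sum_distrib_left)

lemma pair_graph_arcs:
  assumes "pair_graph G"
  shows "parcs G \<subseteq> pverts G \<times> pverts G" "sym (parcs G)" "irrefl (parcs G)" "finite (pverts G)"
proof -
  interpret pair_graph G by fact
  show "parcs G \<subseteq> pverts G \<times> pverts G" using wellformed' by auto
  show "sym (parcs G)" using pair_sym_arcs by (simp add: symmetric_def)
  show "irrefl (parcs G)" using pair_no_loops by (fastforce simp: irrefl_def)
  show "finite (pverts G)" by (rule pair_finite_verts)
qed

text \<open>The eigenbasis of the adjacency matrix is transported to functions on \<open>V\<close>.
  Orthogonality to \<open>e1\<close> removes the top coordinate, so the Rayleigh quotient is at most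
  \<open>lambda2 G\<close>; the last clause is its equality case, which drives all later rigidity
  arguments.\<close>

lemma lambda2_spectral:
  fixes G :: "'a pair_pre_digraph"
  assumes G: "pair_graph G" and n2: "2 \<le> card (pverts G)"
  defines "V \<equiv> pverts G" and "N \<equiv> nbr_sum (parcs G)"
  obtains e1 e2 l1 where "lambda2 G \<le> l1" "\<exists>v\<in>V. e1 v \<noteq> 0" "\<exists>v\<in>V. e2 v \<noteq> 0"
    "(\<Sum>v\<in>V. e1 v * e2 v) = 0"
    "\<And>v. v \<in> V \<Longrightarrow> N e1 v = l1 * e1 v" "\<And>v. v \<in> V \<Longrightarrow> N e2 v = lambda2 G * e2 v"
    "\<And>z. (\<Sum>v\<in>V. e1 v * z v) = 0 \<Longrightarrow> (\<Sum>v\<in>V. z v * N z v) \<le> lambda2 G * (\<Sum>v\<in>V. (z v)\<^sup>2)"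
    "\<And>z v. (\<Sum>v\<in>V. e1 v * z v) = 0 \<Longrightarrow> (\<Sum>v\<in>V. z v * N z v) = lambda2 G * (\<Sum>v\<in>V. (z v)\<^sup>2) \<Longrightarrow>
       v \<in> V \<Longrightarrow> N z v = lambda2 G * z v"
proof -
  note E = pair_graph_arcs[OF G]
  define vs where "vs = (SOME vs. distinct vs \<and> set vs = pverts G)"
  have "\<exists>vs. distinct vs \<and> set vs = pverts G" using finite_distinct_list[OF E(4)] by blast
  hence "distinct vs \<and> set vs = pverts G" unfolding vs_def by (rule someI_ex)
  hence vs: "distinct vs" "set vs = V" by (simp_all add: V_def)
  define n where "n = length vs"
  have n: "2 \<le> n" using n2 vs distinct_card[of vs] by (simp add: n_def V_def)
  define A where "A = adj_matrix G vs"
  have A: "A \<in> carrier_mat n n" by (simp add: A_def adj_matrix_def n_def)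
  have Aij: "A $$ (i, j) = of_bool ((vs ! i, vs ! j) \<in> parcs G)" if "i < n" "j < n" for i j
    using that by (simp add: A_def adj_matrix_def n_def)
  have "transpose_mat A = A"
    by (rule eq_matI) (use A Aij E(2) in \<open>auto dest: symD\<close>)
  note sA = this
  obtain es0 where es0: "char_poly A = (\<Prod>e\<leftarrow>es0. [:- e, 1:])"
    using symmetric_char_poly_splits[OF A sA] by blast
  \<comment> \<open>The diagonalization accepts the roots in any order; in the descending one,
    position 1 is \<open>lambda2\<close>.\<close>
  define es where "es = rev (sort es0)"
  have "(\<Prod>e\<leftarrow>es. [:- e, 1:]) = (\<Prod>e\<leftarrow>es0. [:- e, 1:])"
    unfolding prod_mset_prod_list[symmetric] mset_map es_def by simp
  hence es: "char_poly A = (\<Prod>e\<leftarrow>es. [:- e, 1:])" using es0 by simp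
  obtain p where len: "length es = n"
    and orth: "\<And>k l. k < n \<Longrightarrow> l < n \<Longrightarrow> (\<Sum>i<n. p k i * p l i) = of_bool (k = l)"
    and compl: "\<And>i j. i < n \<Longrightarrow> j < n \<Longrightarrow> (\<Sum>k<n. p k i * p k j) = of_bool (i = j)"
    and eig: "\<And>k i. k < n \<Longrightarrow> i < n \<Longrightarrow> (\<Sum>j<n. A $$ (i, j) * p k j) = es ! k * p k i"
    by (rule real_symmetric_eigenbasis[OF A sA es]) (rule that)
  have "proots (\<Prod>e\<leftarrow>es. [:- e, 1:]) = mset es"
  proof (induct es)
    case (Cons e es)
    have "(\<Prod>e\<leftarrow>es. [:- e, 1:]) \<noteq> 0" by (auto simp: prod_list_zero_iff)
    thus ?case using Cons by (simp add: proots_mult del: mult_pCons_left)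
  qed simp
  hence "adj_eigenvalues G = mset es"
    unfolding adj_eigenvalues_def vs_def[symmetric] A_def[symmetric] es by simp
  hence l2: "lambda2 G = es ! 1"
    by (simp add: lambda2_def es_def)
  have sorted: "es ! l \<le> es ! k" if "k \<le> l" "l < n" for k l
    using that len sorted_nth_mono[of "sort es0" "n - 1 - l" "n - 1 - k"]
    by (auto simp: es_def rev_nth)
  have bij: "bij_betw ((!) vs) {..<n} V" using bij_betw_nth[OF vs(1)] vs(2) n_def by auto
  have sumV: "(\<Sum>v\<in>V. f v) = (\<Sum>i<n. f (vs ! i))" for f :: "'a \<Rightarrow> real"
    by (rule sum.reindex_bij_betw[OF bij, symmetric])
  have N: "N z (vs ! i) = (\<Sum>j<n. A $$ (i, j) * z (vs ! j))" if i: "i < n" for z i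
  proof -
    have fin: "finite V" using E(4) V_def by simp
    have "N z (vs ! i) = (\<Sum>v\<in>V. of_bool ((vs ! i, v) \<in> parcs G) * z v)"
      unfolding N_def nbr_sum_def using E(1) fin
      by (intro sum.mono_neutral_cong_left) (auto simp: V_def)
    also have "\<dots> = (\<Sum>j<n. A $$ (i, j) * z (vs ! j))"
      unfolding sumV using i by (intro sum.cong) (auto simp: Aij)
    finally show ?thesis .
  qed
  define ix where "ix = inv_into {..<n} ((!) vs)"
  have ix: "ix (vs ! i) = i" if "i < n" for i
    unfolding ix_def using bij that by (simp add: bij_betw_def)
  have ixV: "\<exists>i<n. v = vs ! i" if "v \<in> V" for v using bij that by (auto simp: bij_betw_def)
  define e where "e k v = p k (ix v)" for k v
  have ev: "e k (vs ! i) = p k i" if "i < n" for k i using that by (simp add: e_def ix)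
  have Ne: "N (e k) v = es ! k * e k v" if "k < n" "v \<in> V" for k v
  proof -
    from ixV[OF that(2)] obtain i where i: "i < n" "v = vs ! i" by blast
    show ?thesis using i eig[OF that(1) i(1)] by (simp add: N ev)
  qed
  have nz: "\<exists>v\<in>V. e k v \<noteq> 0" if "k < n" for k
  proof (rule ccontr)
    assume "\<not> ?thesis"
    hence "p k i = 0" if "i < n" for i
      using ev[OF that, of k] nth_mem[of i vs] that vs(2) n_def by simp
    thus False using orth[OF that that] by simp
  qed
  \<comment> \<open>Coordinates of \<open>z\<close> in the eigenbasis.\<close>
  define a where "a z k = (\<Sum>i<n. p k i * z (vs ! i))" for z k
  have expand: "z (vs ! i) = (\<Sum>k<n. a z k * p k i)" if "i < n" for z i
  proof -
    have "(\<Sum>k<n. a z k * p k i) = (\<Sum>k<n. \<Sum>j<n. p k j * z (vs ! j) * p k i)"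
      by (simp add: a_def sum_distrib_right)
    also have "\<dots> = (\<Sum>j<n. \<Sum>k<n. p k j * z (vs ! j) * p k i)" by (rule sum.swap)
    also have "\<dots> = (\<Sum>j<n. z (vs ! j) * (\<Sum>k<n. p k j * p k i))"
      by (simp add: sum_distrib_left mult_ac)
    also have "\<dots> = (\<Sum>j<n. if j = i then z (vs ! j) else 0)"
      using that by (intro sum.cong) (auto simp: compl)
    also have "\<dots> = z (vs ! i)" using that by simp
    finally show ?thesis by simp
  qed
  have inner: "(\<Sum>v\<in>V. z v * (\<Sum>k<n. c k * e k v)) = (\<Sum>k<n. c k * a z k)" for z c
  proof -
    have "(\<Sum>v\<in>V. z v * (\<Sum>k<n. c k * e k v)) = (\<Sum>i<n. \<Sum>k<n. z (vs ! i) * (c k * p k i))"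
      unfolding sumV by (intro sum.cong refl) (simp add: ev sum_distrib_left)
    also have "\<dots> = (\<Sum>k<n. \<Sum>i<n. z (vs ! i) * (c k * p k i))" by (rule sum.swap)
    also have "\<dots> = (\<Sum>k<n. c k * a z k)" by (simp add: a_def sum_distrib_left mult_ac)
    finally show ?thesis .
  qed
  have ze: "z v = (\<Sum>k<n. a z k * e k v)" if v: "v \<in> V" for z v
  proof -
    from ixV[OF v] obtain i where i: "i < n" "v = vs ! i" by blast
    show ?thesis using i by (simp add: expand[of i z] ev)
  qed
  have Nz: "N z v = (\<Sum>k<n. (a z k * es ! k) * e k v)" if v: "v \<in> V" for z v
  proof -
    from ixV[OF v] obtain i where i: "i < n" "v = vs ! i" by blast
    have "N z v = (\<Sum>j<n. A $$ (i, j) * (\<Sum>k<n. a z k * p k j))"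
      using i expand by (simp add: N)
    also have "\<dots> = (\<Sum>j<n. \<Sum>k<n. a z k * (A $$ (i, j) * p k j))"
      by (simp add: sum_distrib_left mult_ac)
    also have "\<dots> = (\<Sum>k<n. \<Sum>j<n. a z k * (A $$ (i, j) * p k j))" by (rule sum.swap)
    also have "\<dots> = (\<Sum>k<n. (a z k * es ! k) * e k v)"
      using i by (intro sum.cong refl) (simp add: sum_distrib_left[symmetric] eig ev)
    finally show ?thesis .
  qed
  have sq: "(\<Sum>v\<in>V. (z v)\<^sup>2) = (\<Sum>k<n. (a z k)\<^sup>2)" for z
  proof -
    have "(\<Sum>v\<in>V. (z v)\<^sup>2) = (\<Sum>v\<in>V. z v * (\<Sum>k<n. a z k * e k v))"
      by (intro sum.cong refl) (use ze in \<open>simp add: power2_eq_square\<close>)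
    thus ?thesis by (simp add: inner power2_eq_square)
  qed
  have quad: "(\<Sum>v\<in>V. z v * N z v) = (\<Sum>k<n. es ! k * (a z k)\<^sup>2)" for z
  proof -
    have "(\<Sum>v\<in>V. z v * N z v) = (\<Sum>v\<in>V. z v * (\<Sum>k<n. (a z k * es ! k) * e k v))"
      by (intro sum.cong refl) (use Nz in simp)
    thus ?thesis by (simp only: inner) (simp add: power2_eq_square mult_ac)
  qed
  have a0: "(\<Sum>v\<in>V. e 0 v * z v) = a z 0" for z
    unfolding sumV a_def by (intro sum.cong refl) (simp add: ev)
  have diff: "lambda2 G * (\<Sum>v\<in>V. (z v)\<^sup>2) - (\<Sum>v\<in>V. z v * N z v) = (\<Sum>k<n. (es ! 1 - es ! k) * (a z k)\<^sup>2)" for z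
    by (simp add: sq quad l2 sum_distrib_left sum_subtractf algebra_simps)
  have nonneg: "(es ! 1 - es ! k) * (a z k)\<^sup>2 \<ge> 0" if "(\<Sum>v\<in>V. e 0 v * z v) = 0" "k < n" for z k
  proof (cases "k = 0")
    case True thus ?thesis using that a0 by simp
  next
    case False thus ?thesis using sorted[of 1 k] that by simp
  qed
  show ?thesis
  proof (rule that[of "es ! 0" "e 0" "e 1"])
    show "lambda2 G \<le> es ! 0" using sorted[of 0 1] n l2 by simp
    show "(\<Sum>v\<in>V. e 0 v * e 1 v) = 0"
      using orth[of 0 1] n unfolding sumV by (simp add: ev)
    show "N (e 1) v = lambda2 G * e 1 v" if "v \<in> V" for v using Ne[of 1 v] n that l2 by simp
    fix z assume z: "(\<Sum>v\<in>V. e 0 v * z v) = 0"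
    have "0 \<le> (\<Sum>k<n. (es ! 1 - es ! k) * (a z k)\<^sup>2)" by (rule sum_nonneg) (use nonneg[OF z] in auto)
    thus "(\<Sum>v\<in>V. z v * N z v) \<le> lambda2 G * (\<Sum>v\<in>V. (z v)\<^sup>2)" using diff[of z] by linarith
    fix v assume eq: "(\<Sum>v\<in>V. z v * N z v) = lambda2 G * (\<Sum>v\<in>V. (z v)\<^sup>2)" and v: "v \<in> V"
    \<comment> \<open>A sum of nonnegative terms vanishes, so every coordinate with an eigenvalue
      other than \<open>lambda2 G\<close> is zero.\<close>
    have "(\<Sum>k<n. (es ! 1 - es ! k) * (a z k)\<^sup>2) = 0" using diff[of z] eq by linarith
    hence "\<forall>k<n. (es ! 1 - es ! k) * (a z k)\<^sup>2 = 0"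
      using nonneg[OF z] by (subst (asm) sum_nonneg_eq_0_iff) auto
    hence "a z k * es ! k = lambda2 G * a z k" if "k < n" for k using that l2 by force
    hence "(\<Sum>k<n. (a z k * es ! k) * e k v) = (\<Sum>k<n. lambda2 G * (a z k * e k v))"
      by (intro sum.cong refl) auto
    thus "N z v = lambda2 G * z v" using Nz[OF v, of z] ze[OF v, of z] by (simp add: sum_distrib_left)
  qed (use n nz Ne in auto)
qed

text \<open>The lower half of Courant-Fischer for a plane: some nonzero combination of
  \<open>x\<close> and \<open>y\<close> is orthogonal to the top eigenvector, and there the Rayleigh
  quotient is bounded by \<open>lambda2 G\<close> from above and by \<open>\<mu>\<close> from below.
  If both bounds agree, the equality case turns this combination into an eigenvector.\<close>

lemma two_dim_lambda2_ge:
  fixes G :: "'a pair_pre_digraph" and \<mu> :: real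
  assumes G: "pair_graph G" and n2: "2 \<le> card (pverts G)"
    and indep: "\<And>a b. (\<And>v. v \<in> pverts G \<Longrightarrow> a * x v + b * y v = 0) \<Longrightarrow> a = 0 \<and> b = 0"
    and Q: "\<And>a b z. (\<And>v. z v = a * x v + b * y v) \<Longrightarrow>
       (\<Sum>v\<in>pverts G. z v * (nbr_sum (parcs G) z v - \<mu> * z v)) \<ge> 0"
  shows "\<mu> \<le> lambda2 G"
    and "lambda2 G = \<mu> \<Longrightarrow> \<exists>a b. (a \<noteq> 0 \<or> b \<noteq> 0) \<and>
       (\<forall>v\<in>pverts G. nbr_sum (parcs G) (\<lambda>v. a * x v + b * y v) v = \<mu> * (a * x v + b * y v))"
proof -
  let ?V = "pverts G" and ?N = "nbr_sum (parcs G)"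
  obtain e1 where up: "\<And>z. (\<Sum>v\<in>?V. e1 v * z v) = 0 \<Longrightarrow> (\<Sum>v\<in>?V. z v * ?N z v) \<le> lambda2 G * (\<Sum>v\<in>?V. (z v)\<^sup>2)"
    and eq: "\<And>z v. (\<Sum>v\<in>?V. e1 v * z v) = 0 \<Longrightarrow> (\<Sum>v\<in>?V. z v * ?N z v) = lambda2 G * (\<Sum>v\<in>?V. (z v)\<^sup>2) \<Longrightarrow>
       v \<in> ?V \<Longrightarrow> ?N z v = lambda2 G * z v"
    by (rule lambda2_spectral[OF G n2]) (rule that)
  define p where "p = (\<Sum>v\<in>?V. e1 v * x v)"
  define q where "q = (\<Sum>v\<in>?V. e1 v * y v)"
  obtain a b where ab: "a \<noteq> 0 \<or> b \<noteq> 0" "a * p + b * q = 0"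
  proof (cases "p = 0 \<and> q = 0")
    case True thus ?thesis using that[of 1 0] by simp
  next
    case False thus ?thesis using that[of q "- p"] by auto
  qed
  define z where "z v = a * x v + b * y v" for v
  have orth: "(\<Sum>v\<in>?V. e1 v * z v) = 0"
    using ab(2) by (simp add: z_def p_def q_def algebra_simps sum.distrib sum_distrib_left)
  have "\<exists>v\<in>?V. z v \<noteq> 0" using indep[of a b] ab(1) by (auto simp: z_def)
  moreover have fin: "finite ?V" using pair_graph_arcs[OF G] by blast
  ultimately have pos: "(\<Sum>v\<in>?V. (z v)\<^sup>2) > 0"
    by (auto intro: sum_pos2)
  have "0 \<le> (\<Sum>v\<in>?V. z v * (?N z v - \<mu> * z v))" by (rule Q) (rule z_def)
  also have "\<dots> = (\<Sum>v\<in>?V. z v * ?N z v) - \<mu> * (\<Sum>v\<in>?V. (z v)\<^sup>2)"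
    by (simp add: algebra_simps sum_subtractf sum_distrib_left power2_eq_square)
  finally have low: "\<mu> * (\<Sum>v\<in>?V. (z v)\<^sup>2) \<le> (\<Sum>v\<in>?V. z v * ?N z v)" by simp
  with up[OF orth] have "\<mu> * (\<Sum>v\<in>?V. (z v)\<^sup>2) \<le> lambda2 G * (\<Sum>v\<in>?V. (z v)\<^sup>2)" by linarith
  with pos show "\<mu> \<le> lambda2 G" by simp
  assume l: "lambda2 G = \<mu>"
  have "(\<Sum>v\<in>?V. z v * ?N z v) = lambda2 G * (\<Sum>v\<in>?V. (z v)\<^sup>2)"
    using low up[OF orth] l by simp
  from eq[OF orth this] have "\<forall>v\<in>?V. ?N z v = \<mu> * z v" using l by simp
  moreover have "z = (\<lambda>v. a * x v + b * y v)" by (simp add: z_def fun_eq_iff)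
  ultimately show "\<exists>a b. (a \<noteq> 0 \<or> b \<noteq> 0) \<and>
       (\<forall>v\<in>?V. ?N (\<lambda>v. a * x v + b * y v) v = \<mu> * (a * x v + b * y v))"
    using ab(1) by (intro exI[of _ a] exI[of _ b]) simp
qed

section \<open>Connectedness and the signs of eigenfunctions\<close>

lemma rtrancl_on_sym_eq:
  assumes "E \<subseteq> V \<times> V" "u \<in> V"
  shows "(u, v) \<in> rtrancl_on V E \<longleftrightarrow> (u, v) \<in> E\<^sup>*"
proof
  assume "(u, v) \<in> rtrancl_on V E"
  thus "(u, v) \<in> E\<^sup>*"
    by (induct rule: rtrancl_on_induct) (auto intro: rtrancl_into_rtrancl)
next
  assume "(u, v) \<in> E\<^sup>*"
  thus "(u, v) \<in> rtrancl_on V E"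
    by (induct rule: rtrancl_induct) (use assms in \<open>auto intro: rtrancl_on_into_rtrancl_on\<close>)
qed

lemma pair_graph_connected_iff:
  assumes "pair_graph G"
  shows "Digraph_Component.connected (with_proj G) \<longleftrightarrow>
    pverts G \<noteq> {} \<and> (\<forall>u\<in>pverts G. \<forall>v\<in>pverts G. (u, v) \<in> (parcs G)\<^sup>*)"
proof -
  note E = pair_graph_arcs[OF assms]
  have "parcs (mk_symmetric (with_proj G)) = parcs G"
    using E(2) by (auto simp: mk_symmetric_def dest: symD)
  moreover have "pverts (mk_symmetric (with_proj G)) = pverts G" by (simp add: mk_symmetric_def)
  ultimately show ?thesis
    using rtrancl_on_sym_eq[OF E(1)]
    by (simp add: Digraph_Component.connected_def strongly_connected_def reachable_def)
qed

locale conn_graph =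
  fixes G :: "'a pair_pre_digraph" and V E
  assumes graph: "pair_graph G"
    and card_ge2: "2 \<le> card (pverts G)"
    and conn: "\<And>u v. u \<in> pverts G \<Longrightarrow> v \<in> pverts G \<Longrightarrow> (u, v) \<in> (parcs G)\<^sup>*"
    and V_eq: "V = pverts G" and E_eq: "E = parcs G"
begin

abbreviation "N \<equiv> nbr_sum E"

lemma E_V: "E \<subseteq> V \<times> V" and sym: "sym E" and irr: "irrefl E" and fin: "finite V"
  using pair_graph_arcs[OF graph] by (auto simp: V_eq E_eq)

lemma E_sym: "(u, v) \<in> E \<Longrightarrow> (v, u) \<in> E" using sym by (rule symD)

lemma E_in: "(u, v) \<in> E \<Longrightarrow> u \<in> V" "(u, v) \<in> E \<Longrightarrow> v \<in> V" using E_V by auto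

lemma fin_nbrs: "finite (E `` {v})"
  by (rule finite_subset[OF _ fin]) (auto dest: E_in)

lemma nbrs_in: "E `` {v} \<subseteq> V" by (auto dest: E_in)

lemma nbr_sum_alt: "N x v = (\<Sum>u\<in>V. if (v, u) \<in> E then x u else 0)"
  unfolding nbr_sum_def by (rule sum.mono_neutral_cong_left) (use fin nbrs_in in auto)

lemma nbr_sum_sym: "(\<Sum>v\<in>V. x v * N y v) = (\<Sum>v\<in>V. y v * N x v)"
proof -
  have "(\<Sum>v\<in>V. x v * N y v) = (\<Sum>v\<in>V. \<Sum>u\<in>V. if (v, u) \<in> E then x v * y u else 0)"
    unfolding nbr_sum_alt sum_distrib_left by (intro sum.cong refl) auto
  also have "\<dots> = (\<Sum>u\<in>V. \<Sum>v\<in>V. if (v, u) \<in> E then x v * y u else 0)" by (rule sum.swap)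
  also have "\<dots> = (\<Sum>v\<in>V. y v * N x v)"
    unfolding nbr_sum_alt sum_distrib_left by (intro sum.cong refl) (auto intro: E_sym)
  finally show ?thesis .
qed

lemma conn_closed:
  assumes "u \<in> S" "u \<in> V" "v \<in> V" and "\<And>a b. a \<in> S \<Longrightarrow> (a, b) \<in> E \<Longrightarrow> b \<in> S"
  shows "v \<in> S"
proof -
  have "(u, v) \<in> E\<^sup>*" using conn assms by (simp add: V_eq E_eq)
  thus ?thesis by (induct rule: rtrancl_induct) (use assms in auto)
qed

lemma nbr_sum_ge_single: "(\<And>u. 0 \<le> x u) \<Longrightarrow> (v, u) \<in> E \<Longrightarrow> x u \<le> N x v"
  unfolding nbr_sum_def using fin_nbrs by (intro member_le_sum) auto

lemma nbr_sum_nonneg: "(\<And>u. 0 \<le> x u) \<Longrightarrow> 0 \<le> N x v"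
  unfolding nbr_sum_def by (intro sum_nonneg) auto

text \<open>The Perron-Frobenius argument: at a zero of \<open>y\<close> the equation makes the sum
  of nonnegative neighbour values vanish, so zeros spread along edges to all of
  \<open>V\<close>.\<close>

lemma eigen_nonneg_pos:
  assumes "\<And>v. 0 \<le> y v" "\<And>v. v \<in> V \<Longrightarrow> N y v = \<mu> * y v" "u \<in> V" "y u > 0" "v \<in> V"
  shows "y v > 0"
proof (rule ccontr)
  assume "\<not> y v > 0"
  hence "v \<in> {v \<in> V. y v = 0}" using assms(1)[of v] assms(5) by (simp add: antisym_conv)
  hence "u \<in> {v \<in> V. y v = 0}"
  proof (rule conn_closed)
    fix a b assume a: "a \<in> {v \<in> V. y v = 0}" and ab: "(a, b) \<in> E"
    hence "N y a = 0" using assms(2) by simp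
    hence "y b \<le> 0" using nbr_sum_ge_single[of y, OF assms(1) ab] by simp
    thus "b \<in> {v \<in> V. y v = 0}" using assms(1)[of b] ab E_in by (auto intro: antisym)
  qed (use assms in auto)
  thus False using assms by simp
qed

lemma nbr_sum_cmult: "N (\<lambda>v. a * x v) v = a * N x v"
  by (simp add: nbr_sum_def sum_distrib_left)

lemma nbr_sum_cong: "(\<And>u. (v, u) \<in> E \<Longrightarrow> x u = y u) \<Longrightarrow> N x v = N y v"
  unfolding nbr_sum_def by (rule sum.cong) auto

text \<open>If \<open>e2\<close> has one sign, it has no zeros by connectedness, and
  \<open>e1\<close>, being orthogonal to it, takes both signs. Comparing the absolute value of
  \<open>e1\<close> with \<open>e2\<close> then forces \<open>l1 = lambda2 G\<close>, so that
  \<open>e1\<close> itself serves.\<close>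

lemma lambda2_eigenvector_changes_sign:
  obtains x where "\<And>v. v \<in> V \<Longrightarrow> N x v = lambda2 G * x v" "\<exists>u\<in>V. x u > 0" "\<exists>u\<in>V. x u < 0"
proof -
  note outer = that
  obtain e1 e2 l1 where l1: "lambda2 G \<le> l1" and nz: "\<exists>v\<in>V. e1 v \<noteq> 0" "\<exists>v\<in>V. e2 v \<noteq> 0"
    and orth: "(\<Sum>v\<in>V. e1 v * e2 v) = 0"
    and ev1: "\<And>v. v \<in> V \<Longrightarrow> N e1 v = l1 * e1 v"
    and ev2: "\<And>v. v \<in> V \<Longrightarrow> N e2 v = lambda2 G * e2 v"
    by (rule lambda2_spectral[OF graph card_ge2, folded V_eq E_eq]) (rule that)
  have key: thesis
    if y: "\<And>v. v \<in> V \<Longrightarrow> y v \<ge> 0" and yev: "\<And>v. v \<in> V \<Longrightarrow> N y v = lambda2 G * y v"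
      and ynz: "\<exists>v\<in>V. y v \<noteq> 0" and yo: "(\<Sum>v\<in>V. e1 v * y v) = 0" for y
  proof -
    \<comment> \<open>Cut off outside \<open>V\<close>, because \<open>eigen_nonneg_pos\<close> asks
      for nonnegativity at every argument.\<close>
    define y' where "y' v = (if v \<in> V then y v else 0)" for v
    have y'N: "N y' v = N y v" for v by (rule nbr_sum_cong) (auto simp: y'_def dest: E_in)
    obtain u where "u \<in> V" "y u \<noteq> 0" using ynz by blast
    hence "u \<in> V" "y u > 0" using y[of u] by simp_all
    have pos: "y' v > 0" if "v \<in> V" for v
    proof (rule eigen_nonneg_pos[of y' "lambda2 G" u v])
      show "0 \<le> y' v" for v by (simp add: y'_def y)
      show "N y' v = lambda2 G * y' v" if "v \<in> V" for v
        unfolding y'N using yev[OF that] that by (simp add: y'_def)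
      show "0 < y' u" using \<open>u \<in> V\<close> \<open>0 < y u\<close> by (simp add: y'_def)
    qed fact+
    have pos': "0 \<le> y' v" if "v \<in> V" for v using pos[OF that] by simp
    have yo': "(\<Sum>v\<in>V. e1 v * y' v) = 0" using yo by (simp add: y'_def)
    have "\<exists>v\<in>V. e1 v > 0"
    proof (rule ccontr)
      assume "\<not> ?thesis"
      hence "\<forall>v\<in>V. - (e1 v * y' v) \<ge> 0" using pos' by (auto simp: not_less intro: mult_nonpos_nonneg)
      moreover have "(\<Sum>v\<in>V. - (e1 v * y' v)) = 0" using yo' by (simp add: sum_negf)
      ultimately have "\<forall>v\<in>V. e1 v * y' v = 0" using fin by (subst (asm) sum_nonneg_eq_0_iff) auto
      moreover obtain w where w: "w \<in> V" "e1 w \<noteq> 0" using nz(1) by blast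
      ultimately have "e1 w * y' w = 0" by blast
      thus False using w(2) pos[OF w(1)] by simp
    qed
    moreover have "\<exists>v\<in>V. e1 v < 0"
    proof (rule ccontr)
      assume "\<not> ?thesis"
      hence "\<forall>v\<in>V. e1 v * y' v \<ge> 0" using pos' by (auto simp: not_less)
      hence "\<forall>v\<in>V. e1 v * y' v = 0" using yo' fin by (subst (asm) sum_nonneg_eq_0_iff) auto
      moreover obtain w where w: "w \<in> V" "e1 w \<noteq> 0" using nz(1) by blast
      ultimately have "e1 w * y' w = 0" by blast
      thus False using w(2) pos[OF w(1)] by simp
    qed
    \<comment> \<open>The absolute value of \<open>e1\<close> satisfies the equation for
      \<open>l1\<close> as an inequality; it is paired with the positive eigenfunction
      \<open>y'\<close>, using the symmetry of \<open>N\<close>.\<close>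
    moreover have "l1 = lambda2 G"
    proof -
      have "l1 * (\<Sum>v\<in>V. \<bar>e1 v\<bar> * y' v) \<le> (\<Sum>v\<in>V. N (\<lambda>v. \<bar>e1 v\<bar>) v * y' v)"
        unfolding sum_distrib_left
      proof (rule sum_mono)
        fix v assume v: "v \<in> V"
        have "l1 * \<bar>e1 v\<bar> \<le> \<bar>N e1 v\<bar>" by (simp add: ev1[OF v] abs_mult mult_right_mono)
        also have "\<dots> \<le> N (\<lambda>v. \<bar>e1 v\<bar>) v" unfolding nbr_sum_def by (rule sum_abs)
        finally show "l1 * (\<bar>e1 v\<bar> * y' v) \<le> N (\<lambda>v. \<bar>e1 v\<bar>) v * y' v"
          using pos[OF v] by (simp add: mult.assoc[symmetric] mult_right_mono)
      qed
      also have "\<dots> = (\<Sum>v\<in>V. \<bar>e1 v\<bar> * N y' v)"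
        using nbr_sum_sym[of y' "\<lambda>v. \<bar>e1 v\<bar>"] by (simp add: mult.commute)
      also have "\<dots> = (\<Sum>v\<in>V. \<bar>e1 v\<bar> * (lambda2 G * y' v))"
        by (intro sum.cong refl) (simp add: y'N yev, simp add: y'_def)
      also have "\<dots> = lambda2 G * (\<Sum>v\<in>V. \<bar>e1 v\<bar> * y' v)"
        by (simp add: sum_distrib_left mult_ac)
      finally have "l1 * (\<Sum>v\<in>V. \<bar>e1 v\<bar> * y' v) \<le> lambda2 G * (\<Sum>v\<in>V. \<bar>e1 v\<bar> * y' v)" .
      moreover have "(\<Sum>v\<in>V. \<bar>e1 v\<bar> * y' v) > 0"
      proof -
        obtain w where "w \<in> V" "e1 w \<noteq> 0" using nz by blast
        thus ?thesis using pos pos' fin by (intro sum_pos2[of V w]) auto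
      qed
      ultimately show ?thesis using l1 by simp
    qed
    ultimately show thesis using ev1 by (intro outer[of e1]) simp_all
  qed
  consider "\<exists>u\<in>V. e2 u > 0" "\<exists>u\<in>V. e2 u < 0" | "\<forall>u\<in>V. e2 u \<ge> 0" | "\<forall>u\<in>V. e2 u \<le> 0"
    by (meson not_less)
  thus thesis
  proof cases
    case 1 thus ?thesis using ev2 by (intro outer[of e2]) simp_all
  next
    case 2 thus ?thesis using ev2 nz orth by (intro key[of e2]) simp_all
  next
    case 3
    have "N (\<lambda>v. - e2 v) v = lambda2 G * - e2 v" if "v \<in> V" for v
      using ev2[OF that] nbr_sum_cmult[of "-1" e2 v] by simp
    thus ?thesis by (rule key[of "\<lambda>v. - e2 v", rotated]) (use 3 nz orth in \<open>simp_all add: sum_negf\<close>)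
  qed
qed

end

context conn_graph
begin

text \<open>
  Equality case of the two-dimensional variational bound for a pair of disjointly supported test
  functions: on the span the form is at least \<open>c (a + b)\<^sup>2\<close>, so for \<open>c > 0\<close> it can only
  vanish at multiples of the difference, and for \<open>c = 0\<close> connectedness rules out the other combinations.
\<close>

lemma disjoint_pair_eigenvector:
  assumes yA: "\<And>v. 0 \<le> yA v" and yB: "\<And>v. 0 \<le> yB v" and disj: "\<And>v. yA v = 0 \<or> yB v = 0"
    and nzA: "wA \<in> V" "yA wA > 0" and nzB: "wB \<in> V" "yB wB > 0"
    and c: "c = (\<Sum>v\<in>V. yA v * N yB v)"
    and QA: "c \<le> (\<Sum>v\<in>V. yA v * (N yA v - l * yA v))"
    and QB: "c \<le> (\<Sum>v\<in>V. yB v * (N yB v - l * yB v))"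
    and l: "lambda2 G \<le> l"
  obtains \<beta> where "lambda2 G = l" "0 < \<beta>" "c = 0 \<or> \<beta> = 1"
    "\<And>v. v \<in> V \<Longrightarrow> N yA v - \<beta> * N yB v = l * (yA v - \<beta> * yB v)"
proof -
  define qA where "qA = (\<Sum>v\<in>V. yA v * (N yA v - l * yA v))"
  define qB where "qB = (\<Sum>v\<in>V. yB v * (N yB v - l * yB v))"
  have c2: "c = (\<Sum>v\<in>V. yB v * N yA v)" unfolding c by (rule nbr_sum_sym)
  have c0: "c \<ge> 0" unfolding c by (intro sum_nonneg mult_nonneg_nonneg yA nbr_sum_nonneg yB)
  have Q: "(\<Sum>v\<in>V. (a * yA v + b * yB v) * (N (\<lambda>v. a * yA v + b * yB v) v - l * (a * yA v + b * yB v)))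
      = a\<^sup>2 * qA + b\<^sup>2 * qB + 2 * a * b * c" (is "?L = _") for a b
  proof -
    have "?L = (\<Sum>v\<in>V. a\<^sup>2 * (yA v * (N yA v - l * yA v)) + b\<^sup>2 * (yB v * (N yB v - l * yB v))
        + a * b * (yA v * N yB v) + a * b * (yB v * N yA v))"
    proof (rule sum.cong[OF refl])
      fix v
      show "(a * yA v + b * yB v) * (N (\<lambda>v. a * yA v + b * yB v) v - l * (a * yA v + b * yB v)) =
        a\<^sup>2 * (yA v * (N yA v - l * yA v)) + b\<^sup>2 * (yB v * (N yB v - l * yB v))
        + a * b * (yA v * N yB v) + a * b * (yB v * N yA v)"
        using disj[of v] by (auto simp: nbr_sum_linear algebra_simps power2_eq_square)
    qed
    also have "\<dots> = a\<^sup>2 * qA + b\<^sup>2 * qB + a * b * c + a * b * c"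
      by (simp add: sum.distrib sum_distrib_left[symmetric] qA_def qB_def c[symmetric] c2[symmetric])
    finally show ?thesis by simp
  qed
  have low: "c * (a + b)\<^sup>2 \<le> a\<^sup>2 * qA + b\<^sup>2 * qB + 2 * a * b * c" for a b
  proof -
    have "a\<^sup>2 * c \<le> a\<^sup>2 * qA" "b\<^sup>2 * c \<le> b\<^sup>2 * qB" using QA QB by (auto simp: qA_def qB_def mult_left_mono)
    thus ?thesis by (simp add: power2_sum algebra_simps)
  qed
  have indep: "a = 0 \<and> b = 0" if "\<And>v. v \<in> pverts G \<Longrightarrow> a * yA v + b * yB v = 0" for a b
    using that[of wA] that[of wB] nzA nzB disj[of wA] disj[of wB] by (auto simp: V_eq)
  have Q': "0 \<le> (\<Sum>v\<in>pverts G. z v * (nbr_sum (parcs G) z v - l * z v))"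
    if "\<And>v. z v = a * yA v + b * yB v" for a b z
  proof -
    have z: "z = (\<lambda>v. a * yA v + b * yB v)" using that by (simp add: fun_eq_iff)
    have "0 \<le> c * (a + b)\<^sup>2" using c0 by simp
    thus ?thesis using low[of a b] Q[of a b] unfolding z V_eq[symmetric] E_eq[symmetric] by linarith
  qed
  note two_dim = two_dim_lambda2_ge[OF graph card_ge2, where x = yA and y = yB and \<mu> = l]
  have "l \<le> lambda2 G"
  proof (rule two_dim(1))
    show "a = 0 \<and> b = 0" if "\<And>v. v \<in> pverts G \<Longrightarrow> a * yA v + b * yB v = 0" for a b
      by (rule indep[OF that])
  qed (rule Q')
  hence eq: "lambda2 G = l" using l by simp
  have "\<exists>a b. (a \<noteq> 0 \<or> b \<noteq> 0) \<and>
       (\<forall>v\<in>pverts G. nbr_sum (parcs G) (\<lambda>v. a * yA v + b * yB v) v = l * (a * yA v + b * yB v))"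
  proof (rule two_dim(2))
    show "a = 0 \<and> b = 0" if "\<And>v. v \<in> pverts G \<Longrightarrow> a * yA v + b * yB v = 0" for a b
      by (rule indep[OF that])
  qed (rule Q', simp, rule eq)
  then obtain a b where ab: "a \<noteq> 0 \<or> b \<noteq> 0"
    and ev: "\<And>v. v \<in> V \<Longrightarrow> N (\<lambda>v. a * yA v + b * yB v) v = l * (a * yA v + b * yB v)"
    unfolding V_eq E_eq by blast
  have ev': "a * N yA v + b * N yB v = l * (a * yA v + b * yB v)" if "v \<in> V" for v
    using ev[OF that] by (simp add: nbr_sum_linear)
  have "(\<Sum>v\<in>V. (a * yA v + b * yB v) * (N (\<lambda>v. a * yA v + b * yB v) v - l * (a * yA v + b * yB v))) = 0"
    using ev by simp
  hence z0: "c * (a + b)\<^sup>2 \<le> 0" using low[of a b] Q[of a b] by linarith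
  have "a \<noteq> 0 \<and> b \<noteq> 0 \<and> (c = 0 \<or> b = - a) \<and> b / a < 0"
  proof (cases "c = 0")
    case False
    hence "c > 0" using c0 by simp
    hence "(a + b)\<^sup>2 \<le> 0" using z0 by (simp add: mult_le_0_iff)
    hence "b = - a" by (simp add: eq_neg_iff_add_eq_0 add.commute)
    moreover have "a \<noteq> 0" using ab calculation by auto
    ultimately show ?thesis by simp
  next
    case True
    have noedge: "yA v = 0 \<or> yB u = 0" if "(v, u) \<in> E" for u v
    proof -
      have "yA v * N yB v = 0"
        using True[unfolded c] fin E_in[OF that] yA yB
        by (subst (asm) sum_nonneg_eq_0_iff) (auto intro!: mult_nonneg_nonneg nbr_sum_nonneg)
      thus ?thesis using nbr_sum_ge_single[of yB, OF yB that] yB[of u] by auto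
    qed
    have "a \<noteq> 0"
    proof
      assume "a = 0"
      hence "N yB v = l * yB v" if "v \<in> V" for v using ev'[OF that] ab by simp
      hence "yB wA > 0" using eigen_nonneg_pos[of yB l wB wA] yB nzB nzA by simp
      thus False using disj[of wA] nzA by simp
    qed
    moreover have "b \<noteq> 0"
    proof
      assume "b = 0"
      hence "N yA v = l * yA v" if "v \<in> V" for v using ev'[OF that] ab by simp
      hence "yA wB > 0" using eigen_nonneg_pos[of yA l wA wB] yA nzB nzA by simp
      thus False using disj[of wB] nzB by simp
    qed
    moreover have "\<not> b / a > 0"
    proof
      \<comment> \<open>A nonnegative eigenfunction built from both parts would be positive
        everywhere. As \<open>c = 0\<close> there is no edge from one support to the other, so the
        support of \<open>yA\<close> could never be left.\<close>
      assume ba: "b / a > 0"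
      define y where "y v = yA v + b / a * yB v" for v
      have y0: "y v \<ge> 0" for v unfolding y_def by (intro add_nonneg_nonneg mult_nonneg_nonneg yA yB less_imp_le[OF ba])
      have "N y v = l * y v" if "v \<in> V" for v
      proof -
        have "N y v = N yA v + b / a * N yB v"
          using nbr_sum_linear[of E 1 yA "b / a" yB v] by (simp add: y_def[abs_def])
        also have "\<dots> = (a * N yA v + b * N yB v) / a" using \<open>a \<noteq> 0\<close> by (simp add: add_divide_distrib)
        also have "\<dots> = l * y v" unfolding ev'[OF that] using \<open>a \<noteq> 0\<close>
          by (simp add: y_def add_divide_distrib distrib_left)
        finally show ?thesis .
      qed
      moreover have "y wA > 0" unfolding y_def by (intro add_pos_nonneg mult_nonneg_nonneg yB nzA less_imp_le[OF ba])
      ultimately have pos: "y v > 0" if "v \<in> V" for v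
        using eigen_nonneg_pos[of y l wA v] y0 nzA that by simp
      have "wB \<in> {v \<in> V. yA v > 0}"
      proof (rule conn_closed[of wA])
        fix u v assume u: "u \<in> {v \<in> V. yA v > 0}" and uv: "(u, v) \<in> E"
        hence "yB v = 0" using noedge by force
        moreover have "v \<in> V" using E_in uv by blast
        ultimately show "v \<in> {v \<in> V. yA v > 0}" using pos[of v] by (simp add: y_def)
      qed (use nzA nzB in auto)
      thus False using disj[of wB] nzB by simp
    qed
    ultimately show ?thesis using True 
      by (cases "b / a" "0 :: real" rule: linorder_cases) simp_all
  qed
  hence ba: "a \<noteq> 0" "c = 0 \<or> - (b / a) = 1" "b / a < 0" by (blast, force, blast)
  show ?thesis
  proof (rule that[of "- (b / a)"])
    show "N yA v - - (b / a) * N yB v = l * (yA v - - (b / a) * yB v)" if "v \<in> V" for v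
    proof -
      have "N yA v - - (b / a) * N yB v = (a * N yA v + b * N yB v) / a"
        using ba(1) by (simp add: add_divide_distrib)
      also have "\<dots> = l * (yA v - - (b / a) * yB v)" unfolding ev'[OF that] using ba(1)
        by (simp add: add_divide_distrib distrib_left)
      finally show ?thesis .
    qed
  qed (use ba eq in auto)
qed

end

subsection \<open>Rooted trees\<close>

text \<open>A tree is given by a root, parents and depths; \<open>par\<close> at the root is
  arbitrary. Every edge belongs to exactly one non-root vertex, its child end, so that quadratic
  forms of different trees on \<open>V\<close> can be compared term by term. The clauses force
  \<open>rk\<close> to be the distance to the root.\<close>

definition rooted :: "'a set \<Rightarrow> 'a rel \<Rightarrow> 'a \<Rightarrow> ('a \<Rightarrow> 'a) \<Rightarrow> ('a \<Rightarrow> nat) \<Rightarrow> bool" where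
  "rooted V E w par rk \<longleftrightarrow> finite V \<and> w \<in> V \<and> rk w = 0 \<and>
     (\<forall>e\<in>V - {w}. par e \<in> V \<and> rk e = Suc (rk (par e))) \<and>
     E = (\<lambda>e. (e, par e)) ` (V - {w}) \<union> (\<lambda>e. (par e, e)) ` (V - {w})"

lemma rootedD:
  assumes "rooted V E w par rk"
  shows "finite V" "w \<in> V" "rk w = 0"
    "\<And>e. e \<in> V \<Longrightarrow> e \<noteq> w \<Longrightarrow> par e \<in> V" "\<And>e. e \<in> V \<Longrightarrow> e \<noteq> w \<Longrightarrow> rk e = Suc (rk (par e))"
    "\<And>e. e \<in> V \<Longrightarrow> e \<noteq> w \<Longrightarrow> (e, par e) \<in> E" "\<And>e. e \<in> V \<Longrightarrow> e \<noteq> w \<Longrightarrow> (par e, e) \<in> E"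
  using assms unfolding rooted_def by auto

lemma rooted_edgeE:
  assumes "rooted V E w par rk" "(a, b) \<in> E"
  obtains "a \<in> V" "a \<noteq> w" "b = par a" "b \<in> V" "rk a = Suc (rk b)"
    | "b \<in> V" "b \<noteq> w" "a = par b" "a \<in> V" "rk b = Suc (rk a)"
proof -
  have "(\<exists>e\<in>V - {w}. a = e \<and> b = par e) \<or> (\<exists>e\<in>V - {w}. a = par e \<and> b = e)"
    using assms unfolding rooted_def by auto
  thus thesis
  proof (elim disjE bexE)
    fix e assume e: "e \<in> V - {w}" "a = e \<and> b = par e"
    thus thesis using rootedD(4,5)[OF assms(1), of e] by (intro that(1)) auto
  next
    fix e assume e: "e \<in> V - {w}" "a = par e \<and> b = e"
    thus thesis using rootedD(4,5)[OF assms(1), of e] by (intro that(2)) auto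
  qed
qed

lemma rooted_edge_lower:
  assumes "rooted V E w par rk" "(a, b) \<in> E" "rk b \<le> rk a"
  shows "b = par a"
  by (rule rooted_edgeE[OF assms(1,2)]) (use assms(3) in auto)

lemma rooted_rel:
  assumes "rooted V E w par rk"
  shows "E \<subseteq> V \<times> V" "sym E" "irrefl E"
proof -
  show "E \<subseteq> V \<times> V" using assms unfolding rooted_def by blast
  show "sym E" using assms unfolding rooted_def by (auto simp: sym_def)
  show "irrefl E" unfolding irrefl_def by (auto elim: rooted_edgeE[OF assms])
qed

lemma rooted_rk_zero: "rooted V E w par rk \<Longrightarrow> v \<in> V \<Longrightarrow> rk v = 0 \<Longrightarrow> v = w"
  using rootedD(5) by fastforce

lemma rooted_walk_to_root:
  assumes r: "rooted V E w par rk" and "v \<in> V"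
  shows "(v, w) \<in> E ^^ rk v"
  using assms(2)
proof (induct "rk v" arbitrary: v)
  case 0 thus ?case using rooted_rk_zero[OF r, of v] by simp
next
  case (Suc n)
  hence "v \<noteq> w" using rootedD(3)[OF r] by auto
  note v = rootedD(4-6)[OF r Suc(3) this]
  have "(par v, w) \<in> E ^^ n" using Suc(1)[of "par v"] v Suc(2) by simp
  thus ?case using v(3) Suc(2) by (metis relpow_Suc_I2)
qed

lemma rooted_walk_lipschitz:
  assumes r: "rooted V E w par rk" and "(u, v) \<in> E ^^ n"
  shows "rk v \<le> rk u + n"
  using assms(2)
proof (induct n arbitrary: v)
  case (Suc n)
  then obtain y where "(u, y) \<in> E ^^ n" "(y, v) \<in> E" by auto
  thus ?case using Suc(1)[of y] by (auto elim: rooted_edgeE[OF r])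
qed simp

lemma relpow_sym: "sym E \<Longrightarrow> (u, v) \<in> E ^^ n \<Longrightarrow> (v, u) \<in> E ^^ n"
proof (induct n arbitrary: v)
  case (Suc n)
  then obtain y where "(u, y) \<in> E ^^ n" "(y, v) \<in> E" by auto
  thus ?case using Suc by (metis relpow_Suc_I2 symD)
qed simp

text \<open>Both sides are the distance between the roots: the descent of one root to the other is a
  walk, and a walk changes the rank by at most its length.\<close>

lemma rooted_rk_sym:
  assumes "rooted V E w par rk" "rooted V E w' par' rk'"
  shows "rk w' = rk' w"
proof -
  have "rk w' \<le> rk' w" if "rooted V E w par rk" "rooted V E w' par' rk'" for w w' par par' rk rk'
    using rooted_walk_lipschitz[OF that(1) relpow_sym[OF rooted_rel(2)[OF that(2)] relpow_sym[OF rooted_rel(2)[OF that(2)]]], of w w']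
      rooted_walk_to_root[OF that(2), of w] rootedD(2,3)[OF that(1)] by simp
  from this[OF assms] this[OF assms(2,1)] show ?thesis by simp
qed

lemma rooted_conn:
  assumes r: "rooted V E w par rk" and "u \<in> V" "v \<in> V"
  shows "(u, v) \<in> E\<^sup>*"
proof -
  have "(u, w) \<in> E\<^sup>*" "(v, w) \<in> E\<^sup>*" using rooted_walk_to_root[OF r] assms relpow_imp_rtrancl by blast+
  moreover have "sym (E\<^sup>*)" by (rule sym_rtrancl[OF rooted_rel(2)[OF r]])
  ultimately show ?thesis by (meson rtrancl_trans symD)
qed

lemma rooted_pair_graph:
  assumes "rooted (pverts G) (parcs G) w par rk"
  shows "pair_graph G"
proof -
  note E = rooted_rel[OF assms]
  have "finite (parcs G)" using finite_subset[OF E(1)] rootedD(1)[OF assms] by simp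
  thus ?thesis
    using E rootedD(1)[OF assms]
    by unfold_locales (auto simp: symmetric_def irrefl_def)
qed

lemma pcas_nth:
  assumes "pcas u p v"
  shows "length (pawalk_verts u p) = Suc (length p)" "pawalk_verts u p ! 0 = u"
    "pawalk_verts u p ! length p = v"
    "\<And>i. i < length p \<Longrightarrow> p ! i = (pawalk_verts u p ! i, pawalk_verts u p ! Suc i)"
proof -
  have "length (pawalk_verts u p) = Suc (length p) \<and> pawalk_verts u p ! 0 = u \<and>
    pawalk_verts u p ! length p = v \<and>
    (\<forall>i < length p. p ! i = (pawalk_verts u p ! i, pawalk_verts u p ! Suc i))"
    using assms
  proof (induct p arbitrary: u)
    case (Cons e p)
    hence "fst e = u" "pcas (snd e) p v" by auto
    with Cons(1)[of "snd e"] show ?case by (auto simp: nth_Cons' prod_eq_iff gr0_conv_Suc)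
  qed simp
  thus "length (pawalk_verts u p) = Suc (length p)" "pawalk_verts u p ! 0 = u"
    "pawalk_verts u p ! length p = v"
    "\<And>i. i < length p \<Longrightarrow> p ! i = (pawalk_verts u p ! i, pawalk_verts u p ! Suc i)" by auto
qed

text \<open>A vertex of maximal rank on a cycle would have two different parents.\<close>

lemma rooted_no_cycle:
  assumes r: "rooted V E w par rk" and E: "\<And>i. i < k \<Longrightarrow> (c i, c (Suc i mod k)) \<in> E"
    and inj: "inj_on c {..<k}" and k: "3 \<le> k"
  shows False
proof -
  have "Max ((\<lambda>i. rk (c i)) ` {..<k}) \<in> (\<lambda>i. rk (c i)) ` {..<k}"
    using k by (intro Max_in) (auto simp: lessThan_empty_iff)
  then obtain m where m: "m < k" "rk (c m) = Max ((\<lambda>i. rk (c i)) ` {..<k})" by auto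
  have max: "rk (c i) \<le> rk (c m)" if "i < k" for i using that unfolding m(2) by (intro Max_ge) auto
  note m = m(1) max
  define m1 where "m1 = Suc m mod k"
  define m2 where "m2 = (if m = 0 then k - 1 else m - 1)"
  have lt: "m1 < k" "m2 < k" using k m(1) by (auto simp: m1_def m2_def)
  have "m1 \<noteq> m2" using k m(1) by (auto simp: m1_def m2_def mod_Suc split: if_splits)
  have "Suc m2 mod k = m" using k m(1) by (auto simp: m2_def)
  hence e2: "(c m2, c m) \<in> E" using E[OF lt(2)] by simp
  have "c m1 = par (c m)"
    by (rule rooted_edge_lower[OF r]) (use E[OF m(1)] m(2)[OF lt(1)] in \<open>auto simp: m1_def\<close>)
  moreover have "c m2 = par (c m)"
    by (rule rooted_edge_lower[OF r]) (use symD[OF rooted_rel(2)[OF r] e2] m(2)[OF lt(2)] in auto)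
  ultimately show False using \<open>m1 \<noteq> m2\<close> inj_onD[OF inj, of m1 m2] lt by simp
qed

lemma rooted_undirected_tree:
  assumes r: "rooted (pverts G) (parcs G) w par rk"
  shows "undirected_tree G"
proof -
  note pg = rooted_pair_graph[OF r]
  interpret pair_graph G by (rule pg)
  have "Digraph_Component.connected (with_proj G)"
    unfolding pair_graph_connected_iff[OF pg] using rooted_conn[OF r] rootedD(2)[OF r] by blast
  moreover have False if cyc: "pre_digraph.cycle (with_proj G) p" and len: "3 \<le> length p" for p
  proof -
    from cyc obtain u where p: "awalk u p u" "distinct (tl (pawalk_verts u p))"
      unfolding cycle_def by auto
    hence cas: "pcas u p u" and sub: "set p \<subseteq> parcs G" by (auto simp: awalk_def)
    note nth = pcas_nth[OF cas]
    define k where "k = length p"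
    define c where "c i = pawalk_verts u p ! i" for i
    have ck: "c k = c 0" using nth by (simp add: c_def k_def)
    have edge: "(c i, c (Suc i)) \<in> parcs G" if "i < k" for i
      using nth(4)[of i] sub that nth_mem[of i p] by (auto simp: c_def k_def)
    have tln: "tl (pawalk_verts u p) ! i = c (Suc i)" if "i < k" for i
      using that nth(1) by (simp add: c_def k_def nth_tl)
    show False
    proof (rule rooted_no_cycle[OF r])
      \<comment> \<open>Distinctness is known for the tail of the vertex list, hence the shift of
        the indices by one.\<close>
      show "(c (Suc i), c (Suc (Suc i mod k))) \<in> parcs G" if "i < k" for i
      proof (cases "Suc i = k")
        case True
        moreover have "0 < k" using len by (simp add: k_def del: length_greater_0_conv)
        ultimately show ?thesis using edge[of 0] ck by simp
      next
        case False thus ?thesis using edge[of "Suc i"] that by simp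
      qed
      show "inj_on (\<lambda>i. c (Suc i)) {..<k}"
      proof (rule inj_onI)
        fix i j assume ij: "i \<in> {..<k}" "j \<in> {..<k}" "c (Suc i) = c (Suc j)"
        thus "i = j"
          using nth_eq_iff_index_eq[OF p(2), of i j] tln[of i] tln[of j] nth(1) by (simp add: k_def)
      qed
      show "3 \<le> k" using len k_def by simp
    qed
  qed
  ultimately show ?thesis using pg unfolding undirected_tree_def by blast
qed

lemma pcas_zip:
  "pcas u (zip (u # vs) vs) (last (u # vs)) \<and> pawalk_verts u (zip (u # vs) vs) = u # vs"
  by (induct vs arbitrary: u) auto

lemma undirected_tree_no_closed_list:
  assumes T: "undirected_tree G"
    and d: "distinct (vs @ [z])" and len: "2 \<le> length vs"
    and E: "\<And>i. i < Suc (length vs) \<Longrightarrow> ((z # vs @ [z]) ! i, (z # vs @ [z]) ! Suc i) \<in> parcs G"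
  shows False
proof -
  have pg: "pair_graph G" using T by (simp add: undirected_tree_def)
  interpret pair_graph G by (rule pg)
  define p where "p = zip (z # vs @ [z]) (vs @ [z])"
  have pc: "pcas z p z" "pawalk_verts z p = z # vs @ [z]"
    using pcas_zip[of z "vs @ [z]"] by (auto simp: p_def)
  have "set p \<subseteq> parcs G" using E by (fastforce simp: p_def set_zip)
  moreover have "z \<in> pverts G" using E[of 0] in_arcsD1 by simp
  ultimately have "awalk z p z" using pc by (simp add: awalk_def)
  hence "pre_digraph.cycle (with_proj G) p" unfolding cycle_def using pc d by (auto simp: p_def)
  moreover have "3 \<le> length p" using len by (simp add: p_def)
  ultimately show False using T by (auto simp: undirected_tree_def)
qed

text \<open>
  Ranks are distances to the root. Two different neighbours of \<open>z\<close> whose ranks do not exceed that of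
  \<open>z\<close> would close a cycle through \<open>z\<close> where their descents to the root first meet.
\<close>

lemma undirected_tree_rooted:
  assumes T: "undirected_tree G" and w: "w \<in> pverts G"
  obtains par rk where "rooted (pverts G) (parcs G) w par rk"
proof -
  define V E where "V = pverts G" and "E = parcs G"
  have pg: "pair_graph G" using T by (simp add: undirected_tree_def)
  note E = pair_graph_arcs[OF pg, folded V_def E_def]
  have conn: "(u, v) \<in> E\<^sup>*" if "u \<in> V" "v \<in> V" for u v
    using T that unfolding undirected_tree_def pair_graph_connected_iff[OF pg] V_def E_def by blast
  have wV: "w \<in> V" using w V_def by simp
  define rk where "rk z = (LEAST n. (z, w) \<in> E ^^ n)" for z
  have rk: "(z, w) \<in> E ^^ rk z" if "z \<in> V" for z
  proof -
    have "\<exists>n. (z, w) \<in> E ^^ n" using conn[OF that wV] rtrancl_imp_relpow by blast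
    thus ?thesis unfolding rk_def by (rule LeastI_ex)
  qed
  have rk_le: "rk z \<le> n" if "(z, w) \<in> E ^^ n" for z n unfolding rk_def using that by (rule Least_le)
  have rkw: "rk w = 0" using rk_le[of w 0] by simp
  have rk0: "z = w" if "z \<in> V" "rk z = 0" for z using rk[OF that(1)] that(2) by simp
  have EV: "a \<in> V" "b \<in> V" if "(a, b) \<in> E" for a b using E(1) that by auto
  have step: "rk a \<le> Suc (rk b)" if "(a, b) \<in> E" for a b
    using rk[OF EV(2)[OF that]] that by (intro rk_le) (rule relpow_Suc_I2)
  have ex: "\<exists>y. (z, y) \<in> E \<and> rk z = Suc (rk y)" if z: "z \<in> V" "z \<noteq> w" for z
  proof -
    have "rk z \<noteq> 0" using rk0 z by blast
    then obtain n where n: "rk z = Suc n" by (cases "rk z") auto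
    hence "(z, w) \<in> E ^^ Suc n" using rk[OF z(1)] by simp
    then obtain y where y: "(z, y) \<in> E" "(y, w) \<in> E ^^ n" by (meson relpow_Suc_D2)
    have "rk y = n" using rk_le[OF y(2)] step[OF y(1)] n by simp
    thus ?thesis using y(1) n by blast
  qed
  define par where "par z = (SOME y. (z, y) \<in> E \<and> rk z = Suc (rk y))" for z
  have par: "(z, par z) \<in> E" "rk z = Suc (rk (par z))" if "z \<in> V" "z \<noteq> w" for z
    using someI_ex[OF ex[OF that]] unfolding par_def by auto
  have iter: "(par ^^ i) a \<in> V \<and> rk ((par ^^ i) a) + i = rk a" if "a \<in> V" "i \<le> rk a" for a i
    using that(2)
  proof (induct i)
    case (Suc i)
    let ?b = "(par ^^ i) a"
    from Suc have b: "?b \<in> V" "rk ?b + i = rk a" by auto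
    hence "?b \<noteq> w" using Suc(2) rkw by auto
    from par[OF b(1) this] b Suc(2) EV show ?case by auto
  qed (use that in simp)
  have iterw: "(par ^^ rk a) a = w" if "a \<in> V" for a using iter[OF that, of "rk a"] rk0 by simp
  have iterE: "((par ^^ i) a, (par ^^ Suc i) a) \<in> E" if "a \<in> V" "i < rk a" for a i
  proof -
    have "(par ^^ i) a \<noteq> w" using iter[OF that(1), of i] that(2) rkw by auto
    thus ?thesis using par(1) iter[OF that(1), of i] that(2) by simp
  qed
  have core: False if za: "(z, a) \<in> E" and zb: "(z, b) \<in> E" and ab: "a \<noteq> b"
    and le: "rk a \<le> rk z" "rk b \<le> rk z" for z a b
  proof -
    note aV = EV(2)[OF za] and bV = EV(2)[OF zb]
    \<comment> \<open>\<open>s\<close> counts the steps of both descents up to a common vertex; the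
      least such number gives the first meeting point, before which the two descents are
      disjoint.\<close>
    define ok where "ok s \<longleftrightarrow> (\<exists>i j. s = i + j \<and> i \<le> rk a \<and> j \<le> rk b \<and> (par ^^ i) a = (par ^^ j) b)" for s
    have "ok (rk a + rk b)" unfolding ok_def
      by (intro exI[of _ "rk a"] exI[of _ "rk b"]) (simp add: iterw[OF aV] iterw[OF bV])
    hence "ok (LEAST s. ok s)" by (rule LeastI)
    then obtain i j where ij: "(LEAST s. ok s) = i + j" "i \<le> rk a" "j \<le> rk b" "(par ^^ i) a = (par ^^ j) b"
      unfolding ok_def by blast
    have least: "i + j \<le> s + t" if "s \<le> rk a" "t \<le> rk b" "(par ^^ s) a = (par ^^ t) b" for s t
      unfolding ij(1)[symmetric] by (rule Least_le) (use that in \<open>auto simp: ok_def\<close>)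
    define p where "p s = (par ^^ s) a" for s
    define q where "q t = (par ^^ t) b" for t
    have rkp: "rk (p s) + s = rk a" if "s \<le> rk a" for s using iter[OF aV that] by (simp add: p_def)
    have rkq: "rk (q s) + s = rk b" if "s \<le> rk b" for s using iter[OF bV that] by (simp add: q_def)
    have azb: "a \<noteq> z" "b \<noteq> z" using za zb E(3) by (auto simp: irrefl_def)
    have pz: "p s \<noteq> z" if "s \<le> rk a" for s using rkp[OF that] le azb by (cases s) (auto simp: p_def)
    have qz: "q s \<noteq> z" if "s \<le> rk b" for s using rkq[OF that] le azb by (cases s) (auto simp: q_def)
    \<comment> \<open>The closed walk without its end \<open>z\<close>: from \<open>a\<close> down
      to the meeting point and from there back up to \<open>b\<close>.\<close>
    define vs where "vs = map p [0..<Suc i] @ map q (rev [0..<j])"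
    have len: "length vs = Suc i + j" by (simp add: vs_def)
    have vs_nth: "vs ! s = (if s \<le> i then p s else q (i + j - s))" if "s < Suc i + j" for s
      using that unfolding vs_def by (auto simp: nth_append rev_nth add.commute[of j i] simp del: upt_Suc)
    have "distinct (map p [0..<Suc i])"
      unfolding distinct_map
    proof (intro conjI inj_onI)
      fix s t assume "s \<in> set [0..<Suc i]" "t \<in> set [0..<Suc i]" "p s = p t"
      hence "s \<le> i" "t \<le> i" "p s = p t" by auto
      thus "s = t" using rkp[of s] rkp[of t] ij(2) by simp
    qed simp
    moreover have "distinct (map q (rev [0..<j]))"
      unfolding distinct_map
    proof (intro conjI inj_onI)
      fix s t assume "s \<in> set (rev [0..<j])" "t \<in> set (rev [0..<j])" "q s = q t"
      thus "s = t" using rkq[of s] rkq[of t] ij(3) by simp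
    qed simp
    moreover have "p s \<noteq> q t" if "s \<le> i" "t < j" for s t
      using least[of s t] that ij unfolding p_def q_def by auto
    hence "set (map p [0..<Suc i]) \<inter> set (map q (rev [0..<j])) = {}" by force
    moreover have "z \<notin> set vs"
    proof
      assume "z \<in> set vs"
      then consider s where "s \<le> i" "z = p s" | t where "t < j" "z = q t"
        by (auto simp: vs_def less_Suc_eq_le simp del: upt_Suc)
      thus False
      proof cases
        case 1 thus ?thesis using pz[of s] ij by simp
      next
        case 2 thus ?thesis using qz[of t] ij by simp
      qed
    qed
    ultimately have d: "distinct (vs @ [z])" by (simp add: vs_def del: upt_Suc)
    have "i + j \<noteq> 0"
    proof
      assume "i + j = 0"
      thus False using ij(4) ab by simp
    qed
    hence len2: "2 \<le> length vs" using len by linarith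
    show False
    proof (rule undirected_tree_no_closed_list[OF T d len2, folded E_def])
      fix s assume s: "s < Suc (length vs)"
      show "((z # vs @ [z]) ! s, (z # vs @ [z]) ! Suc s) \<in> E"
      proof (cases s)
        case 0
        thus ?thesis using za len vs_nth[of 0] by (simp add: nth_append p_def)
      next
        case (Suc t)
        consider "t < i" | "t = i" "j = 0" | "t = i" "j \<noteq> 0" | "i < t" "Suc t < Suc i + j" | "i < t" "Suc t = Suc i + j"
          using Suc s len by linarith
        thus ?thesis
        proof cases
          case 1
          thus ?thesis using Suc len iterE[OF aV, of t] ij(2) by (simp add: nth_append vs_nth p_def)
        next
          case 2
          thus ?thesis using Suc len ij(4) symD[OF E(2) zb] by (simp add: nth_append vs_nth p_def)
        next
          case 3
          have "((par ^^ (j - 1)) b, (par ^^ j) b) \<in> E" using iterE[OF bV, of "j - 1"] ij(3) 3 by simp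
          from symD[OF E(2) this] show ?thesis using 3 Suc len ij(4) by (simp add: nth_append vs_nth p_def q_def)
        next
          case 4
          have "i + j - t = Suc (i + j - Suc t)" using 4 by simp
          hence "(q (i + j - Suc t), q (i + j - t)) \<in> E"
            using iterE[OF bV, of "i + j - Suc t"] ij(3) 4 unfolding q_def by simp
          from symD[OF E(2) this] show ?thesis using 4 Suc len by (simp add: nth_append vs_nth)
        next
          case 5
          thus ?thesis using Suc len symD[OF E(2) zb] by (simp add: nth_append vs_nth q_def)
        qed
      qed
    qed
  qed
  have lower: "a \<noteq> w \<and> b = par a" if e: "(a, b) \<in> E" and le: "rk b \<le> rk a" for a b
  proof -
    have "a \<noteq> w"
    proof
      assume "a = w"
      hence "b = w" using rk0[of b] EV[OF e] le rkw by simp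
      thus False using e \<open>a = w\<close> E(3) by (auto simp: irrefl_def)
    qed
    moreover have "b = par a"
      using core[OF e par(1)[OF EV(1)[OF e]]] \<open>a \<noteq> w\<close> le par(2)[OF EV(1)[OF e]] by fastforce
    ultimately show ?thesis by simp
  qed
  have "E = (\<lambda>e. (e, par e)) ` (V - {w}) \<union> (\<lambda>e. (par e, e)) ` (V - {w})"
  proof (intro equalityI subsetI)
    fix ab assume "ab \<in> E"
    then obtain a b where ab: "ab = (a, b)" "(a, b) \<in> E" by (cases ab) auto
    have ba: "(b, a) \<in> E" using symD[OF E(2) ab(2)] .
    consider "rk b \<le> rk a" | "rk a \<le> rk b" by linarith
    thus "ab \<in> (\<lambda>e. (e, par e)) ` (V - {w}) \<union> (\<lambda>e. (par e, e)) ` (V - {w})"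
    proof cases
      case 1 thus ?thesis using lower[OF ab(2)] ab EV[OF ab(2)] by auto
    next
      case 2 thus ?thesis using lower[OF ba] ab EV[OF ab(2)] by auto
    qed
  next
    fix ab assume "ab \<in> (\<lambda>e. (e, par e)) ` (V - {w}) \<union> (\<lambda>e. (par e, e)) ` (V - {w})"
    thus "ab \<in> E" using par symD[OF E(2) par(1)] by auto
  qed
  hence "rooted V E w par rk" unfolding rooted_def using E(4) wV rkw par(2) EV(2)[OF par(1)] by blast
  thus thesis using that unfolding V_def E_def by blast
qed

section \<open>Distances and the diameter in terms of ranks\<close>

lemma awalk_relpow:
  assumes "pair_graph G"
  shows "(\<exists>p. pre_digraph.awalk (with_proj G) u p v \<and> length p = n) \<longleftrightarrow>
    u \<in> pverts G \<and> (u, v) \<in> parcs G ^^ n"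
proof -
  interpret pair_graph G by fact
  show ?thesis
  proof (induct n arbitrary: u)
    case 0 show ?case by (auto simp: awalk_def)
  next
    case (Suc n)
    have "(\<exists>p. awalk u p v \<and> length p = Suc n) \<longleftrightarrow>
        (\<exists>y. (u, y) \<in> parcs G \<and> (\<exists>p. awalk y p v \<and> length p = n))"
    proof
      assume "\<exists>p. awalk u p v \<and> length p = Suc n"
      then obtain e p where "awalk u (e # p) v" "length p = n" by (auto simp: length_Suc_conv)
      thus "\<exists>y. (u, y) \<in> parcs G \<and> (\<exists>p. awalk y p v \<and> length p = n)"
        by (intro exI[of _ "snd e"]) (auto simp: awalk_Cons_iff)
    next
      assume "\<exists>y. (u, y) \<in> parcs G \<and> (\<exists>p. awalk y p v \<and> length p = n)"
      then obtain y p where "(u, y) \<in> parcs G" "awalk y p v" "length p = n" by blast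
      thus "\<exists>p. awalk u p v \<and> length p = Suc n"
        by (intro exI[of _ "(u, y) # p"]) (auto simp: awalk_Cons_iff)
    qed
    also have "\<dots> \<longleftrightarrow> u \<in> pverts G \<and> (u, v) \<in> parcs G ^^ Suc n"
      unfolding Suc relpow.simps relpow_commute[symmetric] using wellformed' by auto
    finally show ?case .
  qed
qed

lemma rooted_distance:
  assumes r: "rooted (pverts G) (parcs G) w par rk" and v: "v \<in> pverts G"
  shows "wf_digraph.\<mu> (with_proj G) (\<lambda>_. 1) w v = ereal (real (rk v))"
proof -
  note pg = rooted_pair_graph[OF r]
  interpret pair_graph G by (rule pg)
  have cost: "awalk_cost (\<lambda>_. 1) p = real (length p)" for p :: "('a \<times> 'a) list"
    by (induct p) auto
  have wV: "w \<in> pverts G" using rootedD(2)[OF r] .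
  have "(w, v) \<in> parcs G ^^ rk v" by (rule relpow_sym[OF rooted_rel(2)[OF r] rooted_walk_to_root[OF r v]])
  then obtain p where p: "awalk w p v" "length p = rk v" using awalk_relpow[OF pg, of w v "rk v"] wV by blast
  show ?thesis
  proof (rule antisym)
    show "\<mu> (\<lambda>_. 1) w v \<le> ereal (real (rk v))" using min_cost_le_walk_cost[OF p(1), of "\<lambda>_. 1"] by (simp add: cost p(2))
    show "ereal (real (rk v)) \<le> \<mu> (\<lambda>_. 1) w v"
      unfolding \<mu>_def
    proof (rule INF_greatest)
      fix q assume "q \<in> {p. awalk w p v}"
      hence "(w, v) \<in> parcs G ^^ length q" using awalk_relpow[OF pg] by blast
      hence "rk v \<le> length q" using rooted_walk_lipschitz[OF r] rootedD(3)[OF r] by fastforce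
      thus "ereal (real (rk v)) \<le> ereal (awalk_cost (\<lambda>_. 1) q)" by (simp add: cost)
    qed
  qed
qed

text \<open>Distances are ranks with respect to a rooting at one end, and the supremum over finitely
  many pairs is a maximum. From here on the diameter is handled through ranks alone.\<close>

lemma graph_diameter_eq_iff:
  assumes T: "undirected_tree G" and ne: "pverts G \<noteq> {}"
  shows "graph_diameter G = ereal (real d) \<longleftrightarrow>
    (\<forall>u par rk v. rooted (pverts G) (parcs G) u par rk \<longrightarrow> v \<in> pverts G \<longrightarrow> rk v \<le> d) \<and>
    (\<exists>u par rk v. rooted (pverts G) (parcs G) u par rk \<and> v \<in> pverts G \<and> rk v = d)"
proof -
  define V where "V = pverts G"
  define D where "D = (\<lambda>(u, v). wf_digraph.\<mu> (with_proj G) (\<lambda>_. 1) u v) ` (V \<times> V)"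
  have fin: "finite V" using T pair_graph_arcs(4) by (auto simp: undirected_tree_def V_def)
  hence "finite D" "D \<noteq> {}" using ne by (auto simp: D_def V_def)
  hence "graph_diameter G = Max D" unfolding graph_diameter_def D_def V_def by (simp add: Max_Sup)
  hence "graph_diameter G = ereal (real d) \<longleftrightarrow> ereal (real d) \<in> D \<and> (\<forall>a\<in>D. a \<le> ereal (real d))"
    using Max_eq_iff[OF \<open>finite D\<close> \<open>D \<noteq> {}\<close>] by auto
  also have "(\<forall>a\<in>D. a \<le> ereal (real d)) \<longleftrightarrow>
    (\<forall>u par rk v. rooted V (parcs G) u par rk \<longrightarrow> v \<in> V \<longrightarrow> rk v \<le> d)"
  proof (intro iffI allI impI ballI)
    fix u par rk v assume "\<forall>a\<in>D. a \<le> ereal (real d)" and r: "rooted V (parcs G) u par rk" and v: "v \<in> V"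
    moreover have "u \<in> V" using rootedD(2)[OF r] .
    ultimately have "wf_digraph.\<mu> (with_proj G) (\<lambda>_. 1) u v \<le> ereal (real d)" by (auto simp: D_def)
    thus "rk v \<le> d" using rooted_distance[OF r[unfolded V_def]] v by (simp add: V_def)
  next
    fix a assume H: "\<forall>u par rk v. rooted V (parcs G) u par rk \<longrightarrow> v \<in> V \<longrightarrow> rk v \<le> d" and "a \<in> D"
    then obtain u v where uv: "u \<in> V" "v \<in> V" "a = wf_digraph.\<mu> (with_proj G) (\<lambda>_. 1) u v" by (auto simp: D_def)
    obtain par rk where r: "rooted V (parcs G) u par rk"
      using undirected_tree_rooted[OF T] uv(1) unfolding V_def by blast
    show "a \<le> ereal (real d)" using H r uv rooted_distance[OF r[unfolded V_def]] by (auto simp: V_def)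
  qed
  also have "ereal (real d) \<in> D \<longleftrightarrow> (\<exists>u par rk v. rooted V (parcs G) u par rk \<and> v \<in> V \<and> rk v = d)"
  proof
    assume "ereal (real d) \<in> D"
    then obtain u v where uv: "u \<in> V" "v \<in> V" "ereal (real d) = wf_digraph.\<mu> (with_proj G) (\<lambda>_. 1) u v"
      by (auto simp: D_def)
    obtain par rk where r: "rooted V (parcs G) u par rk"
      using undirected_tree_rooted[OF T] uv(1) unfolding V_def by blast
    have "rk v = d" using uv rooted_distance[OF r[unfolded V_def]] by (simp add: V_def)
    thus "\<exists>u par rk v. rooted V (parcs G) u par rk \<and> v \<in> V \<and> rk v = d" using r uv(2) by blast
  next
    assume "\<exists>u par rk v. rooted V (parcs G) u par rk \<and> v \<in> V \<and> rk v = d"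
    then obtain u par rk v where r: "rooted V (parcs G) u par rk" "v \<in> V" "rk v = d" by blast
    have "wf_digraph.\<mu> (with_proj G) (\<lambda>_. 1) u v = ereal (real d)"
      using rooted_distance[OF r(1)[unfolded V_def]] r by (simp add: V_def)
    thus "ereal (real d) \<in> D" using rootedD(2)[OF r(1)] r(2) unfolding D_def by force
  qed
  finally show ?thesis unfolding V_def by blast
qed

text \<open>Each edge is counted at its child \<open>e\<close>, once in either direction. With a
  common root, changing parents changes single terms of the right-hand side.\<close>

lemma rooted_quadratic_form:
  fixes x y :: "'a \<Rightarrow> real"
  assumes r: "rooted V E w par rk"
  shows "(\<Sum>v\<in>V. x v * nbr_sum E y v) = (\<Sum>e\<in>V - {w}. x e * y (par e) + x (par e) * y e)"
proof -
  note E = rooted_rel[OF r] and fin = rootedD(1)[OF r]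
  let ?D = "(\<lambda>e. (e, par e)) ` (V - {w})" and ?U = "(\<lambda>e. (par e, e)) ` (V - {w})"
  have E_eq: "E = ?D \<union> ?U" using r by (simp add: rooted_def)
  have disj: "?D \<inter> ?U = {}"
  proof (rule ccontr)
    assume "?D \<inter> ?U \<noteq> {}"
    then obtain e f where "e \<in> V - {w}" "f \<in> V - {w}" "e = par f" "par e = f" by auto
    thus False using rootedD(5)[OF r, of e] rootedD(5)[OF r, of f] by auto
  qed
  have finE: "finite (E `` {v})" for v by (rule finite_subset[OF _ fin]) (use E(1) in auto)
  have "(\<Sum>v\<in>V. x v * nbr_sum E y v) = (\<Sum>v\<in>V. \<Sum>u\<in>E `` {v}. x v * y u)"
    by (simp add: nbr_sum_def sum_distrib_left)
  also have "\<dots> = (\<Sum>(v, u)\<in>Sigma V (\<lambda>v. E `` {v}). x v * y u)"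
    using fin finE by (intro sum.Sigma) auto
  also have "Sigma V (\<lambda>v. E `` {v}) = ?D \<union> ?U" using E(1) E_eq by auto
  also have "(\<Sum>(v, u)\<in>?D \<union> ?U. x v * y u) = (\<Sum>(v, u)\<in>?D. x v * y u) + (\<Sum>(v, u)\<in>?U. x v * y u)"
    using fin disj by (intro sum.union_disjoint) auto
  also have "(\<Sum>(v, u)\<in>?D. x v * y u) = (\<Sum>e\<in>V - {w}. x e * y (par e))"
    by (subst sum.reindex) (auto intro: inj_onI)
  also have "(\<Sum>(v, u)\<in>?U. x v * y u) = (\<Sum>e\<in>V - {w}. x (par e) * y e)"
    by (subst sum.reindex) (auto intro: inj_onI)
  finally show ?thesis by (simp add: sum.distrib)
qed

subsection \<open>Paths with pendant vertices\<close>

lemma rooted_rk_unique: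
  assumes "rooted V E w par rk" "rooted V E w par' rk'" "v \<in> V"
  shows "rk v = rk' v"
proof -
  have "rk v \<le> rk' v" if "rooted V E w par rk" "rooted V E w par' rk'" for par par' rk rk'
    using rooted_walk_lipschitz[OF that(1) relpow_sym[OF rooted_rel(2)[OF that(2)] rooted_walk_to_root[OF that(2) assms(3)]]]
      rootedD(3)[OF that(1)] by simp
  thus ?thesis using assms by (intro antisym)
qed

definition spine_arcs :: "'a set \<Rightarrow> nat \<Rightarrow> (nat \<Rightarrow> 'a) \<Rightarrow> ('a \<Rightarrow> nat) \<Rightarrow> 'a rel" where
  "spine_arcs V d s h = (\<lambda>t. (s t, s (Suc t))) ` {..<d} \<union> (\<lambda>e. (e, s (h e))) ` (V - s ` {..d})"

definition spine_tree :: "'a set \<Rightarrow> nat \<Rightarrow> (nat \<Rightarrow> 'a) \<Rightarrow> ('a \<Rightarrow> nat) \<Rightarrow> 'a pair_pre_digraph" where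
  "spine_tree V d s h = \<lparr> pverts = V, parcs = spine_arcs V d s h \<union> (spine_arcs V d s h)\<inverse> \<rparr>"

text \<open>Trees of this shape are the competitors with which a maximizer is compared. Hanging
  vertices at inner positions only keeps the diameter at \<open>d\<close>.\<close>

locale spine =
  fixes V :: "'a set" and d :: nat and s :: "nat \<Rightarrow> 'a" and h :: "'a \<Rightarrow> nat"
  assumes finV: "finite V" and d2: "2 \<le> d" and inj: "inj_on s {..d}" and sV: "s ` {..d} \<subseteq> V"
    and h: "\<And>e. e \<in> V \<Longrightarrow> e \<notin> s ` {..d} \<Longrightarrow> 1 \<le> h e \<and> h e < d"
begin

abbreviation "S \<equiv> s ` {..d}"
abbreviation "G \<equiv> spine_tree V d s h"

lemma pverts_G [simp]: "pverts G = V" by (simp add: spine_tree_def)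

definition ix where "ix = the_inv_into {..d} s"

lemma ix [simp]: "t \<le> d \<Longrightarrow> ix (s t) = t"
  unfolding ix_def by (rule the_inv_into_f_f[OF inj]) simp

lemma s_eq_iff [simp]: "t \<le> d \<Longrightarrow> u \<le> d \<Longrightarrow> s t = s u \<longleftrightarrow> t = u"
  using inj by (auto dest: inj_onD)

lemma s_in: "t \<le> d \<Longrightarrow> s t \<in> V" "t \<le> d \<Longrightarrow> s t \<in> S" using sV by auto

definition gap :: "nat \<Rightarrow> nat \<Rightarrow> nat" where "gap t i = (t - i) + (i - t)"

text \<open>Together with \<open>rank i\<close> the rooting at position \<open>i\<close> of the
  spine; the comparison of forms needs the freedom to root at either hub.\<close>

definition parent :: "nat \<Rightarrow> 'a \<Rightarrow> 'a" where
  "parent i e = (if e \<in> S then (if ix e < i then s (Suc (ix e)) else s (ix e - 1)) else s (h e))"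

definition rank :: "nat \<Rightarrow> 'a \<Rightarrow> nat" where
  "rank i e = (if e \<in> S then gap (ix e) i else Suc (gap (h e) i))"

lemma parent_spine [simp]: "t \<le> d \<Longrightarrow> parent i (s t) = (if t < i then s (Suc t) else s (t - 1))"
  by (simp add: parent_def)

lemma parent_leaf: "e \<notin> S \<Longrightarrow> parent i e = s (h e)" by (simp add: parent_def)

lemma rank_spine [simp]: "t \<le> d \<Longrightarrow> rank i (s t) = gap t i" by (simp add: rank_def)

lemma rank_leaf: "e \<notin> S \<Longrightarrow> rank i e = Suc (gap (h e) i)" by (simp add: rank_def)

lemma arcs_eq: "parcs G = {(s t, s (Suc t)) |t. t < d} \<union> {(s (Suc t), s t) |t. t < d}
    \<union> {(e, s (h e)) |e. e \<in> V - S} \<union> {(s (h e), e) |e. e \<in> V - S}"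
  by (auto simp: spine_tree_def spine_arcs_def)

lemma spine_rooted:
  assumes i: "i \<le> d"
  shows "rooted V (parcs G) (s i) (parent i) (rank i)"
proof -
  have par: "parent i e \<in> V \<and> rank i e = Suc (rank i (parent i e))" if e: "e \<in> V" "e \<noteq> s i" for e
  proof (cases "e \<in> S")
    case True
    then obtain t where t: "t \<le> d" "e = s t" by auto
    hence "t \<noteq> i" using e by auto
    thus ?thesis using t i s_in by (auto simp: gap_def)
  next
    case False
    thus ?thesis using h[OF e(1) False] s_in[of "h e"] by (simp add: parent_leaf rank_leaf)
  qed
  have sub: "(a, b) \<in> (\<lambda>e. (e, parent i e)) ` (V - {s i}) \<union> (\<lambda>e. (parent i e, e)) ` (V - {s i})"
    (is "_ \<in> ?A") if ab: "(a, b) \<in> parcs G" for a b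
  proof -
    have mem: "(e, parent i e) \<in> ?A \<and> (parent i e, e) \<in> ?A"
      if "e \<in> V" "e \<noteq> s i" for e using that by blast
    have sp: "(s t, s (Suc t)) \<in> ?A \<and> (s (Suc t), s t) \<in> ?A" if t: "t < d" for t
    proof (cases "t < i")
      case True
      thus ?thesis using mem[of "s t"] s_in[of t] t i by simp
    next
      case False
      thus ?thesis using mem[of "s (Suc t)"] s_in[of "Suc t"] t i by (auto simp: conj_commute)
    qed
    have lf: "(e, s (h e)) \<in> ?A \<and> (s (h e), e) \<in> ?A" if e: "e \<in> V" "e \<notin> S" for e
      using mem[of e] e s_in(2)[OF i] parent_leaf[OF e(2), of i] by auto
    consider t where "t < d" "a = s t" "b = s (Suc t)" | t where "t < d" "a = s (Suc t)" "b = s t"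
      | "a \<in> V" "a \<notin> S" "b = s (h a)" | "b \<in> V" "b \<notin> S" "a = s (h b)"
      using ab unfolding arcs_eq by blast
    thus ?thesis
    proof cases
      case 1 thus ?thesis using sp[of t] by simp
    next
      case 2 thus ?thesis using sp[of t] by simp
    next
      case 3 thus ?thesis using lf[of a] by simp
    next
      case 4 thus ?thesis using lf[of b] by simp
    qed
  qed
  have sup: "(e, parent i e) \<in> parcs G \<and> (parent i e, e) \<in> parcs G" if e: "e \<in> V" "e \<noteq> s i" for e
  proof (cases "e \<in> S")
    case True
    then obtain t where t: "t \<le> d" "e = s t" by auto
    hence ti: "t \<noteq> i" using e by auto
    show ?thesis
    proof (cases "t < i")
      case True
      thus ?thesis using t i unfolding arcs_eq by force
    next
      case False
      then obtain u where "t = Suc u" using ti by (cases t) auto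
      thus ?thesis using t i False unfolding arcs_eq by force
    qed
  next
    case False
    thus ?thesis using e parent_leaf[OF False, of i] unfolding arcs_eq by auto
  qed
  have "parcs G = (\<lambda>e. (e, parent i e)) ` (V - {s i}) \<union> (\<lambda>e. (parent i e, e)) ` (V - {s i})"
    using sub sup by auto
  thus ?thesis unfolding rooted_def using finV s_in[OF i] par i by (auto simp: gap_def)
qed

lemma tree_G: "undirected_tree G"
  using rooted_undirected_tree[of G "s 0" "parent 0" "rank 0"] spine_rooted[of 0] by simp

lemma graph_G: "pair_graph G" using tree_G by (simp add: undirected_tree_def)

text \<open>Distances to spine vertices are read off the rooting there, by symmetry of ranks. For
  two hung vertices the feet are at most \<open>d - 2\<close> apart, as they lie between 1 and
  \<open>d - 1\<close>, and two steps are added. The ends of the spine attain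
  \<open>d\<close>.\<close>

lemma in_trees_of_diameter: "G \<in> trees_of_diameter (card V) d"
proof -
  have bound: "rk v \<le> d" if r: "rooted V (parcs G) u par rk" and v: "v \<in> V" for u par rk v
  proof -
    have uV: "u \<in> V" using rootedD(2)[OF r] .
    have spine: "rk (s j) = rank j u" if "j \<le> d" for j
      using rooted_rk_sym[OF r spine_rooted[OF that]] .
    have rle: "rank j u \<le> d" if "j \<le> d" for j
    proof (cases "u \<in> S")
      case True thus ?thesis using that by (auto simp: gap_def)
    next
      case False
      thus ?thesis using that h[OF uV False] unfolding rank_leaf[OF False] gap_def by arith
    qed
    show ?thesis
    proof (cases "v \<in> S")
      case True
      then obtain j where "j \<le> d" "v = s j" by auto
      thus ?thesis using spine[of j] rle[of j] by simp
    next
      case vS: False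
      note hv = h[OF v vS]
      show ?thesis
      proof (cases "u \<in> S")
        case True
        then obtain i where i: "i \<le> d" "u = s i" by auto
        have "rk v = rank i v" using rooted_rk_unique[OF r _ v] spine_rooted[OF i(1)] i(2) by blast
        thus ?thesis using hv i(1) unfolding rank_leaf[OF vS] gap_def by arith
      next
        case False
        have "(v, s (h v)) \<in> parcs G" using v vS unfolding arcs_eq by blast
        hence "rk v \<le> Suc (rk (s (h v)))" by (auto elim: rooted_edgeE[OF r])
        also have "rk (s (h v)) = Suc (gap (h u) (h v))" using spine[of "h v"] hv rank_leaf[OF False] by simp
        finally show ?thesis using hv h[OF uV False] unfolding gap_def by arith
      qed
    qed
  qed
  have ne: "pverts G \<noteq> {}" using s_in(1)[of 0] by auto
  have "graph_diameter G = ereal (real d)"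
    unfolding graph_diameter_eq_iff[OF tree_G ne] pverts_G
  proof (intro conjI allI impI)
    show "\<exists>u par rk v. rooted V (parcs G) u par rk \<and> v \<in> V \<and> rk v = d"
      using spine_rooted[of 0] s_in(1)[of d]
      by (intro exI[of _ "s 0"] exI[of _ "parent 0"] exI[of _ "rank 0"] exI[of _ "s d"]) (simp add: gap_def)
  qed (rule bound)
  thus ?thesis by (simp add: trees_of_diameter_def tree_G)
qed

lemma nbrs_leaf:
  assumes e: "e \<in> V" "e \<notin> S"
  shows "parcs G `` {e} = {s (h e)}"
proof (rule equalityI; rule subsetI)
  fix b assume "b \<in> parcs G `` {e}"
  hence b: "(e, b) \<in> parcs G" by simp
  have "e \<noteq> s t" if "t \<le> d" for t using s_in(2)[OF that] e by auto
  hence "e \<noteq> s t" "e \<noteq> s (Suc t)" if "t < d" for t using that by auto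
  moreover have "e \<noteq> s (h f)" if "f \<in> V - S" for f using h[of f] that s_in(2)[of "h f"] e by auto
  ultimately show "b \<in> {s (h e)}" using b unfolding arcs_eq by auto
next
  fix b assume "b \<in> {s (h e)}"
  thus "b \<in> parcs G `` {e}" using e unfolding arcs_eq by auto
qed

lemma nbrs_spine:
  assumes t: "t \<le> d"
  shows "parcs G `` {s t} = {s u |u. u \<le> d \<and> (u = Suc t \<or> t = Suc u)} \<union> {e \<in> V - S. h e = t}"
proof (rule equalityI; rule subsetI)
  fix b assume "b \<in> parcs G `` {s t}"
  hence b: "(s t, b) \<in> parcs G" by simp
  then consider u where "u < d" "s t = s u" "b = s (Suc u)" | u where "u < d" "s t = s (Suc u)" "b = s u"
    | e where "e \<in> V - S" "s t = e" | "b \<in> V - S" "s t = s (h b)"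
    unfolding arcs_eq by blast
  thus "b \<in> {s u |u. u \<le> d \<and> (u = Suc t \<or> t = Suc u)} \<union> {e \<in> V - S. h e = t}"
  proof cases
    case 1 thus ?thesis using t by auto
  next
    case 2 thus ?thesis using t by auto
  next
    case 3 thus ?thesis using s_in(2)[OF t] by simp
  next
    case 4
    hence "h b < d" using h by blast
    thus ?thesis using 4 t by simp
  qed
next
  fix b assume "b \<in> {s u |u. u \<le> d \<and> (u = Suc t \<or> t = Suc u)} \<union> {e \<in> V - S. h e = t}"
  thus "b \<in> parcs G `` {s t}" using t unfolding arcs_eq by auto
qed

lemma conn_graph_G: "conn_graph G V (parcs G)"
proof (rule conn_graph.intro[OF graph_G])
  show "2 \<le> card (pverts G)"
  proof -
    have "card {s 0, s 1} \<le> card V" using finV s_in d2 by (intro card_mono) auto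
    moreover have "s 0 \<noteq> s 1" using d2 by simp
    ultimately show ?thesis by simp
  qed
  show "(u, v) \<in> (parcs G)\<^sup>*" if "u \<in> pverts G" "v \<in> pverts G" for u v
    using rooted_conn[OF spine_rooted[of 0]] that by simp
qed simp_all

end

subsection \<open>Extremal vertices of a maximizer\<close>

definition is_path :: "'a set \<Rightarrow> 'a rel \<Rightarrow> nat \<Rightarrow> (nat \<Rightarrow> 'a) \<Rightarrow> bool" where
  "is_path V E d v \<longleftrightarrow> inj_on v {..d} \<and> v ` {..d} \<subseteq> V \<and> (\<forall>t<d. (v t, v (Suc t)) \<in> E)"

lemma is_path_rev:
  assumes "is_path V E d v" "sym E"
  shows "is_path V E d (\<lambda>t. v (d - t))"
  unfolding is_path_def
proof (intro conjI allI impI)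
  show "inj_on (\<lambda>t. v (d - t)) {..d}"
  proof (rule inj_onI)
    fix t u assume "t \<in> {..d}" "u \<in> {..d}" "v (d - t) = v (d - u)"
    hence "d - t = d - u" using assms(1) unfolding is_path_def by (auto dest: inj_onD)
    thus "t = u" using \<open>t \<in> {..d}\<close> \<open>u \<in> {..d}\<close> by auto
  qed
  show "(\<lambda>t. v (d - t)) ` {..d} \<subseteq> V" using assms(1) unfolding is_path_def by auto
  fix t assume t: "t < d"
  have "(v (d - Suc t), v (Suc (d - Suc t))) \<in> E" using assms(1) t unfolding is_path_def by auto
  moreover have "Suc (d - Suc t) = d - t" using t by simp
  ultimately show "(v (d - t), v (d - Suc t)) \<in> E" using assms(2) by (simp add: symD)
qed

text \<open>\<open>q\<close> is the position of least rank. Once the path moves away from the root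
  it cannot turn back, since the only neighbour closer to the root is the vertex it came from; so
  the rank grows by one with each step on both sides of \<open>q\<close>.\<close>

lemma path_projection:
  assumes r: "rooted V E w par rk" and p: "is_path V E d v"
  obtains q where "q \<le> d" "\<And>t. t < q \<Longrightarrow> par (v t) = v (Suc t)" "\<And>t. q \<le> t \<Longrightarrow> t < d \<Longrightarrow> par (v (Suc t)) = v t"
    "\<And>t. t \<le> q \<Longrightarrow> rk (v t) = rk (v q) + (q - t)" "\<And>t. q \<le> t \<Longrightarrow> t \<le> d \<Longrightarrow> rk (v t) = rk (v q) + (t - q)"
proof -
  have up: "par (v (Suc t)) = v t \<and> rk (v (Suc t)) = Suc (rk (v t))"
    if p: "is_path V E d v" and min: "\<And>t. t \<le> d \<Longrightarrow> rk (v q) \<le> rk (v t)" and q: "q \<le> t" "t < d" for v t q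
    using q
  proof (induct "t - q" arbitrary: t)
    case 0
    hence t: "t = q" by simp
    have e: "(v t, v (Suc t)) \<in> E" using p 0 unfolding is_path_def by simp
    have le: "rk (v t) \<le> rk (v (Suc t))" using min[of "Suc t"] 0 t by simp
    have "v t = par (v (Suc t))"
      by (rule rooted_edge_lower[OF r symD[OF rooted_rel(2)[OF r] e] le])
    moreover have "rk (v (Suc t)) = Suc (rk (v t))" by (rule rooted_edgeE[OF r e]) (use le in auto)
    ultimately show ?case by simp
  next
    case (Suc k)
    then obtain u where u: "t = Suc u" "q \<le> u" "k = u - q" by (cases t) auto
    have IH: "par (v (Suc u)) = v u" using Suc(1)[OF u(3) u(2)] Suc(4) u by simp
    have e: "(v t, v (Suc t)) \<in> E" using p Suc unfolding is_path_def by simp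
    have ne: "v (Suc t) \<noteq> v u" using p u Suc(4) inj_onD[of v "{..d}" "Suc t" u] unfolding is_path_def by auto
    have le: "\<not> rk (v (Suc t)) \<le> rk (v t)" using rooted_edge_lower[OF r e] IH ne u by auto
    have "v t = par (v (Suc t))"
      by (rule rooted_edge_lower[OF r symD[OF rooted_rel(2)[OF r] e]]) (use le in simp)
    moreover have "rk (v (Suc t)) = Suc (rk (v t))" by (rule rooted_edgeE[OF r e]) (use le in auto)
    ultimately show ?case by simp
  qed
  have "Min ((\<lambda>t. rk (v t)) ` {..d}) \<in> (\<lambda>t. rk (v t)) ` {..d}" by (rule Min_in) auto
  then obtain q0 where "Min ((\<lambda>t. rk (v t)) ` {..d}) = rk (v q0)" "q0 \<in> {..d}" by (rule imageE)
  then obtain q where q: "q \<le> d" "rk (v q) = Min ((\<lambda>t. rk (v t)) ` {..d})" by simp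
  have min: "rk (v q) \<le> rk (v t)" if "t \<le> d" for t unfolding q(2) using that by (intro Min_le) auto
  have right: "par (v (Suc t)) = v t \<and> rk (v (Suc t)) = Suc (rk (v t))" if "q \<le> t" "t < d" for t
    by (rule up[OF p min that])
  have left: "par (v t) = v (Suc t) \<and> rk (v t) = Suc (rk (v (Suc t)))" if t: "t < q" for t
  proof -
    have *: "d - q \<le> d - Suc t" "d - Suc t < d" "d - (d - q) = q" "d - Suc (d - Suc t) = t" "d - (d - Suc t) = Suc t"
      using t q(1) by auto
    have "rk (v (d - (d - q))) \<le> rk (v (d - u))" if "u \<le> d" for u using min[of "d - u"] * by simp
    from up[OF is_path_rev[OF p rooted_rel(2)[OF r]] this *(1,2)] show ?thesis by (simp add: *)
  qed
  show thesis
  proof (rule that[OF q(1)])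
    show "rk (v t) = rk (v q) + (q - t)" if "t \<le> q" for t
      using that
    proof (induct "q - t" arbitrary: t)
      case (Suc k)
      hence "t < q" by simp
      thus ?case using Suc(1)[of "Suc t"] Suc(2) left[of t] by simp
    qed simp
    show "rk (v t) = rk (v q) + (t - q)" if "q \<le> t" "t \<le> d" for t
      using that
    proof (induct t)
      case (Suc t)
      show ?case
      proof (cases "q = Suc t")
        case False
        thus ?thesis using Suc right[of t] by simp
      qed simp
    qed simp
  qed (use left right in auto)
qed

text \<open>Among two neighbours one differs from \<open>par w\<close>, whatever \<open>par\<close>
  is at the root, and it must be a child. Through this a non-pendant vertex has distance less than
  the diameter from every vertex.\<close>

lemma rooted_inner_vertex_rank:
  assumes r: "rooted V E u par rk" and w: "w \<in> V" "2 \<le> card (E `` {w})"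
  obtains c where "c \<in> V" "(w, c) \<in> E" "rk c = Suc (rk w)"
proof -
  have fin: "finite (E `` {w})"
    by (rule finite_subset[OF _ rootedD(1)[OF r]]) (use rooted_rel(1)[OF r] in auto)
  have "\<not> E `` {w} \<subseteq> {par w}"
  proof
    assume "E `` {w} \<subseteq> {par w}"
    hence "card (E `` {w}) \<le> card {par w}" by (intro card_mono) auto
    thus False using w by simp
  qed
  then obtain c where c: "(w, c) \<in> E" "c \<noteq> par w" by blast
  show thesis by (rule rooted_edgeE[OF r c(1)]) (use c that in auto)
qed

text \<open>
  The vertices \<open>wA\<close> and \<open>wB\<close> maximize and minimize the eigenvector \<open>x\<close> among the non-pendant vertices; \<open>pA\<close>, \<open>rA\<close>
  and \<open>pB\<close>, \<open>rB\<close> are parent and depth with respect to these roots. That the sets \<open>0 < x\<close> and \<open>x < 0\<close> are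
  closed under taking parents means that they are subtrees. The last assumption names a diametral path \<open>v\<close>.
\<close>

locale extremal_tree =
  fixes T :: "'a pair_pre_digraph" and V E d l x wA pA rA wB pB rB v
  assumes tree: "undirected_tree T" and V_eq: "V = pverts T" and E_eq: "E = parcs T"
    and d3: "3 \<le> d" and l_eq: "l = lambda2 T"
    and maximal: "\<And>H :: 'a pair_pre_digraph. H \<in> trees_of_diameter (card V) d \<Longrightarrow> lambda2 H \<le> l"
    and rootA: "rooted V E wA pA rA" and rootB: "rooted V E wB pB rB"
    and eig: "\<And>u. u \<in> V \<Longrightarrow> nbr_sum E x u = l * x u"
    and posA: "0 < x wA" and negB: "x wB < 0"
    and A_closed: "\<And>u. u \<in> V \<Longrightarrow> u \<noteq> wA \<Longrightarrow> 0 < x u \<Longrightarrow> 0 < x (pA u)"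
    and B_closed: "\<And>u. u \<in> V \<Longrightarrow> u \<noteq> wB \<Longrightarrow> x u < 0 \<Longrightarrow> x (pB u) < 0"
    and A_max: "\<And>u. u \<in> V \<Longrightarrow> 2 \<le> card (E `` {u}) \<Longrightarrow> x u \<le> x wA"
    and B_max: "\<And>u. u \<in> V \<Longrightarrow> 2 \<le> card (E `` {u}) \<Longrightarrow> x wB \<le> x u"
    and degA: "2 \<le> card (E `` {wA})" and degB: "2 \<le> card (E `` {wB})"
    and diam: "\<And>u par rk z. rooted V E u par rk \<Longrightarrow> z \<in> V \<Longrightarrow> rk z \<le> d"
    and path: "is_path V E d v"

text \<open>Exchanging the signs and, below, reversing the path are symmetries of the setting; one
  sign and one direction suffice afterwards.\<close>

lemma extremal_tree_swap:
  assumes "extremal_tree T V E d l x wA pA rA wB pB rB v"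
  shows "extremal_tree T V E d l (\<lambda>u. - x u) wB pB rB wA pA rA v"
proof -
  interpret extremal_tree T V E d l x wA pA rA wB pB rB v by fact
  have eig': "nbr_sum E (\<lambda>u. - x u) u = l * - x u" if "u \<in> V" for u
    using eig[OF that] by (simp add: nbr_sum_def sum_negf)
  show ?thesis
  proof unfold_locales
    show "0 < - x wB" "- x wA < 0" using posA negB by simp_all
    show "0 < - x (pB u)" if "u \<in> V" "u \<noteq> wB" "0 < - x u" for u using B_closed[OF that(1,2)] that(3) by simp
    show "- x (pA u) < 0" if "u \<in> V" "u \<noteq> wA" "- x u < 0" for u using A_closed[OF that(1,2)] that(3) by simp
    show "- x u \<le> - x wB" if "u \<in> V" "2 \<le> card (E `` {u})" for u using B_max[OF that] by simp
    show "- x wA \<le> - x u" if "u \<in> V" "2 \<le> card (E `` {u})" for u using A_max[OF that] by simp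
  qed (fact tree V_eq E_eq d3 l_eq maximal rootA rootB eig' degA degB diam path)+
qed

lemma extremal_tree_rev:
  assumes "extremal_tree T V E d l x wA pA rA wB pB rB v"
  shows "extremal_tree T V E d l x wA pA rA wB pB rB (\<lambda>t. v (d - t))"
proof -
  interpret extremal_tree T V E d l x wA pA rA wB pB rB v by fact
  show ?thesis
    by (unfold_locales; fact tree V_eq E_eq d3 l_eq maximal rootA rootB eig posA negB A_closed B_closed
        A_max B_max degA degB diam is_path_rev[OF path rooted_rel(2)[OF rootA]])
qed

text \<open>The test functions are the indicators of the first and the last edge of the path. For
  \<open>k = 3\<close> these are joined by the middle edge and the form becomes
  \<open>(a + b)\<^sup>2\<close>, for \<open>k = 4\<close> it vanishes. The bound 1/2 serves for
  positivity, the bound 1 for the values at pendant vertices.\<close>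

lemma two_edges_lambda2_ge:
  assumes r: "rooted (pverts T) (parcs T) (v 0) par rk" and rk: "\<And>t. t \<le> k \<Longrightarrow> rk (v t) = t"
    and p: "is_path (pverts T) (parcs T) k v" and k: "k = 3 \<and> \<mu> = 1 / 2 \<or> k = 4 \<and> \<mu> = 1"
  shows "\<mu> \<le> lambda2 T"
proof -
  let ?V = "pverts T" and ?E = "parcs T"
  have pg: "pair_graph T" by (rule rooted_pair_graph[OF r])
  have fin: "finite ?V" by (rule rootedD(1)[OF r])
  have inj: "v i = v j \<longleftrightarrow> i = j" if "i \<le> k" "j \<le> k" for i j
    using p that unfolding is_path_def by (auto dest: inj_onD)
  have vV: "v i \<in> ?V" if "i \<le> k" for i using p that unfolding is_path_def by auto
  have par: "par (v (Suc t)) = v t" if "t < k" for t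
  proof -
    have "(v t, v (Suc t)) \<in> ?E" using p that unfolding is_path_def by auto
    from symD[OF rooted_rel(2)[OF r] this] have "v t = par (v (Suc t))"
      by (rule rooted_edge_lower[OF r]) (use rk that in simp)
    thus ?thesis by simp
  qed
  define f where "f u = (of_bool (u = v 0 \<or> u = v 1) :: real)" for u
  define g where "g u = (of_bool (u = v (k - 1) \<or> u = v k) :: real)" for u
  have k3: "3 \<le> k" using k by auto
  have fv: "f (v t) = of_bool (t \<le> 1)" if "t \<le> k" for t
    using that inj[of t 0] inj[of t 1] k3 by (auto simp: f_def)
  have gv: "g (v t) = of_bool (k - 1 \<le> t)" if "t \<le> k" for t
    using that inj[of t k] inj[of t "k - 1"] k3 by (auto simp: g_def)
  have card: "2 \<le> card ?V"
  proof -
    have "card (v ` {0, 1}) \<le> card ?V" using fin vV k by (intro card_mono) auto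
    moreover have "card (v ` {0, 1}) = 2" using inj[of 0 1] k by auto
    ultimately show ?thesis by simp
  qed
  show ?thesis
  proof (rule two_dim_lambda2_ge(1)[OF pg card, of f g])
    fix a b :: real assume *: "\<And>u. u \<in> ?V \<Longrightarrow> a * f u + b * g u = 0"
    show "a = 0 \<and> b = 0"
      using *[OF vV, of 0] *[OF vV, of k] k3 by (simp add: fv gv)
  next
    fix a b :: real and z :: "'a \<Rightarrow> real" assume z: "\<And>u. z u = a * f u + b * g u"
    have zv: "z (v t) = (if t \<le> 1 then a else if k - 1 \<le> t then b else 0)" if "t \<le> k" for t
      using that k3 by (auto simp: z fv gv)
    have zo: "z u = 0" if "u \<notin> v ` {..k}" for u
    proof -
      have "u \<noteq> v t" if "t \<le> k" for t using that \<open>u \<notin> v ` {..k}\<close> by auto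
      from this[of 0] this[of 1] this[of k] this[of "k - 1"] k3 show ?thesis by (simp add: z f_def g_def)
    qed
    have sub: "v ` {1..k} \<subseteq> ?V - {v 0}" using vV inj by auto
    have rest: "u \<in> v ` {1..k} \<or> z u = 0" if "u \<in> ?V - {v 0}" for u
    proof (cases "u \<in> v ` {..k}")
      case True
      then obtain t where "t \<le> k" "u = v t" by auto
      thus ?thesis using that by (cases t) auto
    qed (use zo in simp)
    have q: "(\<Sum>u\<in>?V. z u * nbr_sum ?E z u) = (\<Sum>t\<in>{1..k}. 2 * z (v t) * z (v (t - 1)))"
    proof -
      have "(\<Sum>u\<in>?V. z u * nbr_sum ?E z u) = (\<Sum>e\<in>?V - {v 0}. 2 * z e * z (par e))"
        unfolding rooted_quadratic_form[OF r] by (intro sum.cong refl) simp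
      also have "\<dots> = (\<Sum>e\<in>v ` {1..k}. 2 * z e * z (par e))"
        by (rule sum.mono_neutral_right) (use fin sub rest in auto)
      also have "\<dots> = (\<Sum>t\<in>{1..k}. 2 * z (v t) * z (par (v t)))"
        by (subst sum.reindex) (auto intro!: inj_onI simp: inj)
      also have "\<dots> = (\<Sum>t\<in>{1..k}. 2 * z (v t) * z (v (t - 1)))"
      proof (rule sum.cong[OF refl])
        fix t assume "t \<in> {1..k}"
        hence "t - 1 < k" "Suc (t - 1) = t" by auto
        thus "2 * z (v t) * z (par (v t)) = 2 * z (v t) * z (v (t - 1))" using par[of "t - 1"] by simp
      qed
      finally show ?thesis .
    qed
    have n: "(\<Sum>u\<in>?V. z u * z u) = (\<Sum>t\<in>{..k}. z (v t) * z (v t))"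
    proof -
      have "(\<Sum>u\<in>?V. z u * z u) = (\<Sum>u\<in>v ` {..k}. z u * z u)"
        by (rule sum.mono_neutral_right) (use fin vV zo in auto)
      thus ?thesis by (subst (asm) sum.reindex) (auto intro!: inj_onI simp: inj)
    qed
    have "(\<Sum>u\<in>?V. z u * (nbr_sum ?E z u - \<mu> * z u)) =
        (\<Sum>u\<in>?V. z u * nbr_sum ?E z u) - \<mu> * (\<Sum>u\<in>?V. z u * z u)"
      by (simp add: sum_subtractf sum_distrib_left algebra_simps)
    also have "\<dots> \<ge> 0"
    proof -
      have *: "{1..3} = {1, 2, 3 :: nat}" "{..3} = {0, 1, 2, 3 :: nat}"
        "{1..4} = {1, 2, 3, 4 :: nat}" "{..4} = {0, 1, 2, 3, 4 :: nat}" by auto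
      have "0 \<le> (a + b)\<^sup>2" by simp
      from k show ?thesis
      proof (elim disjE conjE)
        assume k: "k = 3" and \<mu>: "\<mu> = 1 / 2"
        have "z (v 0) = a" "z (v 1) = a" "z (v 2) = b" "z (v 3) = b" using zv k by simp_all
        thus ?thesis using \<open>0 \<le> (a + b)\<^sup>2\<close> unfolding q n k *
          by (simp add: \<mu> algebra_simps power2_eq_square)
      next
        assume k: "k = 4" and \<mu>: "\<mu> = 1"
        have "z (v 0) = a" "z (v 1) = a" "z (v 2) = 0" "z (v 3) = b" "z (v 4) = b" using zv k by simp_all
        thus ?thesis unfolding q n k *
          by (simp add: \<mu> algebra_simps power2_eq_square)
      qed
    qed
    finally show "0 \<le> (\<Sum>u\<in>?V. z u * (nbr_sum ?E z u - \<mu> * z u))" .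
  qed
qed

section \<open>Sign components of an eigenvector of the maximizer\<close>

lemma rooted_path_from_root:
  assumes r: "rooted V E u par rk" and z: "z \<in> V" "rk z = d"
  obtains v where "is_path V E d v" "v 0 = u" "\<And>t. t \<le> d \<Longrightarrow> rk (v t) = t"
proof -
  have it: "(par ^^ i) z \<in> V \<and> rk ((par ^^ i) z) = d - i" if "i \<le> d" for i
    using that
  proof (induct i)
    case (Suc i)
    hence "(par ^^ i) z \<noteq> u" using rootedD(3)[OF r] by auto
    thus ?case using Suc rootedD(4,5)[OF r, of "(par ^^ i) z"] by auto
  qed (use z in simp)
  define v where "v t = (par ^^ (d - t)) z" for t
  have v: "v t \<in> V" "rk (v t) = t" if "t \<le> d" for t using it[of "d - t"] that by (auto simp: v_def)
  show thesis
  proof (rule that[of v])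
    show "is_path V E d v"
      unfolding is_path_def
    proof (intro conjI allI impI inj_onI)
      fix t s assume ts: "t \<in> {..d}" "s \<in> {..d}" "v t = v s"
      have "t = rk (v t)" using v(2)[of t] ts(1) by simp
      also have "\<dots> = rk (v s)" by (rule arg_cong[OF ts(3)])
      also have "\<dots> = s" using v(2)[of s] ts(2) by simp
      finally show "t = s" .
    next
      fix t assume t: "t < d"
      hence "v (Suc t) \<noteq> u" using v(2)[of "Suc t"] rootedD(3)[OF r] by auto
      moreover have "v t = par (v (Suc t))"
      proof -
        have "d - t = Suc (d - Suc t)" using t by simp
        thus ?thesis by (simp add: v_def)
      qed
      ultimately show "(v t, v (Suc t)) \<in> E" using rootedD(7)[OF r, of "v (Suc t)"] v(1)[of "Suc t"] t by simp
    qed (use v in auto)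
    show "v 0 = u" using rooted_rk_zero[OF r v(1)[of 0]] v(2)[of 0] by simp
  qed (use v in auto)
qed

text \<open>The connected component of the root in the set where \<open>f\<close> is positive: the
  whole descent has to be positive. The iteration stops at \<open>rk z\<close> because it is then at
  the root, where \<open>par\<close> is arbitrary.\<close>

definition component :: "'a set \<Rightarrow> ('a \<Rightarrow> 'a) \<Rightarrow> ('a \<Rightarrow> nat) \<Rightarrow> ('a \<Rightarrow> real) \<Rightarrow> 'a set" where
  "component V par rk f = {z \<in> V. \<forall>k\<le>rk z. 0 < f ((par ^^ k) z)}"

lemma component_pos: "z \<in> component V par rk f \<Longrightarrow> 0 < f z"
  unfolding component_def by force

lemma component_root: "rooted V E w par rk \<Longrightarrow> 0 < f w \<Longrightarrow> w \<in> component V par rk f"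
  using rootedD(2,3)[of V E w par rk] by (simp add: component_def)

lemma component_parent:
  assumes "rooted V E w par rk" "z \<in> component V par rk f" "z \<noteq> w"
  shows "par z \<in> component V par rk f"
  unfolding component_def
proof (intro CollectI conjI allI impI)
  have z: "z \<in> V" "\<And>k. k \<le> rk z \<Longrightarrow> 0 < f ((par ^^ k) z)" using assms(2) by (auto simp: component_def)
  show "par z \<in> V" using rootedD(4)[OF assms(1) z(1) assms(3)] .
  fix k assume "k \<le> rk (par z)"
  hence "0 < f ((par ^^ Suc k) z)" using rootedD(5)[OF assms(1) z(1) assms(3)] by (intro z(2)) simp
  thus "0 < f ((par ^^ k) (par z))" by (simp add: funpow_swap1)
qed

lemma component_nbr:
  assumes r: "rooted V E w par rk" and z: "z \<in> component V par rk f" and e: "(z, y) \<in> E" and y: "0 < f y"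
  shows "y \<in> component V par rk f"
proof (rule rooted_edgeE[OF r e])
  assume "z \<noteq> w" "y = par z"
  thus ?thesis using component_parent[OF r z] by simp
next
  assume h: "y \<in> V" "y \<noteq> w" "z = par y" "rk y = Suc (rk z)"
  show ?thesis
    unfolding component_def
  proof (intro CollectI conjI allI impI)
    fix k assume k: "k \<le> rk y"
    show "0 < f ((par ^^ k) y)"
    proof (cases k)
      case (Suc i)
      hence "0 < f ((par ^^ i) z)" using z h(4) k unfolding component_def by auto
      thus ?thesis using Suc h(3) by (simp add: funpow_swap1)
    qed (use y in simp)
  qed (rule h)
qed

text \<open>At a vertex of the component every neighbour outside has \<open>f u \<le> 0\<close>, and
  dropping it gains at least the value of \<open>yB\<close> there. Cutting an eigenvector down to
  one component thus leaves a form that dominates the mixed term, as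
  \<open>disjoint_pair_eigenvector\<close> requires.\<close>

lemma (in conn_graph) component_form_ge:
  assumes r: "rooted V E w par rk" and eig: "\<And>u. u \<in> V \<Longrightarrow> N f u = l * f u"
    and yA: "\<And>u. yA u = (if u \<in> component V par rk f then f u else 0)"
    and yB: "\<And>u. yB u = 0 \<or> f u < 0 \<and> yB u = - f u"
  shows "(\<Sum>v\<in>V. yA v * N yB v) \<le> (\<Sum>v\<in>V. yA v * (N yA v - l * yA v))"
proof (rule sum_mono)
  let ?A = "component V par rk f"
  fix z assume z: "z \<in> V"
  show "yA z * N yB z \<le> yA z * (N yA z - l * yA z)"
  proof (cases "z \<in> ?A")
    case True
    have "N yB z + N f z \<le> N yA z"
      unfolding nbr_sum_def sum.distrib[symmetric]
    proof (rule sum_mono)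
      fix u assume u: "u \<in> E `` {z}"
      show "yB u + f u \<le> yA u"
      proof (cases "u \<in> ?A")
        case True thus ?thesis using component_pos[OF True] yB[of u] by (simp add: yA)
      next
        case False
        hence "f u \<le> 0" using component_nbr[OF r \<open>z \<in> ?A\<close>, of u] u by force
        thus ?thesis using False yB[of u] by (auto simp: yA)
      qed
    qed
    hence "N yB z \<le> N yA z - l * yA z" using eig[OF z] True by (simp add: yA)
    thus ?thesis using component_pos[OF True] True by (intro mult_left_mono) (auto simp: yA)
  qed (simp add: yA)
qed

text \<open>An eigenvector of both signs is cut down to one positive and one negative component,
  those of the hubs. The variational equality case on \<open>T\<close> itself makes
  \<open>yA - \<beta> * yB\<close> an eigenvector again, now with connected sign sets; the scaling
  by \<open>\<beta> > 0\<close> preserves the extremal property of the hubs.\<close>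

lemma maximizer_extremal_tree:
  fixes T :: "'a pair_pre_digraph"
  assumes d3: "3 \<le> d" and max: "lambda2_maximizer n d T"
  obtains x wA pA rA wB pB rB v where
    "extremal_tree T (pverts T) (parcs T) d (lambda2 T) x wA pA rA wB pB rB v"
proof -
  define V E where "V = pverts T" and "E = parcs T"
  have T: "undirected_tree T" "card V = n" "graph_diameter T = ereal (real d)"
    and maxT: "\<And>H :: 'a pair_pre_digraph. H \<in> trees_of_diameter n d \<Longrightarrow> lambda2 H \<le> lambda2 T"
    using max by (auto simp: lambda2_maximizer_def trees_of_diameter_def V_def)
  have pg: "pair_graph T" using T(1) by (simp add: undirected_tree_def)
  note E = pair_graph_arcs[OF pg, folded V_def E_def]
  have conn: "V \<noteq> {}" "\<And>u v. u \<in> V \<Longrightarrow> v \<in> V \<Longrightarrow> (u, v) \<in> E\<^sup>*"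
    using T(1) unfolding undirected_tree_def pair_graph_connected_iff[OF pg] V_def E_def by auto
  note dia = graph_diameter_eq_iff[OF T(1), of d, folded V_def E_def, OF conn(1)]
  have rk_le: "rk v \<le> d" if "rooted V E u par rk" "v \<in> V" for u par rk v
    using dia T(3) that by blast
  obtain u0 par0 rk0 z0 where r0: "rooted V E u0 par0 rk0" "z0 \<in> V" "rk0 z0 = d"
    using dia T(3) by blast
  obtain v where v: "is_path V E d v" "v 0 = u0" "\<And>t. t \<le> d \<Longrightarrow> rk0 (v t) = t"
    using rooted_path_from_root[OF r0] by blast
  have lpos: "1 / 2 \<le> lambda2 T"
  proof (rule two_edges_lambda2_ge[of T v par0 rk0 3])
    show "rooted (pverts T) (parcs T) (v 0) par0 rk0" using r0 v(2) by (simp add: V_def E_def)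
    have "{..3} \<subseteq> {..d}" using d3 by auto
    thus "is_path (pverts T) (parcs T) 3 v" using v(1) d3 unfolding is_path_def V_def E_def
      by (meson image_mono inj_on_subset less_le_trans order_trans)
  qed (use v(3) d3 in auto)
  have cardV: "4 \<le> card V"
  proof -
    have "card (v ` {..d}) \<le> card V" using v(1) E(4) unfolding is_path_def by (intro card_mono) auto
    moreover have "card (v ` {..d}) = Suc d" using v(1) unfolding is_path_def by (simp add: card_image)
    ultimately show ?thesis using d3 by simp
  qed
  interpret conn_graph T V E
    by (rule conn_graph.intro) (use pg cardV conn in \<open>simp_all add: V_def E_def\<close>)
  obtain x where eig: "\<And>u. u \<in> V \<Longrightarrow> N x u = lambda2 T * x u" and sgn: "\<exists>u\<in>V. x u > 0" "\<exists>u\<in>V. x u < 0"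
    using lambda2_eigenvector_changes_sign by blast
  define I where "I = {u \<in> V. 2 \<le> card (E `` {u})}"
  have finI: "finite I" using E(4) by (simp add: I_def)
  \<comment> \<open>Otherwise every positive vertex is pendant; as the eigenvalue is positive, its
    only neighbour is positive, hence pendant too, and the tree would consist of one edge.\<close>
  have inner: "\<exists>u\<in>I. 0 < f u" if f: "\<And>u. u \<in> V \<Longrightarrow> N f u = lambda2 T * f u" and ex: "\<exists>u\<in>V. f u > 0" for f
  proof (rule ccontr)
    assume no: "\<not> ?thesis"
    obtain u where u: "u \<in> V" "f u > 0" using ex by blast
    have leaf: "card (E `` {u}) \<le> 1" if "u \<in> V" "f u > 0" for u using no that by (force simp: I_def)
    have one: "\<exists>y. E `` {u} = {y} \<and> f y > 0 \<and> y \<in> V" if u: "u \<in> V" "f u > 0" for u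
    proof -
      have pos: "0 < N f u" using f[OF u(1)] u(2) lpos by simp
      hence "E `` {u} \<noteq> {}" by (auto simp: nbr_sum_def)
      hence "card (E `` {u}) = 1" using leaf[OF u] fin_nbrs[of u] by (simp add: le_Suc_eq)
      then obtain y where y: "E `` {u} = {y}" by (auto simp: card_1_singleton_iff)
      thus ?thesis using pos nbrs_in[of u] by (auto simp: nbr_sum_def)
    qed
    obtain y where y: "E `` {u} = {y}" "f y > 0" "y \<in> V" using one[OF u] by blast
    obtain z where z: "E `` {y} = {z}" using one[OF y(3,2)] by blast
    have "u \<in> E `` {y}" using y(1) E_sym by blast
    hence "z = u" unfolding z by simp
    have "V \<subseteq> {u, y}"
    proof
      fix w assume "w \<in> V"
      show "w \<in> {u, y}"
        by (rule conn_closed[of u, OF _ u(1) \<open>w \<in> V\<close>]) (use y(1) z \<open>z = u\<close> in auto)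
    qed
    hence "card V \<le> card {u, y}" by (intro card_mono) auto
    also have "\<dots> \<le> 2" by (simp add: card_insert_if)
    finally show False using cardV by simp
  qed
  have argmax: "\<exists>w\<in>I. (\<forall>u\<in>I. f u \<le> f w) \<and> 0 < f w" if "\<exists>u\<in>I. 0 < f u" for f :: "'a \<Rightarrow> real"
  proof -
    have "Max (f ` I) \<in> f ` I" using finI that by (intro Max_in) auto
    then obtain w where w: "w \<in> I" "f w = Max (f ` I)" by auto
    have "\<forall>u\<in>I. f u \<le> f w" unfolding w(2) using finI by (auto intro: Max_ge)
    thus ?thesis using w(1) that by (meson less_le_trans)
  qed
  obtain wA where wA: "wA \<in> I" "\<And>u. u \<in> I \<Longrightarrow> x u \<le> x wA" "0 < x wA"
    using argmax[OF inner[OF eig sgn(1)]] by blast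
  have eig': "N (\<lambda>u. - x u) u = lambda2 T * - x u" if "u \<in> V" for u
    using eig[OF that] nbr_sum_cmult[of "-1" x u] by simp
  have "\<exists>u\<in>V. - x u > 0" using sgn(2) by auto
  then obtain wB where wB: "wB \<in> I" "\<And>u. u \<in> I \<Longrightarrow> - x u \<le> - x wB" "0 < - x wB"
    using argmax[OF inner[OF eig']] by blast
  have wV: "wA \<in> V" "wB \<in> V" using wA wB by (auto simp: I_def)
  obtain pA rA where rA: "rooted V E wA pA rA"
    using undirected_tree_rooted[OF T(1)] wV unfolding V_def E_def by blast
  obtain pB rB where rB: "rooted V E wB pB rB"
    using undirected_tree_rooted[OF T(1)] wV unfolding V_def E_def by blast
  define A where "A = component V pA rA x"
  define B where "B = component V pB rB (\<lambda>u. - x u)"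
  define yA where "yA u = (if u \<in> A then x u else 0)" for u
  define yB where "yB u = (if u \<in> B then - x u else 0)" for u
  have Apos: "0 < x u" if "u \<in> A" for u using component_pos that unfolding A_def by fast
  have Bneg: "x u < 0" if "u \<in> B" for u using component_pos[of u V pB rB "\<lambda>u. - x u"] that unfolding B_def by simp
  have wAA: "wA \<in> A" using component_root[OF rA, of x] wA(3) by (simp add: A_def)
  have wBB: "wB \<in> B" using component_root[OF rB, of "\<lambda>u. - x u"] wB(3) by (simp add: B_def)
  define c where "c = (\<Sum>v\<in>V. yA v * N yB v)"
  have QA: "c \<le> (\<Sum>v\<in>V. yA v * (N yA v - lambda2 T * yA v))"
    unfolding c_def
    by (rule component_form_ge[OF rA eig]) (use Bneg in \<open>auto simp: yA_def yB_def A_def\<close>)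
  have "c = (\<Sum>v\<in>V. yB v * N yA v)" unfolding c_def by (rule nbr_sum_sym)
  also have "\<dots> \<le> (\<Sum>v\<in>V. yB v * (N yB v - lambda2 T * yB v))"
    by (rule component_form_ge[OF rB eig']) (use Apos in \<open>auto simp: yA_def yB_def B_def\<close>)
  finally have QB: "c \<le> (\<Sum>v\<in>V. yB v * (N yB v - lambda2 T * yB v))" .
  obtain \<beta> where \<beta>: "0 < \<beta>" and ev: "\<And>v. v \<in> V \<Longrightarrow> N yA v - \<beta> * N yB v = lambda2 T * (yA v - \<beta> * yB v)"
  proof (rule disjoint_pair_eigenvector[of yA yB wA wB c "lambda2 T"])
    show "0 \<le> yA v" "0 \<le> yB v" "yA v = 0 \<or> yB v = 0" for v
      using Apos[of v] Bneg[of v] by (auto simp: yA_def yB_def)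
    show "0 < yA wA" "0 < yB wB" using wA wB wAA wBB by (auto simp: yA_def yB_def)
  qed (use wV QA QB c_def that in auto)
  define x' where "x' u = yA u - \<beta> * yB u" for u
  have x'pos: "0 < x' u \<longleftrightarrow> u \<in> A" for u
    using Apos[of u] Bneg[of u] \<beta> by (auto simp: x'_def yA_def yB_def zero_less_mult_iff not_less mult_le_0_iff)
  have x'neg: "x' u < 0 \<longleftrightarrow> u \<in> B" for u
    using Apos[of u] Bneg[of u] \<beta> by (auto simp: x'_def yA_def yB_def zero_less_mult_iff not_less mult_le_0_iff mult_less_0_iff)
  show thesis
  proof (rule that, unfold V_def[symmetric] E_def[symmetric], unfold_locales)
    show "nbr_sum E x' u = lambda2 T * x' u" if "u \<in> V" for u
      using ev[OF that] nbr_sum_linear[of E 1 yA "- \<beta>" yB u] by (simp add: x'_def[abs_def])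
    show "0 < x' wA" "x' wB < 0" using x'pos x'neg wAA wBB by auto
    show "0 < x' (pA u)" if "u \<in> V" "u \<noteq> wA" "0 < x' u" for u
      using component_parent[OF rA] that unfolding x'pos A_def by blast
    show "x' (pB u) < 0" if "u \<in> V" "u \<noteq> wB" "x' u < 0" for u
      using component_parent[OF rB] that unfolding x'neg B_def by blast
    have xA: "x' u = x u" if "u \<in> A" for u using that Apos[OF that] Bneg[of u] by (auto simp: x'_def yA_def yB_def)
    have xB: "x' u = \<beta> * x u" if "u \<in> B" for u using that Bneg[OF that] Apos[of u] by (auto simp: x'_def yA_def yB_def)
    show "x' u \<le> x' wA" if "u \<in> V" "2 \<le> card (E `` {u})" for u
    proof (cases "u \<in> A")
      case True thus ?thesis using xA wAA wA(2)[of u] that by (simp add: I_def)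
    next
      case False thus ?thesis using x'pos[of u] x'pos[of wA] wAA by simp
    qed
    show "x' wB \<le> x' u" if "u \<in> V" "2 \<le> card (E `` {u})" for u
    proof (cases "u \<in> B")
      case True thus ?thesis using xB wBB wB(2)[of u] that \<beta> by (simp add: I_def)
    next
      case False thus ?thesis using x'neg[of u] x'neg[of wB] wBB by simp
    qed
    show "2 \<le> card (E `` {wA})" "2 \<le> card (E `` {wB})" using wA wB by (auto simp: I_def)
    show "lambda2 H \<le> lambda2 T" if "H \<in> trees_of_diameter (card V) d" for H :: "'a pair_pre_digraph"
      using maxT that T(2) by simp
    show "rk z \<le> d" if "rooted V E u par rk" "z \<in> V" for u par rk z by (rule rk_le[OF that])
  qed (fact T(1) V_def E_def d3 rA rB v(1) refl)+
qed

context extremal_tree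
begin

lemma conn_graph_T: "conn_graph T V E"
proof -
  have pg: "pair_graph T" using tree by (simp add: undirected_tree_def)
  have "card (v ` {..d}) \<le> card V"
    using path rootedD(1)[OF rootA] unfolding is_path_def by (intro card_mono) auto
  moreover have "card (v ` {..d}) = Suc d" using path unfolding is_path_def by (simp add: card_image)
  ultimately have "2 \<le> card V" using d3 by simp
  thus ?thesis using pg rooted_conn[OF rootA] V_eq E_eq
    by (intro conn_graph.intro) auto
qed

sublocale conn_graph T V E by (rule conn_graph_T)

lemma v_in: "t \<le> d \<Longrightarrow> v t \<in> V" using path unfolding is_path_def by auto

lemma v_eq_iff [simp]: "t \<le> d \<Longrightarrow> u \<le> d \<Longrightarrow> v t = v u \<longleftrightarrow> t = u"
  using path unfolding is_path_def by (auto dest: inj_onD)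

lemma v_edge: "t < d \<Longrightarrow> (v t, v (Suc t)) \<in> E" using path unfolding is_path_def by auto

lemma wA_V: "wA \<in> V" and wB_V: "wB \<in> V" using rootedD(2)[OF rootA] rootedD(2)[OF rootB] .

lemma root_at_path_start:
  obtains par rk where "rooted V E (v 0) par rk" "\<And>t. t \<le> d \<Longrightarrow> rk (v t) = t"
proof -
  obtain par rk where r: "rooted V E (v 0) par rk"
    using undirected_tree_rooted[OF tree] v_in[of 0] unfolding V_eq E_eq by auto
  obtain q where q: "q \<le> d" "\<And>t. t \<le> q \<Longrightarrow> rk (v t) = rk (v q) + (q - t)"
    "\<And>t. q \<le> t \<Longrightarrow> t \<le> d \<Longrightarrow> rk (v t) = rk (v q) + (t - q)"
    by (rule path_projection[OF r path]) (rule that)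
  have "q = 0" "rk (v q) = 0" using q(2)[of 0] rootedD(3)[OF r] by auto
  hence "rk (v t) = t" if "t \<le> d" for t using q(3)[of t] that by simp
  thus thesis using that r by blast
qed

lemma l_ge: "1 / 2 \<le> l" "4 \<le> d \<Longrightarrow> 1 \<le> l"
proof -
  obtain par rk where r: "rooted V E (v 0) par rk" "\<And>t. t \<le> d \<Longrightarrow> rk (v t) = t"
    by (rule root_at_path_start) (rule that)
  have p: "is_path V E k v" if "k \<le> d" for k
  proof -
    have "{..k} \<subseteq> {..d}" using that by auto
    thus ?thesis using path that unfolding is_path_def
      by (meson image_mono inj_on_subset less_le_trans order_trans)
  qed
  show "1 / 2 \<le> l" unfolding l_eq
    by (rule two_edges_lambda2_ge[of T v par rk 3]) (use r p d3 in \<open>auto simp: V_eq E_eq\<close>)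
  show "1 \<le> l" if "4 \<le> d" unfolding l_eq
    by (rule two_edges_lambda2_ge[of T v par rk 4]) (use r p that in \<open>auto simp: V_eq E_eq\<close>)
qed

lemma projection:
  assumes r: "rooted V E w par rk" and deg: "2 \<le> card (E `` {w})"
  obtains q where "q \<le> d" "\<And>t. t < q \<Longrightarrow> par (v t) = v (Suc t)" "\<And>t. q \<le> t \<Longrightarrow> t < d \<Longrightarrow> par (v (Suc t)) = v t"
    "rk (v q) + q < d" "rk (v q) + (d - q) < d"
    "\<And>t. t \<le> q \<Longrightarrow> rk (v t) = rk (v q) + (q - t)" "\<And>t. q \<le> t \<Longrightarrow> t \<le> d \<Longrightarrow> rk (v t) = rk (v q) + (t - q)"
proof -
  obtain q where q: "q \<le> d" "\<And>t. t < q \<Longrightarrow> par (v t) = v (Suc t)" "\<And>t. q \<le> t \<Longrightarrow> t < d \<Longrightarrow> par (v (Suc t)) = v t"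
    "\<And>t. t \<le> q \<Longrightarrow> rk (v t) = rk (v q) + (q - t)" "\<And>t. q \<le> t \<Longrightarrow> t \<le> d \<Longrightarrow> rk (v t) = rk (v q) + (t - q)"
    by (rule path_projection[OF r path]) (rule that)
  \<comment> \<open>In the rooting at \<open>u\<close> the non-pendant \<open>w\<close> has a child,
    whose depth is at most \<open>d\<close>; so \<open>w\<close> itself has depth less than
    \<open>d\<close>.\<close>
  have small: "rk u < d" if u: "u \<in> V" for u
  proof -
    obtain par' rk' where r': "rooted V E u par' rk'"
      using undirected_tree_rooted[OF tree] u unfolding V_eq E_eq by blast
    obtain c where c: "c \<in> V" "rk' c = Suc (rk' w)"
      by (rule rooted_inner_vertex_rank[OF r' rootedD(2)[OF r] deg]) (rule that)
    have "rk' c \<le> d" by (rule diam[OF r' c(1)])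
    thus ?thesis using c(2) rooted_rk_sym[OF r r'] by simp
  qed
  have "rk (v q) + q < d" using small[OF v_in, of 0] q(4)[of 0] by simp
  moreover have "rk (v q) + (d - q) < d" using small[OF v_in, of d] q(5)[of d] q(1) by simp
  ultimately show thesis by (intro that[of q] q)
qed

end

section \<open>Comparing forms after rehanging\<close>

lemma rooted_card_arcs:
  assumes r: "rooted V E w par rk"
  shows "card E = 2 * (card V - 1)"
proof -
  let ?D = "(\<lambda>e. (e, par e)) ` (V - {w})" and ?U = "(\<lambda>e. (par e, e)) ` (V - {w})"
  have "?D \<inter> ?U = {}"
  proof (rule ccontr)
    assume "?D \<inter> ?U \<noteq> {}"
    then obtain e f where "e \<in> V - {w}" "f \<in> V - {w}" "e = par f" "par e = f" by auto
    thus False using rootedD(5)[OF r, of e] rootedD(5)[OF r, of f] by auto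
  qed
  moreover have "card ?D = card (V - {w})" "card ?U = card (V - {w})"
    by (auto intro!: card_image inj_onI)
  moreover have "E = ?D \<union> ?U" using r by (simp add: rooted_def)
  ultimately show ?thesis using rootedD(1,2)[OF r] by (simp add: card_Un_disjoint card_Diff_singleton)
qed

definition pos_part :: "('a \<Rightarrow> real) \<Rightarrow> 'a \<Rightarrow> real" where
  "pos_part f u = max (f u) 0"

lemma pos_part_simps [simp]:
  "0 \<le> pos_part f u" "0 < f u \<Longrightarrow> pos_part f u = f u" "f u \<le> 0 \<Longrightarrow> pos_part f u = 0"
  "0 < pos_part f u \<longleftrightarrow> 0 < f u" "pos_part f u = 0 \<longleftrightarrow> f u \<le> 0"
  by (auto simp: pos_part_def)

context extremal_tree
begin

abbreviation "xA \<equiv> pos_part x"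
abbreviation "xB \<equiv> pos_part (\<lambda>u. - x u)"

lemma x_split: "x u = xA u - xB u" by (simp add: pos_part_def)

lemma N_split: "u \<in> V \<Longrightarrow> N xA u - N xB u = l * (xA u - xB u)"
proof -
  assume u: "u \<in> V"
  have "N xA u - N xB u = N x u"
    unfolding nbr_sum_def sum_subtractf[symmetric] by (rule sum.cong[OF refl]) (rule x_split[symmetric])
  also have "\<dots> = l * x u" by (rule eig[OF u])
  also have "x u = xA u - xB u" by (rule x_split)
  finally show ?thesis .
qed

definition cross :: real where "cross = (\<Sum>u\<in>V. xA u * N xB u)"

text \<open>Where \<open>xA\<close> is positive, \<open>xB\<close> vanishes and the eigenvector
  equation reads \<open>N xA - l * xA = N xB\<close>. By symmetry the form of \<open>xB\<close> has
  the same value.\<close>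

lemma form_A: "(\<Sum>u\<in>V. xA u * (N xA u - l * xA u)) = cross"
  unfolding cross_def
proof (rule sum.cong[OF refl])
  fix u assume u: "u \<in> V"
  show "xA u * (N xA u - l * xA u) = xA u * N xB u"
    using N_split[OF u] by (cases "0 < x u") auto
qed

text \<open>A parent other than \<open>wA\<close> has a child and a parent of its own, so it is
  non-pendant and \<open>A_max\<close> applies.\<close>

lemma A_parent_le:
  assumes e: "e \<in> V" "e \<noteq> wA" "0 < x e"
  shows "xA (pA e) \<le> x wA"
proof (cases "pA e = wA")
  case False
  have p: "pA e \<in> V" "0 < x (pA e)" using rootedD(4)[OF rootA e(1,2)] A_closed[OF e] .
  have "{e, pA (pA e)} \<subseteq> E `` {pA e}"
    using rootedD(6,7)[OF rootA] e p False by auto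
  moreover have "e \<noteq> pA (pA e)" using rootedD(5)[OF rootA e(1,2)] rootedD(5)[OF rootA p(1) False] by auto
  ultimately have "2 \<le> card (E `` {pA e})" using card_mono[OF fin_nbrs, of "{e, pA (pA e)}" "pA e"] by simp
  thus ?thesis using A_max[OF p(1)] p(2) by simp
qed (use posA in simp)

text \<open>Edges are compared at their child. Only positive children count, and each of them keeps
  its parent or receives the hub, whose value is at least that of the old parent.\<close>

lemma reroot_form_ge:
  assumes r: "rooted V E' wA par rk"
    and par: "\<And>e. e \<in> V \<Longrightarrow> e \<noteq> wA \<Longrightarrow> 0 < x e \<Longrightarrow> par e = pA e \<or> par e = wA"
  shows "cross \<le> (\<Sum>u\<in>V. xA u * (nbr_sum E' xA u - l * xA u))"
proof -
  have "(\<Sum>u\<in>V. xA u * N xA u) \<le> (\<Sum>u\<in>V. xA u * nbr_sum E' xA u)"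
    unfolding rooted_quadratic_form[OF rootA] rooted_quadratic_form[OF r]
  proof (rule sum_mono)
    fix e assume e: "e \<in> V - {wA}"
    show "xA e * xA (pA e) + xA (pA e) * xA e \<le> xA e * xA (par e) + xA (par e) * xA e"
    proof (cases "0 < x e")
      case True
      hence "xA (pA e) \<le> xA (par e)" using par[of e] A_parent_le[of e] e posA by auto
      hence "xA e * xA (pA e) \<le> xA e * xA (par e)" by (intro mult_left_mono) simp_all
      thus ?thesis by (simp add: mult.commute)
    qed simp
  qed
  hence "(\<Sum>u\<in>V. xA u * (N xA u - l * xA u)) \<le> (\<Sum>u\<in>V. xA u * (nbr_sum E' xA u - l * xA u))"
    by (simp add: algebra_simps sum_subtractf)
  thus ?thesis by (simp only: form_A)
qed

text \<open>No edge between the sign sets arises, so the mixed sums can only lose terms.\<close>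

lemma cross_ge:
  assumes sub: "E' \<subseteq> V \<times> V" and cr: "\<And>a b. (a, b) \<in> E' \<Longrightarrow> 0 < x a \<Longrightarrow> x b < 0 \<Longrightarrow> (a, b) \<in> E"
  shows "(\<Sum>u\<in>V. xA u * nbr_sum E' xB u) \<le> cross"
    and "0 < x a \<Longrightarrow> nbr_sum E' xB a \<le> N xB a"
proof -
  have le: "nbr_sum E' xB a \<le> N xB a" if a: "0 < x a" for a
  proof -
    have fin': "finite (E' `` {a})" by (rule finite_subset[OF _ fin]) (use sub in auto)
    have "nbr_sum E' xB a = (\<Sum>u\<in>{u \<in> E' `` {a}. x u < 0}. xB u)"
      unfolding nbr_sum_def by (rule sum.mono_neutral_right) (use fin' in auto)
    also have "\<dots> \<le> N xB a"
      unfolding nbr_sum_def by (rule sum_mono2) (use fin_nbrs a cr in auto)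
    finally show ?thesis .
  qed
  thus "0 < x a \<Longrightarrow> nbr_sum E' xB a \<le> N xB a" .
  show "(\<Sum>u\<in>V. xA u * nbr_sum E' xB u) \<le> cross"
    unfolding cross_def
  proof (rule sum_mono)
    fix u
    show "xA u * nbr_sum E' xB u \<le> xA u * N xB u"
      using le[of u] by (cases "0 < x u") auto
  qed
qed

text \<open>
  If the eigenvector equation at the maximal vertex \<open>wA\<close> survives in a tree where \<open>wA\<close> keeps its
  positive neighbours, then no positive neighbour has been gained.
\<close>

lemma no_gain_at_wA:
  assumes E': "E' \<subseteq> V \<times> V" and keep: "\<And>e. (wA, e) \<in> E \<Longrightarrow> 0 < x e \<Longrightarrow> (wA, e) \<in> E'"
    and eq: "nbr_sum E' xA wA \<le> l * x wA + N xB wA"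
    and z: "(wA, z) \<in> E'" "0 < x z"
  shows "(wA, z) \<in> E"
proof (rule ccontr)
  assume nz: "(wA, z) \<notin> E"
  have fin': "finite (E' `` {wA})" by (rule finite_subset[OF _ fin]) (use E' in auto)
  have finp: "finite {u \<in> E `` {wA}. 0 < x u}" by (rule finite_subset[OF _ fin_nbrs[of wA]]) auto
  have "N xA wA = (\<Sum>u\<in>{u \<in> E `` {wA}. 0 < x u}. xA u)"
    unfolding nbr_sum_def by (rule sum.mono_neutral_right) (use fin_nbrs in auto)
  also have "\<dots> < x z + \<dots>" using z by simp
  also have "\<dots> = (\<Sum>u\<in>insert z {u \<in> E `` {wA}. 0 < x u}. xA u)"
    using finp nz z by (subst sum.insert) auto
  also have "\<dots> \<le> nbr_sum E' xA wA"
    unfolding nbr_sum_def by (rule sum_mono2) (use fin' z keep in auto)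
  finally have "N xA wA < l * x wA + N xB wA" using eq by simp
  thus False using N_split[OF wA_V] posA by simp
qed

lemma reroot_keep:
  assumes r: "rooted V E' wA par rk"
    and par: "\<And>e. e \<in> V \<Longrightarrow> e \<noteq> wA \<Longrightarrow> 0 < x e \<Longrightarrow> par e = pA e \<or> par e = wA"
    and e: "(wA, e) \<in> E" "0 < x e"
  shows "(wA, e) \<in> E'"
proof -
  have "e \<in> V" "e \<noteq> wA" "pA e = wA" by (rule rooted_edgeE[OF rootA e(1)]; simp)+
  thus ?thesis using par[of e] e(2) rootedD(7)[OF r, of e] by auto
qed

end

text \<open>The rehung tree competes with \<open>T\<close>, and the forms of \<open>xA\<close> and
  \<open>xB\<close> there dominate its mixed term \<open>c\<close>. By maximality the equality case
  yields \<open>\<beta>\<close> with \<open>xA - \<beta> * xB\<close> an eigenvector of the new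
  tree; its equations at the hubs forbid new neighbours of the same sign, and at a zero of
  \<open>x\<close> they balance the two signs.\<close>

lemma (in extremal_tree) rigid:
  assumes sp: "spine V d s h" and i: "i \<le> d" "s i = wA" and j: "j \<le> d" "s j = wB"
    and parA: "\<And>e. e \<in> V \<Longrightarrow> e \<noteq> wA \<Longrightarrow> 0 < x e \<Longrightarrow> spine.parent d s h i e = pA e \<or> spine.parent d s h i e = wA"
    and parB: "\<And>e. e \<in> V \<Longrightarrow> e \<noteq> wB \<Longrightarrow> x e < 0 \<Longrightarrow> spine.parent d s h j e = pB e \<or> spine.parent d s h j e = wB"
    and cr: "\<And>a b. (a, b) \<in> parcs (spine_tree V d s h) \<Longrightarrow> 0 < x a \<Longrightarrow> x b < 0 \<Longrightarrow> (a, b) \<in> E"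
  shows "(wA, z) \<in> parcs (spine_tree V d s h) \<Longrightarrow> 0 < x z \<Longrightarrow> (wA, z) \<in> E" (is "_ \<Longrightarrow> _ \<Longrightarrow> ?A")
    and "(wB, z) \<in> parcs (spine_tree V d s h) \<Longrightarrow> x z < 0 \<Longrightarrow> (wB, z) \<in> E" (is "_ \<Longrightarrow> _ \<Longrightarrow> ?B")
    and "z \<in> V \<Longrightarrow> x z = 0 \<Longrightarrow> 0 < nbr_sum (parcs (spine_tree V d s h)) xA z \<longleftrightarrow>
           0 < nbr_sum (parcs (spine_tree V d s h)) xB z"
proof -
  interpret S: spine V d s h by fact
  let ?E = "parcs S.G"
  interpret S': conn_graph S.G V ?E by (rule S.conn_graph_G)
  interpret sw: extremal_tree T V E d l "\<lambda>u. - x u" wB pB rB wA pA rA v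
    by (rule extremal_tree_swap) (rule extremal_tree_axioms)
  have xx: "pos_part (\<lambda>u. - (- x u)) = xA" by (simp add: fun_eq_iff pos_part_def)
  have rA': "rooted V ?E wA (S.parent i) (S.rank i)" using S.spine_rooted[OF i(1)] i(2) by simp
  have rB': "rooted V ?E wB (S.parent j) (S.rank j)" using S.spine_rooted[OF j(1)] j(2) by simp
  have cr': "(a, b) \<in> E" if "(a, b) \<in> ?E" "0 < - x a" "- x b < 0" for a b
    using cr[of b a] S'.E_sym[OF that(1)] E_sym that by auto
  note subE = S'.E_V
  define c where "c = (\<Sum>u\<in>V. xA u * S'.N xB u)"
  have c_sym: "c = (\<Sum>u\<in>V. xB u * S'.N xA u)" unfolding c_def by (rule S'.nbr_sum_sym)
  have cross_sym: "sw.cross = cross" unfolding cross_def sw.cross_def xx by (rule nbr_sum_sym)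
  have c1: "c \<le> cross" unfolding c_def by (rule cross_ge(1)[OF subE cr])
  have QA: "c \<le> (\<Sum>u\<in>V. xA u * (S'.N xA u - l * xA u))"
    using c1 reroot_form_ge[OF rA' parA] by linarith
  have QB: "c \<le> (\<Sum>u\<in>V. xB u * (S'.N xB u - l * xB u))"
  proof -
    have "sw.cross \<le> (\<Sum>u\<in>V. xB u * (S'.N xB u - l * xB u))"
      by (rule sw.reroot_form_ge[OF rB']) (use parB in auto)
    thus ?thesis using c1 cross_sym by linarith
  qed
  obtain \<beta> where \<beta>: "0 < \<beta>" "c = 0 \<or> \<beta> = 1"
    and ev: "\<And>u. u \<in> V \<Longrightarrow> S'.N xA u - \<beta> * S'.N xB u = l * (xA u - \<beta> * xB u)"
  proof (rule S'.disjoint_pair_eigenvector[of xA xB wA wB c l])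
    show "xA u = 0 \<or> xB u = 0" for u by auto
    show "lambda2 S.G \<le> l" by (rule maximal[OF S.in_trees_of_diameter])
  qed (use wA_V wB_V posA negB QA QB c_def that in auto)
  have zero: "S'.N xB u = 0" if "c = 0" "0 < x u" "u \<in> V" for u
  proof -
    have "xA u * S'.N xB u = 0"
      using that(1)[unfolded c_def] that(3) fin
      by (subst (asm) sum_nonneg_eq_0_iff) (auto intro!: mult_nonneg_nonneg S'.nbr_sum_nonneg)
    thus ?thesis using that(2) by simp
  qed
  have zero': "S'.N xA u = 0" if "c = 0" "x u < 0" "u \<in> V" for u
  proof -
    have "xB u * S'.N xA u = 0"
      using that(1)[unfolded c_sym] that(3) fin
      by (subst (asm) sum_nonneg_eq_0_iff) (auto intro!: mult_nonneg_nonneg S'.nbr_sum_nonneg)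
    thus ?thesis using that(2) by simp
  qed
  \<comment> \<open>If \<open>c = 0\<close>, the mixed sum at \<open>wA\<close> is zero in the new
    tree; otherwise \<open>\<beta> = 1\<close> and it is at most the one in
    \<open>T\<close>.\<close>
  have eqA: "S'.N xA wA \<le> l * x wA + N xB wA"
  proof (cases "c = 0")
    case True
    thus ?thesis using ev[OF wA_V] zero[OF True posA wA_V] posA nbr_sum_nonneg[of xB wA] by simp
  next
    case False
    thus ?thesis using ev[OF wA_V] \<beta>(2) posA cross_ge(2)[OF subE cr posA] by simp
  qed
  have eqB: "S'.N xB wB \<le> l * - x wB + N xA wB"
  proof (cases "c = 0")
    case True
    have "\<beta> * S'.N xB wB = \<beta> * (l * - x wB)"
      using ev[OF wB_V] zero'[OF True negB wB_V] negB by (simp add: algebra_simps)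
    hence "S'.N xB wB = l * - x wB"
      by (rule mult_left_cancel[THEN iffD1, rotated]) (use \<beta>(1) in simp)
    thus ?thesis using nbr_sum_nonneg[of xA wB] by simp
  next
    case False
    thus ?thesis using ev[OF wB_V] \<beta>(2) negB sw.cross_ge(2)[OF subE cr' sw.posA] unfolding xx by simp
  qed
  show ?A if "(wA, z) \<in> ?E" "0 < x z"
    by (rule no_gain_at_wA[OF subE reroot_keep[OF rA' parA] eqA that])
  show ?B if "(wB, z) \<in> ?E" "x z < 0"
    by (rule sw.no_gain_at_wA[OF subE sw.reroot_keep[OF rB']]) (use parB eqB that xx in auto)
  show "0 < S'.N xA z \<longleftrightarrow> 0 < S'.N xB z" if z: "z \<in> V" "x z = 0"
    using ev[OF z(1)] z(2) \<beta>(1) by (simp add: pos_part_def zero_less_mult_iff)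
qed

subsection \<open>The diametral path meets both hubs\<close>

context extremal_tree
begin

text \<open>\<open>q\<close> is the position where the path is closest to the root. The two strict
  bounds say that both ends of the path have depth less than \<open>d\<close>, which holds for a
  non-pendant root; hence \<open>1 \<le> q < d\<close>, and \<open>2 \<le> q \<le> d - 2\<close> if
  the root is off the path.\<close>

definition projects :: "('a \<Rightarrow> 'a) \<Rightarrow> ('a \<Rightarrow> nat) \<Rightarrow> nat \<Rightarrow> bool" where
  "projects par rk q \<longleftrightarrow> q \<le> d \<and> (\<forall>t<q. par (v t) = v (Suc t)) \<and> (\<forall>t. q \<le> t \<and> t < d \<longrightarrow> par (v (Suc t)) = v t) \<and>
     rk (v q) + q < d \<and> rk (v q) + (d - q) < d \<and> (\<forall>t\<le>d. rk (v t) = rk (v q) + ((q - t) + (t - q)))"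

lemma projectsD:
  assumes "projects par rk q"
  shows "q \<le> d" "\<And>t. t < q \<Longrightarrow> par (v t) = v (Suc t)" "\<And>t. q \<le> t \<Longrightarrow> t < d \<Longrightarrow> par (v (Suc t)) = v t"
    "rk (v q) + q < d" "rk (v q) + (d - q) < d" "\<And>t. t \<le> d \<Longrightarrow> rk (v t) = rk (v q) + ((q - t) + (t - q))"
  using assms unfolding projects_def by blast+

lemma projection_exists:
  assumes r: "rooted V E w par rk" and deg: "2 \<le> card (E `` {w})"
  obtains q where "projects par rk q"
proof -
  obtain q where q: "q \<le> d" "\<And>t. t < q \<Longrightarrow> par (v t) = v (Suc t)" "\<And>t. q \<le> t \<Longrightarrow> t < d \<Longrightarrow> par (v (Suc t)) = v t"
    "rk (v q) + q < d" "rk (v q) + (d - q) < d"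
    "\<And>t. t \<le> q \<Longrightarrow> rk (v t) = rk (v q) + (q - t)" "\<And>t. q \<le> t \<Longrightarrow> t \<le> d \<Longrightarrow> rk (v t) = rk (v q) + (t - q)"
    by (rule projection[OF r deg]) (rule that)
  have "rk (v t) = rk (v q) + ((q - t) + (t - q))" if "t \<le> d" for t
  proof (cases "t \<le> q")
    case True thus ?thesis using q(6)[OF True] by linarith
  next
    case False thus ?thesis using q(7)[of t] that by linarith
  qed
  note r = this
  have "projects par rk q"
    unfolding projects_def
  proof (intro conjI allI impI)
    show "par (v (Suc t)) = v t" if "q \<le> t \<and> t < d" for t using that by (intro q(3)) auto
  qed (rule q r, assumption?)+
  thus thesis by (rule that)
qed

lemma projects_rev:
  assumes "projects par rk q"
  shows "extremal_tree.projects d (\<lambda>t. v (d - t)) par rk (d - q)"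
proof -
  interpret R: extremal_tree T V E d l x wA pA rA wB pB rB "\<lambda>t. v (d - t)"
    by (rule extremal_tree_rev) (rule extremal_tree_axioms)
  note p = projectsD[OF assms]
  have dq: "d - (d - q) = q" using p(1) by simp
  show ?thesis
    unfolding R.projects_def dq
  proof (intro conjI allI impI)
    show "d - q \<le> d" by simp
    show "rk (v q) + (d - q) < d" "rk (v q) + q < d" by (fact p(5), fact p(4))
    show "par (v (d - t)) = v (d - Suc t)" if t: "t < d - q" for t
    proof -
      have "q \<le> d - Suc t" "d - Suc t < d" "Suc (d - Suc t) = d - t" using t by auto
      thus ?thesis using p(3)[of "d - Suc t"] by simp
    qed
    show "par (v (d - Suc t)) = v (d - t)" if t: "d - q \<le> t \<and> t < d" for t
    proof -
      have "d - Suc t < q" "Suc (d - Suc t) = d - t" using t p(1) by auto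
      thus ?thesis using p(2)[of "d - Suc t"] by simp
    qed
    show "rk (v (d - t)) = rk (v q) + ((d - q - t) + (t - (d - q)))" if t: "t \<le> d" for t
    proof -
      have "(q - (d - t)) + ((d - t) - q) = (d - q - t) + (t - (d - q))" using t p(1) by auto
      thus ?thesis using p(6)[of "d - t"] by simp
    qed
  qed
qed

lemma off_path:
  assumes "rooted V E w par rk" "projects par rk q" "w \<noteq> v q"
  shows "0 < rk (v q)" "w \<notin> v ` {..d}"
proof -
  note p = projectsD[OF assms(2)]
  have "rk (v q) \<noteq> 0" using rooted_rk_zero[OF assms(1) v_in[OF p(1)]] assms(3) by auto
  thus "0 < rk (v q)" by simp
  show "w \<notin> v ` {..d}"
  proof
    assume "w \<in> v ` {..d}"
    then obtain t where "t \<le> d" "w = v t" by auto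
    thus False using p(6)[of t] rootedD(3)[OF assms(1)] \<open>rk (v q) \<noteq> 0\<close> by simp
  qed
qed

text \<open>Going along the path towards position \<open>q\<close> means taking parents, and the
  positive set is closed under that.\<close>

lemma A_toward:
  assumes q: "projects pA rA q" and t: "t \<le> d" "0 < x (v t)" and s: "q \<le> s \<and> s \<le> t \<or> t \<le> s \<and> s \<le> q"
  shows "0 < x (v s)"
proof -
  note p = projectsD[OF q]
  have ne: "v u \<noteq> wA" if "u \<le> d" "u \<noteq> q" for u
    using p(6)[OF that(1)] rootedD(3)[OF rootA] that(2) by auto
  from s show ?thesis
  proof
    assume "q \<le> s \<and> s \<le> t"
    hence "q \<le> s" "s \<le> t" by auto
    have "0 < x (v (t - k))" if "q + k \<le> t" for k
      using that
    proof (induct k)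
      case (Suc k)
      have "Suc (t - Suc k) = t - k" using Suc(2) by simp
      moreover have "q \<le> t - Suc k" "t - Suc k < d" using Suc(2) t(1) by auto
      ultimately have "pA (v (t - k)) = v (t - Suc k)" using p(3)[of "t - Suc k"] by simp
      moreover have "v (t - k) \<noteq> wA" using Suc(2) t(1) by (intro ne) auto
      ultimately show ?case using A_closed[of "v (t - k)"] Suc t(1) v_in[of "t - k"] by simp
    qed (use t in simp)
    from this[of "t - s"] \<open>q \<le> s\<close> \<open>s \<le> t\<close> show ?thesis by simp
  next
    assume "t \<le> s \<and> s \<le> q"
    hence "t \<le> s" "s \<le> q" by auto
    have "0 < x (v (t + k))" if "t + k \<le> q" for k
      using that
    proof (induct k)
      case (Suc k)
      have "pA (v (t + k)) = v (t + Suc k)" using p(2)[of "t + k"] Suc(2) by simp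
      moreover have "v (t + k) \<noteq> wA" using Suc(2) p(1) by (intro ne) auto
      ultimately show ?case using A_closed[of "v (t + k)"] Suc p(1) v_in[of "t + k"] by simp
    qed (use t in simp)
    from this[of "s - t"] \<open>s \<le> q\<close> \<open>t \<le> s\<close> show ?thesis by simp
  qed
qed

lemma B_toward:
  assumes q: "projects pB rB q" and t: "t \<le> d" "x (v t) < 0" and s: "q \<le> s \<and> s \<le> t \<or> t \<le> s \<and> s \<le> q"
  shows "x (v s) < 0"
proof -
  interpret sw: extremal_tree T V E d l "\<lambda>u. - x u" wB pB rB wA pA rA v
    by (rule extremal_tree_swap) (rule extremal_tree_axioms)
  show ?thesis using sw.A_toward[OF q t(1) _ s] t(2) by simp
qed

text \<open>A hub off the path is put on the spine one step outside its foot, in place of the path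
  vertex there; this touches no position between the feet, and the displaced vertex becomes a hung
  one. Rigidity then shows that nothing was displaced and that the competitor is \<open>T\<close>
  itself.\<close>

lemma path_meets_both:
  assumes prA: "projects pA rA qA" and prB: "projects pB rB qB"
    and A: "0 < x (v qA)" and B: "x (v qB) < 0" and lt: "qA < qB"
  shows "\<exists>h. spine V d v h \<and> E = parcs (spine_tree V d v h) \<and> v qA = wA \<and> v qB = wB \<and> 1 \<le> qA \<and> qB < d \<and>
    (\<forall>e\<in>V - v ` {..d}. h e = qA \<and> 0 < x e \<or> h e = qB \<and> x e < 0)"
proof -
  note pA = projectsD[OF prA] and pB = projectsD[OF prB]
  define i where "i = (if wA = v qA then qA else qA - 1)"
  define j where "j = (if wB = v qB then qB else Suc qB)"
  define s where "s t = (if t = i then wA else if t = j then wB else v t)" for t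
  \<comment> \<open>Vertices where \<open>x\<close> vanishes are hung at \<open>i\<close>;
    \<open>rigid_0\<close> shows below that there are none off the spine.\<close>
  define h where "h e = (if x e < 0 then j else i)" for e
  have i1: "1 \<le> i" using pA(1,4,5) off_path(1)[OF rootA prA] by (auto simp: i_def)
  have jd: "j < d" using pB(1,4,5) off_path(1)[OF rootB prB] by (auto simp: j_def)
  have ij: "i \<le> qA" "qB \<le> j" "i < j" "i \<le> d" "j \<le> d" using lt jd pA(1) by (auto simp: i_def j_def)
  have s_simps: "s i = wA" "s j = wB" "\<And>t. t \<noteq> i \<Longrightarrow> t \<noteq> j \<Longrightarrow> s t = v t"
    using ij by (auto simp: s_def)
  have wA_off: "wA \<noteq> v t" if "t \<le> d" "t \<noteq> i" for t
  proof (cases "wA = v qA")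
    case True thus ?thesis using that pA(1) by (simp add: i_def)
  next
    case False thus ?thesis using that(1) off_path(2)[OF rootA prA False] by blast
  qed
  have wB_off: "wB \<noteq> v t" if "t \<le> d" "t \<noteq> j" for t
  proof (cases "wB = v qB")
    case True thus ?thesis using that pB(1) by (simp add: j_def)
  next
    case False thus ?thesis using that(1) off_path(2)[OF rootB prB False] by blast
  qed
  have wAB: "wA \<noteq> wB" using posA negB by auto
  have sv: "s t = v t" if "t \<le> d" "i < qA \<longrightarrow> t \<noteq> i" "qB < j \<longrightarrow> t \<noteq> j" for t
    using that i1[unfolded i_def] by (auto simp: s_def i_def j_def split: if_splits)
  have sp: "spine V d s h"
  proof
    show "finite V" by (rule fin)
    show "2 \<le> d" using d3 by simp
    show "inj_on s {..d}"
    proof (rule inj_onI)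
      fix t u assume tu: "t \<in> {..d}" "u \<in> {..d}" "s t = s u"
      thus "t = u" using wA_off[of t] wA_off[of u] wB_off[of t] wB_off[of u] wAB
        by (auto simp: s_def split: if_splits)
    qed
    show "s ` {..d} \<subseteq> V" using wA_V wB_V v_in by (auto simp: s_def)
    show "1 \<le> h e \<and> h e < d" for e using i1 jd ij by (simp add: h_def)
  qed
  interpret S: spine V d s h by (rule sp)
  \<comment> \<open>Along the spine a positive vertex keeps its parent unless the new one is the
    hub. Position \<open>j\<close> cannot intervene, as \<open>A_toward\<close> would make
    \<open>v qB\<close> positive.\<close>
  have parA: "S.parent i e = pA e \<or> S.parent i e = wA" if e: "e \<in> V" "e \<noteq> wA" "0 < x e" for e
  proof (cases "e \<in> S.S")
    case False thus ?thesis using e s_simps by (simp add: S.parent_leaf h_def)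
  next
    case True
    then obtain t where t: "t \<le> d" "e = s t" by auto
    have ti: "t \<noteq> i" and tj: "t \<noteq> j" using t e s_simps negB by auto
    hence et: "e = v t" using t s_simps by simp
    show ?thesis
    proof (cases "t < i")
      case True
      hence "S.parent i e = s (Suc t)" using t by simp
      moreover have "pA e = v (Suc t)" using pA(2)[of t] True ij et by simp
      moreover have "Suc t \<noteq> j" using True ij by simp
      ultimately show ?thesis using s_simps by metis
    next
      case False
      hence t1: "i < t" "S.parent i e = s (t - 1)" using t ti by auto
      have "qA \<le> t - 1 \<or> t - 1 = i" using t1(1) by (auto simp: i_def split: if_splits)
      moreover have "s (t - 1) = v (t - 1) \<and> pA e = v (t - 1)" if q: "qA \<le> t - 1" "t - 1 \<noteq> i"
      proof -
        have "Suc (t - 1) = t" using t1 by simp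
        hence "pA e = v (t - 1)" using pA(3)[of "t - 1"] q t et by simp
        moreover have "t - 1 \<noteq> j"
        proof
          assume "t - 1 = j"
          hence "qA \<le> qB \<and> qB \<le> t" using ij lt by simp
          hence "0 < x (v qB)" using A_toward[OF prA t(1)] e(3) et by blast
          thus False using B by simp
        qed
        ultimately show ?thesis using s_simps(3)[OF q(2)] by simp
      qed
      ultimately show ?thesis using t1 s_simps by metis
    qed
  qed
  have parB: "S.parent j e = pB e \<or> S.parent j e = wB" if e: "e \<in> V" "e \<noteq> wB" "x e < 0" for e
  proof (cases "e \<in> S.S")
    case False thus ?thesis using e s_simps by (simp add: S.parent_leaf h_def)
  next
    case True
    then obtain t where t: "t \<le> d" "e = s t" by auto
    have ti: "t \<noteq> i" and tj: "t \<noteq> j" using t e s_simps posA by auto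
    hence et: "e = v t" using t s_simps by simp
    show ?thesis
    proof (cases "t < j")
      case False
      hence t1: "j < t" "S.parent j e = s (t - 1)" using t tj by auto
      have "Suc (t - 1) = t" using t1 by simp
      hence "pB e = v (t - 1)" using pB(3)[of "t - 1"] t1 t et ij by simp
      moreover have "t - 1 \<noteq> i" using t1 ij by simp
      ultimately show ?thesis using t1 s_simps by metis
    next
      case True
      hence t1: "S.parent j e = s (Suc t)" using t by simp
      have "Suc t \<le> qB \<or> Suc t = j" using True by (auto simp: j_def split: if_splits)
      moreover have "s (Suc t) = v (Suc t) \<and> pB e = v (Suc t)" if q: "Suc t \<le> qB" "Suc t \<noteq> j"
      proof -
        have "pB e = v (Suc t)" using pB(2)[of t] q et by simp
        moreover have "Suc t \<noteq> i"
        proof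
          assume "Suc t = i"
          hence "t \<le> qA \<and> qA \<le> qB" using ij lt by simp
          hence "x (v qA) < 0" using B_toward[OF prB t(1)] e(3) et by blast
          thus False using A by simp
        qed
        ultimately show ?thesis using s_simps(3)[OF _ q(2)] by simp
      qed
      ultimately show ?thesis using t1 s_simps by metis
    qed
  qed
  \<comment> \<open>A new edge between the sign sets would have to use a replaced position. In
    either direction this gives the value at a foot \<open>v qA\<close> or \<open>v qB\<close> the
    wrong sign.\<close>
  have cr: "(a, b) \<in> E" if ab: "(a, b) \<in> parcs S.G" "0 < x a" "x b < 0" for a b
  proof -
    consider t where "t < d" "a = s t" "b = s (Suc t)" | t where "t < d" "a = s (Suc t)" "b = s t"
      | "a \<in> V - S.S" "b = s (h a)" | "b \<in> V - S.S" "a = s (h b)"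
      using ab(1) unfolding S.arcs_eq by blast
    thus ?thesis
    proof cases
      case 1
      have "t = i \<Longrightarrow> i < qA \<Longrightarrow> b = v qA" using 1 ij sv[of qA] lt pA(1) by (auto simp: i_def split: if_splits)
      hence a: "i < qA \<longrightarrow> t \<noteq> i" using ab A by auto
      have "Suc t = j \<Longrightarrow> qB < j \<Longrightarrow> a = v qB" using 1 ij sv[of qB] lt pB(1) by (auto simp: j_def split: if_splits)
      hence b: "qB < j \<longrightarrow> Suc t \<noteq> j" using ab B by auto
      have "t \<noteq> j" "Suc t \<noteq> i" using 1 ab s_simps posA negB by auto
      hence "a = v t" "b = v (Suc t)" using 1 sv a b by auto
      thus ?thesis using v_edge 1 by simp
    next
      case 2
      have ne: "Suc t \<noteq> j" "t \<noteq> i" using 2 ab s_simps posA negB by auto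
      have a: "\<not> (i < qA \<and> Suc t = i)"
      proof
        assume h: "i < qA \<and> Suc t = i"
        hence "b = v t" using 2 ne ij s_simps by simp
        moreover have "t \<le> qA \<and> qA \<le> qB" using h lt by simp
        ultimately have "x (v qA) < 0" using B_toward[OF prB, of t] 2 ab by auto
        thus False using A by simp
      qed
      have b: "\<not> (qB < j \<and> t = j)"
      proof
        assume h: "qB < j \<and> t = j"
        hence "a = v (Suc t)" using 2 ne ij s_simps by simp
        moreover have "qA \<le> qB \<and> qB \<le> Suc t" using h lt by simp
        ultimately have "0 < x (v qB)" using A_toward[OF prA, of "Suc t"] 2 ab by auto
        thus False using B by simp
      qed
      have "a = v (Suc t)" "b = v t" using 2 sv[of t] sv[of "Suc t"] a b ne by auto
      thus ?thesis using E_sym[OF v_edge] 2 by simp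
    next
      case 3 thus ?thesis using ab s_simps posA by (simp add: h_def)
    next
      case 4 thus ?thesis using ab s_simps negB by (simp add: h_def)
    qed
  qed
  note rg = rigid[OF sp ij(4) s_simps(1) ij(5) s_simps(2)]
  have rigid_A: "(wA, z) \<in> E" if "(wA, z) \<in> parcs S.G" "0 < x z" for z
    by (rule rg(1); (erule (2) parA | erule (2) parB | erule (2) cr | fact that))
  have rigid_B: "(wB, z) \<in> E" if "(wB, z) \<in> parcs S.G" "x z < 0" for z
    by (rule rg(2); (erule (2) parA | erule (2) parB | erule (2) cr | fact that))
  have rigid_0: "0 < nbr_sum (parcs S.G) xA z \<longleftrightarrow> 0 < nbr_sum (parcs S.G) xB z" if "z \<in> V" "x z = 0" for z
    by (rule rg(3); (erule (2) parA | erule (2) parB | erule (2) cr | fact that))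
  \<comment> \<open>A hung vertex has its hub as only neighbour. If \<open>x\<close> vanished there,
    the neighbour sum of \<open>xA\<close> would be positive and that of \<open>xB\<close> zero,
    against \<open>rigid_0\<close>.\<close>
  have leaf: "x e \<noteq> 0 \<and> (0 < x e \<longrightarrow> pA e = wA) \<and> (x e < 0 \<longrightarrow> pB e = wB)" if e: "e \<in> V" "e \<notin> S.S" for e
  proof -
    have nb: "parcs S.G `` {e} = {s (h e)}" by (rule S.nbrs_leaf[OF e])
    have arc: "(s (h e), e) \<in> parcs S.G" using e unfolding S.arcs_eq by auto
    have "x e \<noteq> 0"
    proof
      assume x0: "x e = 0"
      hence "h e = i" by (simp add: h_def)
      thus False using rigid_0[OF e(1) x0] posA unfolding nbr_sum_def nb by (simp add: s_simps)
    qed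
    moreover have "pA e = wA" if "0 < x e"
    proof -
      have "(wA, e) \<in> parcs S.G" using arc that s_simps by (simp add: h_def)
      from rigid_A[OF this that] show ?thesis by (rule rooted_edgeE[OF rootA]) simp_all
    qed
    moreover have "pB e = wB" if "x e < 0"
    proof -
      have "(wB, e) \<in> parcs S.G" using arc that s_simps by (simp add: h_def)
      from rigid_B[OF this that] show ?thesis by (rule rooted_edgeE[OF rootB]) simp_all
    qed
    ultimately show ?thesis by blast
  qed
  \<comment> \<open>Otherwise \<open>v i\<close> was displaced and hangs at a hub. It is not
    negative, since \<open>v qA\<close> is positive, and its parent \<open>v qA\<close> differs from
    \<open>wA\<close>, so it is not positive either.\<close>
  have wA: "wA = v qA"
  proof (rule ccontr)
    assume ne: "wA \<noteq> v qA"
    hence i: "i = qA - 1" "i < qA" using i1 by (auto simp: i_def)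
    have z: "v i \<in> V" "v i \<notin> S.S"
    proof -
      show "v i \<in> V" using v_in ij by simp
      show "v i \<notin> S.S"
      proof
        assume "v i \<in> S.S"
        then obtain t where t: "t \<le> d" "v i = s t" by auto
        thus False using off_path(2)[OF rootA prA ne] wB_off[of i] ij by (auto simp: s_def split: if_splits)
      qed
    qed
    have "pA (v i) = v qA" using pA(2)[of i] i by simp
    hence "\<not> 0 < x (v i)" using leaf[OF z] ne by auto
    moreover have "\<not> x (v i) < 0"
    proof
      assume "x (v i) < 0"
      moreover have "i \<le> qA \<and> qA \<le> qB" using ij lt by simp
      ultimately have "x (v qA) < 0" using B_toward[OF prB ij(4)] by blast
      thus False using A by simp
    qed
    ultimately show False using leaf[OF z] by linarith
  qed
  have wB: "wB = v qB"
  proof (rule ccontr)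
    assume ne: "wB \<noteq> v qB"
    hence j: "j = Suc qB" by (auto simp: j_def)
    have z: "v j \<in> V" "v j \<notin> S.S"
    proof -
      show "v j \<in> V" using v_in ij by simp
      show "v j \<notin> S.S"
      proof
        assume "v j \<in> S.S"
        then obtain t where t: "t \<le> d" "v j = s t" by auto
        thus False using off_path(2)[OF rootB prB ne] wA_off[of j] ij by (auto simp: s_def split: if_splits)
      qed
    qed
    have "pB (v j) = v qB" using pB(3)[of qB] j jd by simp
    hence "\<not> x (v j) < 0" using leaf[OF z] ne by auto
    moreover have "\<not> 0 < x (v j)"
    proof
      assume "0 < x (v j)"
      moreover have "qA \<le> qB \<and> qB \<le> j" using ij lt by simp
      ultimately have "0 < x (v qB)" using A_toward[OF prA ij(5)] by blast
      thus False using B by simp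
    qed
    ultimately show False using leaf[OF z] by linarith
  qed
  have ij': "i = qA" "j = qB" using wA wB by (auto simp: i_def j_def)
  have "s = v" using wA wB ij' by (auto simp: s_def fun_eq_iff)
  \<comment> \<open>Two trees on \<open>V\<close> have equally many arcs, so an inclusion suffices
    for equality.\<close>
  have "parcs S.G \<subseteq> E"
  proof -
    have sp: "(s t, s (Suc t)) \<in> E" if "t < d" for t using v_edge[OF that] \<open>s = v\<close> by simp
    have lf: "(e, s (h e)) \<in> E" if "e \<in> V" "e \<notin> S.S" for e
    proof -
      have ne: "e \<noteq> wA" "e \<noteq> wB"
        using S.s_in(2)[OF ij(4)] S.s_in(2)[OF ij(5)] s_simps(1,2) that(2) by auto
      show ?thesis
        using leaf[OF that] rootedD(6)[OF rootA that(1) ne(1)] rootedD(6)[OF rootB that(1) ne(2)] s_simps(1,2)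
        by (cases "0 < x e") (auto simp: h_def)
    qed
    show ?thesis unfolding S.arcs_eq using sp lf E_sym by auto
  qed
  moreover have "card (parcs S.G) = card E"
    using rooted_card_arcs[OF rootA] rooted_card_arcs[OF S.spine_rooted[of 0]] by simp
  moreover have "finite E" using finite_subset[OF E_V] fin by simp
  ultimately have "E = parcs S.G" by (metis card_subset_eq)
  moreover have "h e = qA \<and> 0 < x e \<or> h e = qB \<and> x e < 0" if "e \<in> V - v ` {..d}" for e
    using leaf[of e] that ij' \<open>s = v\<close> by (auto simp: h_def)
  ultimately show ?thesis using sp wA wB i1 jd ij' \<open>s = v\<close> by (intro exI[of _ h]) simp
qed

end

section \<open>A path that misses the positive subtree\<close>

lemma nbr_sum_mono_rel:
  assumes "finite (E' `` {a})" "finite (E `` {a})" "\<And>b. 0 \<le> z b"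
    and "\<And>b. (a, b) \<in> E' \<Longrightarrow> y b \<noteq> 0 \<Longrightarrow> (a, b) \<in> E \<and> y b \<le> z b"
  shows "nbr_sum E' y a \<le> nbr_sum E z a"
proof -
  have "nbr_sum E' y a = (\<Sum>b\<in>{b \<in> E' `` {a}. y b \<noteq> 0}. y b)"
    unfolding nbr_sum_def by (rule sum.mono_neutral_right) (use assms(1) in auto)
  also have "\<dots> \<le> (\<Sum>b\<in>{b \<in> E' `` {a}. y b \<noteq> 0}. z b)" by (rule sum_mono) (use assms(4) in auto)
  also have "\<dots> \<le> nbr_sum E z a"
    unfolding nbr_sum_def by (rule sum_mono2) (use assms in auto)
  finally show ?thesis .
qed

text \<open>The assumption \<open>p \<le> q\<close> says that, seen from \<open>wB\<close>, the
  initial piece \<open>v 0\<close>, ..., \<open>v (p - 1)\<close> lies behind \<open>v p\<close>;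
  reversal of the path covers the other order.\<close>

locale missing_A = extremal_tree +
  fixes p q
  assumes prA: "projects pA rA p" and prB: "projects pB rB q" and pq: "p \<le> q"
    and miss: "x (v p) \<le> 0"
begin

lemmas pA' = projectsD[OF prA] and pB' = projectsD[OF prB]

lemma path_nonpos: "t \<le> d \<Longrightarrow> x (v t) \<le> 0"
  using A_toward[OF prA, of t p] miss pA'(1) by (meson linorder_not_less linorder_le_cases order_refl)

lemma wA_off: "wA \<notin> v ` {..d}" using path_nonpos posA by force

lemma rA_pos: "0 < rA (v p)" using off_path(1)[OF rootA prA] miss posA by force

lemma p_bounds: "2 \<le> p" "p + 2 \<le> d" using pA'(4,5) pA'(1) rA_pos by auto

lemma l1: "1 \<le> l" using l_ge(2) p_bounds by simp

definition M where "M = - x wB"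

lemma M_pos: "0 < M" using negB by (simp add: M_def)

lemma swapped: "extremal_tree T V E d l (\<lambda>u. - x u) wB pB rB wA pA rA v"
  by (rule extremal_tree_swap) (rule extremal_tree_axioms)

lemma xB_parent_le: "e \<in> V \<Longrightarrow> e \<noteq> wB \<Longrightarrow> x e < 0 \<Longrightarrow> xB (pB e) \<le> M"
  using extremal_tree.A_parent_le[OF swapped, of e] by (simp add: M_def)

lemma xB_eq: "u \<in> V \<Longrightarrow> x u < 0 \<Longrightarrow> N xB u = l * xB u + N xA u"
  using N_split[of u] by simp

text \<open>\<open>B_max\<close> covers the non-pendant vertices. At a negative pendant one the
  equation gives \<open>l * xB u = xB (pB u) \<le> M\<close>, and \<open>1 \<le> l\<close> finishes;
  this is the purpose of the bound on \<open>l\<close> for \<open>4 \<le> d\<close>.\<close>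

lemma xB_le:
  assumes u: "u \<in> V"
  shows "xB u \<le> M"
proof (cases "x u < 0 \<and> u \<noteq> wB")
  case False
  thus ?thesis using M_pos by (auto simp: M_def pos_part_def)
next
  case True
  show ?thesis
  proof (cases "2 \<le> card (E `` {u})")
    case True
    thus ?thesis using B_max[OF u True] M_pos by (simp add: pos_part_def M_def)
  next
    case False
    have e: "(u, pB u) \<in> E" using rootedD(6)[OF rootB u] True by simp
    hence "E `` {u} \<noteq> {}" by blast
    hence "0 < card (E `` {u})" using fin_nbrs[of u] by (simp add: card_gt_0_iff)
    hence "card (E `` {u}) = 1" using False by simp
    then obtain y where "E `` {u} = {y}" by (auto simp: card_1_singleton_iff)
    hence nb: "E `` {u} = {pB u}" using e by auto
    have "x (pB u) < 0" using B_closed[OF u] True by simp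
    hence "l * xB u = xB (pB u)" using xB_eq[OF u] True by (simp add: nbr_sum_def nb)
    hence "l * xB u \<le> M" using xB_parent_le[OF u] True by simp
    moreover have "1 * xB u \<le> l * xB u" by (rule mult_right_mono[OF l1]) simp
    ultimately show ?thesis by simp
  qed
qed

text \<open>The branch behind \<open>v (p - 1)\<close> as seen from \<open>wB\<close>, that is, its
  descendants in the rooting at \<open>wB\<close>. Its only edge to the rest joins
  \<open>u\<^sub>1\<close> and \<open>v p\<close>.\<close>

definition Lam where "Lam = {e \<in> V. (e, v (p - 1)) \<in> {(e, pB e) |e. e \<in> V \<and> e \<noteq> wB}\<^sup>*}"

abbreviation "u\<^sub>1 \<equiv> v (p - 1)"

lemma u1: "u\<^sub>1 \<in> V" "u\<^sub>1 \<noteq> wB" "pB u\<^sub>1 = v p" "u\<^sub>1 \<in> Lam"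
proof -
  show u: "u\<^sub>1 \<in> V" using v_in p_bounds by simp
  have "0 < rB u\<^sub>1" using pB'(6)[of "p - 1"] p_bounds pq by simp
  thus "u\<^sub>1 \<noteq> wB" using rootedD(3)[OF rootB] by auto
  show "pB u\<^sub>1 = v p" using pB'(2)[of "p - 1"] p_bounds pq by simp
  show "u\<^sub>1 \<in> Lam" using u by (simp add: Lam_def)
qed

lemma Lam_V: "e \<in> Lam \<Longrightarrow> e \<in> V" by (simp add: Lam_def)

lemma Lam_step:
  assumes "e \<in> Lam" "e \<noteq> u\<^sub>1"
  shows "e \<noteq> wB" "pB e \<in> Lam"
proof -
  let ?R = "{(e, pB e) |e. e \<in> V \<and> e \<noteq> wB}"
  have "(e, u\<^sub>1) \<in> ?R\<^sup>*" using assms(1) by (simp add: Lam_def)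
  then obtain y where y: "(e, y) \<in> ?R" "(y, u\<^sub>1) \<in> ?R\<^sup>*"
    using assms(2) by (meson converse_rtranclE)
  show "e \<noteq> wB" using y(1) by auto
  have "y = pB e" using y(1) by auto
  thus "pB e \<in> Lam" using y rootedD(4)[OF rootB Lam_V[OF assms(1)] \<open>e \<noteq> wB\<close>] by (simp add: Lam_def)
qed

lemma Lam_child: "e \<in> V \<Longrightarrow> e \<noteq> wB \<Longrightarrow> pB e \<in> Lam \<Longrightarrow> e \<in> Lam"
  unfolding Lam_def by (auto intro: converse_rtrancl_into_rtrancl)

lemma Lam_rank: "e \<in> Lam \<Longrightarrow> rB u\<^sub>1 \<le> rB e"
proof -
  assume e: "e \<in> Lam"
  let ?R = "{(e, pB e) |e. e \<in> V \<and> e \<noteq> wB}"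
  have "(e, u\<^sub>1) \<in> ?R\<^sup>*" using e by (simp add: Lam_def)
  thus ?thesis
    by (induct rule: converse_rtrancl_induct) (use rootedD(5)[OF rootB] in force)+
qed

lemma Lam_not: "v p \<notin> Lam" "wB \<notin> Lam"
proof -
  have r: "rB u\<^sub>1 = Suc (rB (v p))"
    using pB'(6)[of "p - 1"] pB'(6)[of p] p_bounds pq by simp
  show "v p \<notin> Lam" using Lam_rank[of "v p"] r by auto
  show "wB \<notin> Lam" using Lam_rank[of wB] r rootedD(3)[OF rootB] by auto
qed

lemma Lam_boundary:
  assumes "(a, b) \<in> E" "a \<in> Lam" "b \<notin> Lam"
  shows "a = u\<^sub>1" "b = v p"
proof -
  have "a = u\<^sub>1 \<and> b = v p"
  proof (rule rooted_edgeE[OF rootB assms(1)])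
    assume "a \<noteq> wB" "b = pB a"
    thus ?thesis using Lam_step(2)[OF assms(2)] assms(3) u1(3) by auto
  next
    assume "b \<in> V" "b \<noteq> wB" "a = pB b"
    thus ?thesis using Lam_child[of b] assms by simp
  qed
  thus "a = u\<^sub>1" "b = v p" by auto
qed

lemma Lam_path: "t < p \<Longrightarrow> v t \<in> Lam"
proof (induct "p - 1 - t" arbitrary: t)
  case 0
  hence "t = p - 1" by simp
  thus ?case using u1(4) by simp
next
  case (Suc k)
  have "v (Suc t) \<in> Lam" using Suc(1)[of "Suc t"] Suc(2) by simp
  moreover have "pB (v t) = v (Suc t)" using pB'(2)[of t] Suc(3) pq by simp
  moreover have "v t \<noteq> wB"
    using pB'(6)[of t] Suc(3) pq pB'(1) rootedD(3)[OF rootB] by force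
  ultimately show ?case using Lam_child[of "v t"] v_in[of t] Suc(3) pA'(1) by simp
qed

text \<open>The descent from \<open>v p\<close> to \<open>wA\<close> cannot enter the branch: the
  only entrance \<open>u\<^sub>1\<close> is farther from \<open>wA\<close> than
  \<open>v p\<close>.\<close>

lemma Lam_wA: "wA \<notin> Lam"
proof -
  have "k \<le> rA (v p) \<Longrightarrow> (pA ^^ k) (v p) \<in> V \<and> rA ((pA ^^ k) (v p)) = rA (v p) - k \<and> (pA ^^ k) (v p) \<notin> Lam" for k
  proof (induct k)
    case 0 thus ?case using v_in pA'(1) Lam_not by simp
  next
    case (Suc k)
    let ?y = "(pA ^^ k) (v p)"
    from Suc have y: "?y \<in> V" "rA ?y = rA (v p) - k" "?y \<notin> Lam" by auto
    hence "?y \<noteq> wA" using Suc(2) rootedD(3)[OF rootA] by auto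
    note st = rootedD(4,5,7)[OF rootA y(1) this]
    have "pA ?y \<noteq> u\<^sub>1"
    proof
      assume "pA ?y = u\<^sub>1"
      moreover have "rA u\<^sub>1 = Suc (rA (v p))" using pA'(6)[of "p - 1"] p_bounds by simp
      ultimately show False using st(2) y(2) by simp
    qed
    hence "pA ?y \<notin> Lam" using Lam_boundary(1)[OF st(3)] y(3) by blast
    thus ?case using st y(2) Suc(2) by simp
  qed
  from this[of "rA (v p)"] have z: "(pA ^^ rA (v p)) (v p) \<in> V" "rA ((pA ^^ rA (v p)) (v p)) = 0"
    "(pA ^^ rA (v p)) (v p) \<notin> Lam" by auto
  thus ?thesis using rooted_rk_zero[OF rootA z(1,2)] by simp
qed

text \<open>A positive vertex of the branch would have a positive descent to \<open>wA\<close>,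
  which leaves the branch through \<open>u\<^sub>1\<close>, a vertex of the nonpositive
  path.\<close>

lemma Lam_nonpos: "e \<in> Lam \<Longrightarrow> x e \<le> 0"
proof (induct "rA e" arbitrary: e)
  case 0
  hence "e = wA" using rooted_rk_zero[OF rootA, of e] Lam_V by simp
  thus ?case using Lam_wA 0 by simp
next
  case (Suc k)
  note eV = Lam_V[OF Suc(3)]
  have ne: "e \<noteq> wA" using Lam_wA Suc by auto
  show ?case
  proof (rule ccontr)
    assume "\<not> x e \<le> 0"
    hence pos: "0 < x e" by simp
    have "0 < x (pA e)" by (rule A_closed[OF eV ne pos])
    hence "pA e \<notin> Lam" using Suc(1)[of "pA e"] Suc(2) rootedD(5)[OF rootA eV ne] by force
    hence "e = u\<^sub>1" using Lam_boundary(1)[OF rootedD(6)[OF rootA eV ne] Suc(3)] by simp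
    moreover have "p - 1 \<le> d" using p_bounds by simp
    ultimately show False using path_nonpos[of "p - 1"] pos by simp
  qed
qed

text \<open>Neither the branch nor \<open>v p\<close> carries positive values, so the mixed sum
  drops out of the equation.\<close>

lemma Lam_eq:
  assumes e: "e \<in> Lam" "x e < 0"
  shows "N xB e = l * xB e"
proof -
  have "N xA e = 0"
    unfolding nbr_sum_def
  proof (rule sum.neutral, rule ballI)
    fix u assume "u \<in> E `` {e}"
    hence "(e, u) \<in> E" by simp
    hence "u \<in> Lam \<or> u = v p" using Lam_boundary(2)[OF _ e(1)] by blast
    thus "xA u = 0" using Lam_nonpos[of u] miss by auto
  qed
  thus ?thesis using xB_eq[OF Lam_V[OF e(1)] e(2)] by simp
qed

lemma finLam: "finite Lam" using finite_subset[OF _ fin, of Lam] Lam_V by blast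

text \<open>Cutting the branch off at \<open>v p\<close> costs only the product of the two values at the cut edge.\<close>

lemma Lam_form: "(\<Sum>e\<in>Lam. 2 * xB e * xB (pB e) - l * (xB e)\<^sup>2) = xB u\<^sub>1 * xB (v p)"
proof -
  \<comment> \<open>Pairing \<open>xB\<close>, cut to the branch, with \<open>N xB\<close> counts
    every edge inside twice and the cut edge once; the eigenvector equation evaluates the same
    sum.\<close>
  define z where "z e = (if e \<in> Lam then xB e else 0)" for e
  have sub: "Lam \<subseteq> V - {wB}" using Lam_V Lam_not by auto
  have "(\<Sum>e\<in>V. z e * N xB e) = (\<Sum>e\<in>Lam. l * (xB e)\<^sup>2)"
  proof -
    have "(\<Sum>e\<in>V. z e * N xB e) = (\<Sum>e\<in>Lam. z e * N xB e)"
      by (rule sum.mono_neutral_right) (use fin sub in \<open>auto simp: z_def\<close>)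
    also have "\<dots> = (\<Sum>e\<in>Lam. l * (xB e)\<^sup>2)"
    proof (rule sum.cong[OF refl])
      fix e assume "e \<in> Lam"
      thus "z e * N xB e = l * (xB e)\<^sup>2"
        using Lam_eq[of e] by (cases "x e < 0") (auto simp: z_def power2_eq_square)
    qed
    finally show ?thesis .
  qed
  moreover have "(\<Sum>e\<in>V. z e * N xB e) = (\<Sum>e\<in>Lam. xB e * xB (pB e)) + (\<Sum>e\<in>Lam - {u\<^sub>1}. xB (pB e) * xB e)"
  proof -
    have "(\<Sum>e\<in>V. z e * N xB e) = (\<Sum>e\<in>V - {wB}. z e * xB (pB e)) + (\<Sum>e\<in>V - {wB}. z (pB e) * xB e)"
      unfolding rooted_quadratic_form[OF rootB] by (rule sum.distrib)
    also have "(\<Sum>e\<in>V - {wB}. z e * xB (pB e)) = (\<Sum>e\<in>Lam. z e * xB (pB e))"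
      by (rule sum.mono_neutral_right) (use fin sub in \<open>auto simp: z_def\<close>)
    also have "\<dots> = (\<Sum>e\<in>Lam. xB e * xB (pB e))" by (rule sum.cong) (auto simp: z_def)
    also have "(\<Sum>e\<in>V - {wB}. z (pB e) * xB e) = (\<Sum>e\<in>Lam - {u\<^sub>1}. z (pB e) * xB e)"
    proof (rule sum.mono_neutral_right)
      show "\<forall>e\<in>V - {wB} - (Lam - {u\<^sub>1}). z (pB e) * xB e = 0"
        using Lam_child Lam_not u1(3) by (auto simp: z_def)
    qed (use fin sub in auto)
    also have "\<dots> = (\<Sum>e\<in>Lam - {u\<^sub>1}. xB (pB e) * xB e)"
      by (rule sum.cong) (use Lam_step(2) in \<open>auto simp: z_def\<close>)
    finally show ?thesis .
  qed
  moreover have "(\<Sum>e\<in>Lam. xB (pB e) * xB e) = xB u\<^sub>1 * xB (v p) + (\<Sum>e\<in>Lam - {u\<^sub>1}. xB (pB e) * xB e)"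
    using sum.remove[OF finLam u1(4), of "\<lambda>e. xB (pB e) * xB e"] u1(3) by simp
  moreover have "(\<Sum>e\<in>Lam. xB (pB e) * xB e) = (\<Sum>e\<in>Lam. xB e * xB (pB e))" by (simp add: mult.commute)
  moreover have "(\<Sum>e\<in>Lam. 2 * xB e * xB (pB e) - l * (xB e)\<^sup>2) =
      2 * (\<Sum>e\<in>Lam. xB e * xB (pB e)) - (\<Sum>e\<in>Lam. l * (xB e)\<^sup>2)"
    by (simp add: sum_subtractf sum_distrib_left mult.assoc)
  ultimately show ?thesis by linarith
qed

lemma path_nbr:
  assumes "(v t, v s) \<in> E" "t \<le> d" "s \<le> d"
  shows "s = Suc t \<or> t = Suc s"
proof -
  obtain par rk where r: "rooted V E (v 0) par rk" "\<And>t. t \<le> d \<Longrightarrow> rk (v t) = t"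
    by (rule root_at_path_start) (rule that)
  show ?thesis
    by (rule rooted_edgeE[OF r(1) assms(1)]) (use r(2)[OF assms(2)] r(2)[OF assms(3)] in linarith)+
qed

text \<open>One number in two roles: it bounds the degree of \<open>u\<^sub>1\<close>, whose
  neighbours are \<open>v p\<close>, \<open>v (p - 2)\<close> or off the path, and it is a lower
  bound for the number of branch vertices that can be hung at \<open>wB\<close>, among them
  \<open>v 0\<close> and \<open>v 1\<close>.\<close>

definition m where "m = Suc (Suc (card (Lam - v ` {..d})))"

lemma nbrs_u1: "E `` {u\<^sub>1} \<subseteq> {v p, v (p - 2)} \<union> (Lam - v ` {..d})"
proof
  fix u assume "u \<in> E `` {u\<^sub>1}"
  hence e: "(u\<^sub>1, u) \<in> E" by simp
  show "u \<in> {v p, v (p - 2)} \<union> (Lam - v ` {..d})"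
  proof (cases "u \<in> v ` {..d}")
    case True
    then obtain t where t: "t \<le> d" "u = v t" by auto
    hence "t = Suc (p - 1) \<or> p - 1 = Suc t" using path_nbr[of "p - 1" t] e p_bounds by simp
    hence "t = p \<or> t = p - 2" using p_bounds by auto
    thus ?thesis using t by auto
  next
    case False
    hence "u \<noteq> v p" using pA'(1) by auto
    thus ?thesis using Lam_boundary(2)[OF e u1(4)] False by blast
  qed
qed

lemma card_nbrs_u1: "card (E `` {u\<^sub>1}) \<le> m"
proof -
  have "card (E `` {u\<^sub>1}) \<le> card ({v p, v (p - 2)} \<union> (Lam - v ` {..d}))"
    by (rule card_mono[OF _ nbrs_u1]) (use finLam in auto)
  also have "\<dots> \<le> card {v p, v (p - 2)} + card (Lam - v ` {..d})" by (rule card_Un_le)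
  also have "card {v p, v (p - 2)} \<le> 2" by (simp add: card_insert_if)
  finally show ?thesis by (simp add: m_def)
qed

lemma N_u1_le: "N xB u\<^sub>1 \<le> real (card (E `` {u\<^sub>1})) * M"
  unfolding nbr_sum_def by (rule sum_bounded_above) (use xB_le nbrs_in in blast)

text \<open>The equation at \<open>u\<^sub>1\<close> bounds \<open>l * xB u\<^sub>1\<close> by
  \<open>m * M\<close>. The right-hand side is what \<open>m\<close> pendant vertices of value
  \<open>M / l\<close> at a vertex of value \<open>M\<close> contribute to the form, as
  \<open>2 * M * (M / l) - l * (M / l)\<^sup>2 = M\<^sup>2 / l\<close>.\<close>

lemma cut_le: "xB u\<^sub>1 * xB (v p) \<le> real m * M\<^sup>2 / l"
proof (cases "x u\<^sub>1 < 0")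
  case True
  have "l * xB u\<^sub>1 \<le> real (card (E `` {u\<^sub>1})) * M" using N_u1_le Lam_eq[OF u1(4) True] by simp
  also have "\<dots> \<le> real m * M" using card_nbrs_u1 M_pos by (intro mult_right_mono) auto
  finally have "xB u\<^sub>1 \<le> real m * M / l" using l1 by (simp add: field_simps)
  hence "xB u\<^sub>1 * xB (v p) \<le> real m * M / l * M"
    using xB_le[OF v_in[OF pA'(1)]] M_pos l1 by (intro mult_mono) auto
  thus ?thesis by (simp add: power2_eq_square)
next
  case False
  thus ?thesis using M_pos l1 by simp
qed

text \<open>
  The equality case: all neighbours of \<open>u\<^sub>1\<close> would attain the maximum and the branch would be a bare
  path behind \<open>u\<^sub>1\<close>. There the values strictly increase, as \<open>2 \<le> l\<close>.
\<close>

lemma cut_strict: "xB u\<^sub>1 < real m * M / l"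
proof (rule ccontr)
  assume "\<not> ?thesis"
  hence ge: "real m * M / l \<le> xB u\<^sub>1" by simp
  have lpos: "0 < l" using l1 by simp
  have mM: "0 < real m * M / l" using M_pos lpos by (simp add: m_def)
  have neg: "x u\<^sub>1 < 0" using ge mM by (auto simp: pos_part_def split: if_splits)
  have big: "real m * M \<le> l * xB u\<^sub>1" using ge lpos by (simp add: field_simps)
  have "real m * M \<le> l * M"
    using big xB_le[OF u1(1)] lpos by (meson mult_left_mono less_imp_le order_trans)
  hence lm: "real m \<le> l" using M_pos by simp
  \<comment> \<open>By its definition \<open>m\<close> is at least 2.\<close>
  hence l2: "2 \<le> l" by (simp add: m_def)
  have N1: "real m * M \<le> N xB u\<^sub>1" using big Lam_eq[OF u1(4) neg] by simp
  let ?K = "{v p, v (p - 2)} \<union> (Lam - v ` {..d})"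
  have finK: "finite ?K" using finLam by simp
  have "card ?K \<le> m"
  proof -
    have "card ?K \<le> card {v p, v (p - 2)} + card (Lam - v ` {..d})" by (rule card_Un_le)
    also have "card {v p, v (p - 2)} \<le> 2" by (simp add: card_insert_if)
    finally show ?thesis by (simp add: m_def)
  qed
  \<comment> \<open>The sum at \<open>u\<^sub>1\<close> reaches \<open>m * M\<close> only if each of
    the at most \<open>m\<close> candidates is a neighbour with value \<open>M\<close>.\<close>
  have all: "(u\<^sub>1, u) \<in> E \<and> xB u = M" if u: "u \<in> ?K" for u
  proof (rule ccontr)
    assume no: "\<not> ?thesis"
    have "N xB u\<^sub>1 = (\<Sum>w\<in>?K. if (u\<^sub>1, w) \<in> E then xB w else 0)"
      unfolding nbr_sum_def by (rule sum.mono_neutral_cong_left) (use finK nbrs_u1 in auto)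
    also have "\<dots> < (\<Sum>w\<in>?K. M)"
    proof (rule sum_strict_mono_ex1[OF finK])
      show "\<forall>w\<in>?K. (if (u\<^sub>1, w) \<in> E then xB w else 0) \<le> M"
        using xB_le E_in M_pos by auto
      have "(if (u\<^sub>1, u) \<in> E then xB u else 0) < M"
        using no xB_le[of u] E_in(2)[of "u\<^sub>1" u] M_pos by (auto simp: less_le)
      thus "\<exists>w\<in>?K. (if (u\<^sub>1, w) \<in> E then xB w else 0) < M" using u by blast
    qed
    also have "\<dots> \<le> real m * M" using \<open>card ?K \<le> m\<close> M_pos by (simp add: mult_right_mono)
    finally show False using N1 by simp
  qed
  \<comment> \<open>An off-path neighbour of \<open>v t\<close> would lie in the branch and be a
    neighbour of \<open>u\<^sub>1\<close> as well, hence have two parents.\<close>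
  have nb: "E `` {v t} \<subseteq> {v (Suc t)} \<union> (if t = 0 then {} else {v (t - 1)})" if t: "t + 2 \<le> p" for t
  proof
    fix u assume "u \<in> E `` {v t}"
    hence e: "(v t, u) \<in> E" by simp
    have td: "t \<le> d" using t p_bounds by simp
    show "u \<in> {v (Suc t)} \<union> (if t = 0 then {} else {v (t - 1)})"
    proof (cases "u \<in> v ` {..d}")
      case True
      then obtain s where s: "s \<le> d" "u = v s" by auto
      hence "s = Suc t \<or> t = Suc s" using path_nbr[of t s] e td by simp
      thus ?thesis using s by auto
    next
      case False
      have vt: "v t \<in> Lam" "v t \<noteq> u\<^sub>1" using Lam_path t p_bounds by auto
      have "u \<in> Lam" using Lam_boundary(1)[OF e vt(1)] vt(2) by blast
      hence "(u\<^sub>1, u) \<in> E" using all False by blast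
      hence "u\<^sub>1 = pB u"
      proof (rule rooted_edgeE[OF rootB])
        assume "u = pB u\<^sub>1"
        thus ?thesis using u1(3) False pA'(1) by simp
      qed simp
      moreover have "v t = pB u"
      proof (rule rooted_edgeE[OF rootB e])
        assume "u = pB (v t)"
        hence "u = v (Suc t)" using pB'(2)[of t] t pq by simp
        thus ?thesis using False t p_bounds by simp
      qed simp
      ultimately show ?thesis using vt(2) by simp
    qed
  qed
  have step: "l * xB (v t) \<le> xB (v (Suc t)) + (if t = 0 then 0 else xB (v (t - 1)))"
    if t: "t + 2 \<le> p" for t
  proof (cases "x (v t) < 0")
    case True
    have "l * xB (v t) = N xB (v t)" using Lam_eq[OF Lam_path True] t by simp
    also have "\<dots> \<le> (\<Sum>u\<in>{v (Suc t)} \<union> (if t = 0 then {} else {v (t - 1)}). xB u)"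
      unfolding nbr_sum_def by (rule sum_mono2[OF _ nb[OF t]]) auto
    also have "\<dots> = xB (v (Suc t)) + (if t = 0 then 0 else xB (v (t - 1)))"
      using t p_bounds by (simp add: add.commute)
    finally show ?thesis .
  qed (use lpos in simp)
  have inc: "0 < xB (v t) \<Longrightarrow> t = 0 \<or> xB (v (t - 1)) < xB (v t)" if "t + 2 \<le> p" for t
    using that
  proof (induct t)
    case (Suc t)
    show ?case
    proof (cases "0 < xB (v t)")
      case True
      have "2 * xB (v t) \<le> l * xB (v t)" by (rule mult_right_mono[OF l2]) simp
      also have "\<dots> \<le> xB (v (Suc t)) + (if t = 0 then 0 else xB (v (t - 1)))" by (rule step) (use Suc in simp)
      also have "(if t = 0 then 0 else xB (v (t - 1))) < xB (v t)" using Suc True by auto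
      finally show ?thesis by simp
    next
      case False
      hence "xB (v t) = 0" using pos_part_simps(1)[of "\<lambda>u. - x u" "v t"] by linarith
      thus ?thesis using Suc by simp
    qed
  qed simp
  define t where "t = p - 2"
  have t: "t + 2 \<le> p" using p_bounds by (simp add: t_def)
  have xt: "xB (v t) = M" using all[of "v (p - 2)"] by (simp add: t_def)
  \<comment> \<open>The equation at \<open>v (p - 2)\<close>, whose value is \<open>M\<close>: one
    neighbour value is at most \<open>M\<close>, the other is smaller.\<close>
  have "2 * M \<le> l * M" using l2 M_pos by simp
  also have "\<dots> \<le> xB (v (Suc t)) + (if t = 0 then 0 else xB (v (t - 1)))" using step[OF t] xt by simp
  also have "xB (v (Suc t)) \<le> M" by (rule xB_le[OF v_in]) (use t p_bounds in simp)
  also have "(if t = 0 then 0 else xB (v (t - 1))) < M" using inc[OF t] xt M_pos by auto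
  finally show False by simp
qed

end

text \<open>
  A component \<open>A\<close> off the path is replaced by a star around \<open>wA\<close> whose edge \<open>f wA\<close> takes over the
  first two positions of the spine. This frees \<open>v 0\<close> and \<open>v 1\<close>, and these, hung at \<open>wB\<close> together with
  the other vertices of the branch behind \<open>u\<^sub>1\<close>, more than pay for cutting that branch off.
\<close>

lemma (in missing_A) contradiction: False
proof -
  interpret sw: extremal_tree T V E d l "\<lambda>u. - x u" wB pB rB wA pA rA v by (rule swapped)
  have lpos: "0 < l" using l1 by simp
  obtain f where f: "(wA, f) \<in> E" "0 < x f"
  proof -
    have "0 < l * x wA" using posA lpos by simp
    hence pos: "0 < N xA wA" using N_split[OF wA_V] posA nbr_sum_nonneg[of xB wA] by simp
    have "\<exists>f\<in>E `` {wA}. xA f \<noteq> 0"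
    proof (rule ccontr)
      assume "\<not> ?thesis"
      hence "N xA wA = 0" unfolding nbr_sum_def by (intro sum.neutral) blast
      thus False using pos by simp
    qed
    then obtain f where "(wA, f) \<in> E" "xA f \<noteq> 0" by blast
    thus thesis using that by simp
  qed
  have fV: "f \<in> V" using E_in f by blast
  have f_off: "f \<noteq> v t" "wA \<noteq> v t" if "t \<le> d" for t using path_nonpos[OF that] f(2) posA by auto
  have ne: "f \<noteq> wA" "f \<noteq> wB" "wA \<noteq> wB" using f irr posA negB by (auto simp: irrefl_def)
  \<comment> \<open>As before, a hub off the path replaces the vertex one step outside its
    foot.\<close>
  define j where "j = (if wB = v q then q else Suc q)"
  define s where "s t = (if t = 0 then f else if t = 1 then wA else if t = j then wB else v t)" for t
  define h where "h e = (if 0 < x e then 1 else j)" for e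
  have jd: "2 \<le> j" "q \<le> j" "j < d" "j \<le> Suc q"
    using p_bounds pq pB'(1,4,5) off_path(1)[OF rootB prB] by (auto simp: j_def)
  have wB_off: "wB \<noteq> v t" if "t \<le> d" "t \<noteq> j" for t
  proof (cases "wB = v q")
    case True thus ?thesis using that pB'(1) by (simp add: j_def)
  next
    case False thus ?thesis using that(1) off_path(2)[OF rootB prB False] by blast
  qed
  have s0: "s 0 = f" "s 1 = wA" "s (Suc 0) = wA" "s j = wB" using jd by (auto simp: s_def)
  have sv: "s t = v t" if "2 \<le> t" "t \<noteq> j" for t using that by (simp add: s_def)
  have sp: "spine V d s h"
  proof
    show "finite V" by (rule fin)
    show "2 \<le> d" using d3 by simp
    show "inj_on s {..d}"
    proof (rule inj_onI)
      fix t u assume tu: "t \<in> {..d}" "u \<in> {..d}" "s t = s u"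
      thus "t = u" using f_off[of t] f_off[of u] wB_off[of t] wB_off[of u] ne
        by (auto simp: s_def split: if_splits)
    qed
    show "s ` {..d} \<subseteq> V" using wA_V wB_V v_in fV by (auto simp: s_def)
    show "1 \<le> h e \<and> h e < d" for e using jd by (simp add: h_def)
  qed
  interpret S: spine V d s h by (rule sp)
  let ?E = "parcs S.G"
  interpret S': conn_graph S.G V ?E by (rule S.conn_graph_G)
  have S_cases: "e = f \<or> e = wA \<or> e = wB \<or> (\<exists>t. 2 \<le> t \<and> t \<le> d \<and> t \<noteq> j \<and> e = v t)" if "e \<in> S.S" for e
  proof -
    obtain t where t: "t \<le> d" "e = s t" using \<open>e \<in> S.S\<close> by auto
    show ?thesis
    proof (cases "t = 0 \<or> t = 1 \<or> t = j")
      case True thus ?thesis using t(2) s0 by blast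
    next
      case False
      hence "2 \<le> t" "t \<noteq> j" by auto
      thus ?thesis using t sv[of t] by blast
    qed
  qed
  have rA': "rooted V ?E wA (S.parent 1) (S.rank 1)" using S.spine_rooted[of 1] s0 d3 by simp
  have rB': "rooted V ?E wB (S.parent j) (S.rank j)" using S.spine_rooted[of j] s0 jd by simp
  have parA: "S.parent 1 e = wA" if e: "e \<in> V" "e \<noteq> wA" "0 < x e" for e
  proof (cases "e \<in> S.S")
    case False thus ?thesis using e s0 by (simp add: S.parent_leaf h_def)
  next
    case True
    from S_cases[OF this] have "e = s 0"
    proof (elim disjE exE conjE)
      fix t assume "t \<le> d" "e = v t"
      thus ?thesis using path_nonpos[of t] e(3) by simp
    qed (use e negB s0 in auto)
    thus ?thesis using S.parent_spine[of 0 1] s0 by simp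
  qed
  \<comment> \<open>The branch is exempt here, since its contribution is estimated as a
    whole.\<close>
  have parB: "S.parent j e = pB e \<or> S.parent j e = wB" if e: "e \<in> V" "e \<noteq> wB" "x e < 0" "e \<notin> Lam" for e
  proof (cases "e \<in> S.S")
    case False thus ?thesis using e s0 by (simp add: S.parent_leaf h_def)
  next
    case True
    from S_cases[OF this] obtain t where t: "2 \<le> t" "t \<le> d" "t \<noteq> j" "e = v t"
    proof (elim disjE exE conjE)
      assume "e = f" thus thesis using e(3) f(2) by simp
    next
      assume "e = wA" thus thesis using e(3) posA by simp
    next
      assume "e = wB" thus thesis using e(2) by simp
    qed (rule that)
    have et: "e = s t" using t sv by simp
    show ?thesis
    proof (cases "t < j")
      case True
      hence "S.parent j e = s (Suc t)" unfolding et S.parent_spine[OF t(2)] by simp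
      moreover have "pB e = v (Suc t) \<or> Suc t = j" using pB'(2)[of t] True jd t by (cases "t < q") auto
      moreover have "Suc t \<noteq> j \<Longrightarrow> s (Suc t) = v (Suc t)" using sv[of "Suc t"] t by simp
      ultimately show ?thesis using s0(4) by (cases "Suc t = j") simp_all
    next
      case False
      hence t1: "j < t" using t(3) by simp
      have par: "S.parent j e = s (t - 1)" unfolding et S.parent_spine[OF t(2)] using t1 by simp
      have "Suc (t - 1) = t" using t by simp
      hence "pB e = v (t - 1)" using pB'(3)[of "t - 1"] t1 t jd by simp
      moreover have "t - 1 \<noteq> j \<Longrightarrow> s (t - 1) = v (t - 1)" using sv[of "t - 1"] t1 jd by simp
      ultimately show ?thesis using par s0(4) by (cases "t - 1 = j") simp_all
    qed
  qed
  \<comment> \<open>Off-spine vertices of the branch will hang at \<open>wB\<close>, where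
    \<open>M / l\<close> is the value demanded by the equation at a pendant vertex. Branch vertices
    kept on the spine get 0, which removes them from the form.\<close>
  define yB where "yB e = (if e \<in> Lam then if e \<in> S.S then 0 else M / l else xB e)" for e
  have Ml: "0 < M / l" using M_pos lpos by simp
  have yB0: "0 \<le> yB e" for e using Ml by (simp add: yB_def)
  have yB_wB: "yB wB = M" using Lam_not negB by (simp add: yB_def M_def)
  have yB_pos: "xA e = 0" if "yB e \<noteq> 0" for e
    using that Lam_nonpos[of e] by (auto simp: yB_def split: if_splits)
  have disj: "xA e = 0 \<or> yB e = 0" for e using yB_pos by blast
  have QA: "cross \<le> (\<Sum>u\<in>V. xA u * (S'.N xA u - l * xA u))"
    by (rule reroot_form_ge[OF rA']) (use parA in auto)
  define K where "K = Lam - S.S"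
  have finK: "finite K" using finLam by (simp add: K_def)
  \<comment> \<open>\<open>f\<close> and \<open>wA\<close> occupy the first two positions of the new
    spine, so these two path vertices become free.\<close>
  have v01: "v 0 \<in> K" "v 1 \<in> K"
  proof -
    have "v t \<notin> S.S" if "t < 2" for t
    proof
      assume "v t \<in> S.S"
      from S_cases[OF this] show False
        using f_off[of t] wB_off[of t] that jd d3 by auto
    qed
    thus "v 0 \<in> K" "v 1 \<in> K" using Lam_path p_bounds by (auto simp: K_def)
  qed
  have cardK: "m \<le> card K"
  proof -
    have sub: "insert (v 0) (insert (v 1) (Lam - v ` {..d})) \<subseteq> K"
    proof -
      have "e \<in> K" if e: "e \<in> Lam" "e \<notin> v ` {..d}" for e
      proof -
        have "e \<notin> S.S"
        proof
          assume "e \<in> S.S"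
          from S_cases[OF this] show False
            using e Lam_wA Lam_not Lam_nonpos[of e] f(2) by auto
        qed
        thus ?thesis using e by (simp add: K_def)
      qed
      thus ?thesis using v01 by auto
    qed
    have "card (insert (v 0) (insert (v 1) (Lam - v ` {..d}))) = m"
      using finLam d3 by (simp add: m_def)
    thus ?thesis using card_mono[OF finK sub] by simp
  qed
  have QB: "cross \<le> (\<Sum>u\<in>V. yB u * (S'.N yB u - l * yB u))"
  proof -
    let ?t = "\<lambda>e. 2 * xB e * xB (pB e) - l * (xB e)\<^sup>2"
    let ?t' = "\<lambda>e. 2 * yB e * yB (S.parent j e) - l * (yB e)\<^sup>2"
    have expand: "(\<Sum>u\<in>V. y u * (nbr_sum E' y u - l * y u)) =
        (\<Sum>e\<in>V - {wB}. 2 * y e * y (par e) - l * (y e)\<^sup>2) - l * (y wB)\<^sup>2"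
      if r: "rooted V E' wB par rk" for E' par rk y
    proof -
      have "(\<Sum>u\<in>V. y u * (nbr_sum E' y u - l * y u)) = (\<Sum>u\<in>V. y u * nbr_sum E' y u) - (\<Sum>u\<in>V. l * (y u)\<^sup>2)"
        by (simp add: algebra_simps sum_subtractf power2_eq_square)
      also have "(\<Sum>u\<in>V. l * (y u)\<^sup>2) = l * (y wB)\<^sup>2 + (\<Sum>u\<in>V - {wB}. l * (y u)\<^sup>2)"
        by (rule sum.remove[OF fin wB_V])
      also have "(\<Sum>u\<in>V. y u * nbr_sum E' y u) = (\<Sum>e\<in>V - {wB}. 2 * y e * y (par e))"
        unfolding rooted_quadratic_form[OF r] by (intro sum.cong refl) simp
      finally show ?thesis by (simp add: sum_subtractf)
    qed
    have sub: "Lam \<subseteq> V - {wB}" using Lam_V Lam_not by auto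
    have split: "(\<Sum>e\<in>V - {wB}. g e) = (\<Sum>e\<in>V - {wB} - Lam. g e) + (\<Sum>e\<in>Lam. g e)" for g :: "'a \<Rightarrow> real"
      by (rule sum.subset_diff[OF sub]) (use fin in simp)
    have rest: "(\<Sum>e\<in>V - {wB} - Lam. ?t e) \<le> (\<Sum>e\<in>V - {wB} - Lam. ?t' e)"
    proof (rule sum_mono)
      fix e assume e: "e \<in> V - {wB} - Lam"
      hence ye: "yB e = xB e" by (simp add: yB_def)
      show "?t e \<le> ?t' e"
      proof (cases "x e < 0")
        case True
        have "pB e \<notin> Lam" using Lam_child[of e] e by blast
        hence pe: "yB (pB e) = xB (pB e)" by (simp add: yB_def)
        have "xB (pB e) \<le> M" using xB_parent_le[of e] e True by simp
        hence "xB (pB e) \<le> yB (S.parent j e)" using parB[of e] e True pe yB_wB by auto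
        hence "xB e * xB (pB e) \<le> xB e * yB (S.parent j e)" by (intro mult_left_mono) simp_all
        thus ?thesis using ye by simp
      qed (use ye in simp)
    qed
    have "(\<Sum>e\<in>Lam. ?t' e) = (\<Sum>e\<in>K. M\<^sup>2 / l)"
    proof -
      have "(\<Sum>e\<in>Lam. ?t' e) = (\<Sum>e\<in>K. ?t' e)"
        by (rule sum.mono_neutral_right[OF finLam]) (auto simp: K_def yB_def)
      also have "\<dots> = (\<Sum>e\<in>K. M\<^sup>2 / l)"
      proof (rule sum.cong[OF refl])
        fix e assume e: "e \<in> K"
        have par: "S.parent j e = wB" using e Lam_nonpos[of e] s0 by (auto simp: K_def S.parent_leaf h_def)
        have ye: "yB e = M / l" using e by (simp add: K_def yB_def)
        show "?t' e = M\<^sup>2 / l" unfolding par ye yB_wB using lpos by (simp add: power2_eq_square)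
      qed
      finally show ?thesis .
    qed
    also have "\<dots> = real (card K) * M\<^sup>2 / l" by simp
    also have "\<dots> \<ge> real m * M\<^sup>2 / l" using cardK lpos by (simp add: divide_right_mono mult_right_mono)
    finally have "(\<Sum>e\<in>Lam. ?t e) \<le> (\<Sum>e\<in>Lam. ?t' e)" using Lam_form cut_le by linarith
    hence "(\<Sum>e\<in>V - {wB}. ?t e) \<le> (\<Sum>e\<in>V - {wB}. ?t' e)" using rest split[of ?t] split[of ?t'] by linarith
    moreover have "(xB wB)\<^sup>2 = (yB wB)\<^sup>2" using yB_wB negB by (simp add: M_def)
    ultimately have "(\<Sum>u\<in>V. xB u * (N xB u - l * xB u)) \<le> (\<Sum>u\<in>V. yB u * (S'.N yB u - l * yB u))"
      unfolding expand[OF rootB] expand[OF rB'] by simp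
    moreover have "(\<Sum>u\<in>V. xB u * (N xB u - l * xB u)) = cross"
    proof -
      have "pos_part (\<lambda>u. - (- x u)) = xA" by (simp add: fun_eq_iff pos_part_def)
      hence "sw.cross = cross" unfolding cross_def sw.cross_def by (simp add: nbr_sum_sym[of xB xA])
      thus ?thesis using sw.form_A by simp
    qed
    ultimately show ?thesis by simp
  qed
  \<comment> \<open>The edge from \<open>wA\<close> to position 2 is the only candidate for a new
    edge between the supports. It carries weight only if \<open>p = 2\<close>, and then the depth
    bound puts \<open>wA\<close> next to \<open>v p\<close> in \<open>T\<close> already.\<close>
  have s2: "s 2 = v p \<and> (wA, v p) \<in> E" if "yB (s 2) \<noteq> 0"
  proof -
    have p2: "p = 2"
    proof (rule ccontr)
      assume "p \<noteq> 2"
      hence p3: "2 < p" using p_bounds by simp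
      hence "s 2 = v 2" using sv[of 2] pq jd by simp
      moreover have "v 2 \<in> Lam" using Lam_path p3 by simp
      moreover have "s 2 \<in> S.S" using S.s_in(2)[of 2] d3 by simp
      ultimately show False using that by (simp add: yB_def)
    qed
    have "s 2 = v 2"
    proof (cases "j = 2")
      case True
      hence "q = 2" using pq p2 jd by simp
      thus ?thesis using True s0 by (auto simp: j_def split: if_splits)
    qed (use sv in simp)
    moreover have "(wA, v p) \<in> E"
    proof -
      have "rA (v p) = 1" using pA'(5) p2 pA'(1) rA_pos by simp
      note st = rootedD(4,5,7)[OF rootA v_in[OF pA'(1)] f_off(2)[OF pA'(1), symmetric]]
      have "rA (pA (v p)) = 0" using st(2) \<open>rA (v p) = 1\<close> by simp
      hence "pA (v p) = wA" by (rule rooted_rk_zero[OF rootA st(1)])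
      thus ?thesis using st(3) by simp
    qed
    ultimately show ?thesis using p2 by simp
  qed
  have claim: "a = wA \<and> b = v p \<and> (wA, v p) \<in> E" if ab: "(a, b) \<in> ?E" "0 < x a" "yB b \<noteq> 0" for a b
  proof -
    have nb: "\<not> 0 < x b" using yB_pos[OF ab(3)] by auto
    have neg: "x (s t) \<le> 0" if "2 \<le> t" "t \<le> d" for t
      using that path_nonpos[of t] negB by (auto simp: s_def)
    consider t where "t < d" "a = s t" "b = s (Suc t)" | t where "t < d" "a = s (Suc t)" "b = s t"
      | "a \<in> V - S.S" "b = s (h a)" | "b \<in> V - S.S" "a = s (h b)"
      using ab(1) unfolding S.arcs_eq by blast
    thus ?thesis
    proof cases
      case 1
      have "\<not> 2 \<le> t" using neg[of t] 1 ab(2) by auto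
      moreover have "t \<noteq> 0"
      proof
        assume "t = 0"
        hence "b = wA" using 1(3) s0(3) by simp
        thus False using nb posA by simp
      qed
      ultimately have "t = 1" by simp
      hence "a = wA" "b = s 2" using 1 s0 by (auto simp: numeral_2_eq_2)
      thus ?thesis using s2 ab(3) by simp
    next
      case 2
      have "\<not> 2 \<le> Suc t" using neg[of "Suc t"] 2 ab(2) by auto
      hence "t = 0" by simp
      hence "b = f" using 2(3) s0(1) by simp
      thus ?thesis using nb f by simp
    next
      case 3 thus ?thesis using nb ab(2) s0 posA by (simp add: h_def)
    next
      case 4 thus ?thesis using nb ab(2) s0 negB by (simp add: h_def)
    qed
  qed
  have Vp: "yB (v p) = xB (v p)" using Lam_not by (simp add: yB_def)
  have le1: "S'.N yB a \<le> N xB a" if "0 < x a" for a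
  proof (rule nbr_sum_mono_rel[OF S'.fin_nbrs fin_nbrs])
    fix b assume "(a, b) \<in> ?E" "yB b \<noteq> 0"
    from claim[OF this(1) that this(2)] show "(a, b) \<in> E \<and> yB b \<le> xB b" using Vp by auto
  qed simp
  have le2: "S'.N xA wB \<le> N xA wB"
  proof (rule nbr_sum_mono_rel[OF S'.fin_nbrs fin_nbrs])
    fix b assume b: "(wB, b) \<in> ?E" "xA b \<noteq> 0"
    have "0 < x b" using b(2) by (simp add: pos_part_def split: if_splits)
    hence "b = wA \<and> wB = v p \<and> (wA, v p) \<in> E"
      using claim[OF S'.E_sym[OF b(1)]] yB_wB M_pos by simp
    thus "(wB, b) \<in> E \<and> xA b \<le> xA b" using E_sym by auto
  qed simp
  define c where "c = (\<Sum>u\<in>V. xA u * S'.N yB u)"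
  have c_le: "c \<le> cross"
    unfolding c_def cross_def
  proof (rule sum_mono)
    fix u
    show "xA u * S'.N yB u \<le> xA u * N xB u" using le1[of u] by (cases "0 < x u") auto
  qed
  have c_sym: "c = (\<Sum>u\<in>V. yB u * S'.N xA u)" unfolding c_def by (rule S'.nbr_sum_sym)
  obtain \<beta> where \<beta>: "0 < \<beta>" "c = 0 \<or> \<beta> = 1"
    and ev: "\<And>u. u \<in> V \<Longrightarrow> S'.N xA u - \<beta> * S'.N yB u = l * (xA u - \<beta> * yB u)"
  proof (rule S'.disjoint_pair_eigenvector[of xA yB wA wB c l])
    show "lambda2 S.G \<le> l" by (rule maximal[OF S.in_trees_of_diameter])
    show "c \<le> (\<Sum>v\<in>V. xA v * (S'.N xA v - l * xA v))" "c \<le> (\<Sum>v\<in>V. yB v * (S'.N yB v - l * yB v))"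
      using c_le QA QB by auto
  qed (use wA_V wB_V posA M_pos yB_wB yB0 disj c_def that in auto)
  have xwB: "xA wB = 0" using negB by simp
  \<comment> \<open>As in \<open>rigid\<close>: for \<open>c = 0\<close> the mixed sum at
    \<open>wB\<close> vanishes, otherwise \<open>\<beta> = 1\<close> and it did not grow.\<close>
  have up: "S'.N yB wB \<le> N xB wB"
  proof -
    have T_eq: "N xB wB = l * M + N xA wB" using xB_eq[OF wB_V negB] negB by (simp add: M_def)
    show ?thesis
    proof (cases "c = 0")
      case True
      have "yB wB * S'.N xA wB = 0"
        using True[unfolded c_sym] wB_V fin
        by (subst (asm) sum_nonneg_eq_0_iff) (auto intro!: mult_nonneg_nonneg S'.nbr_sum_nonneg yB0)
      hence "S'.N xA wB = 0" using yB_wB M_pos by simp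
      hence "\<beta> * S'.N yB wB = \<beta> * (l * M)" using ev[OF wB_V] xwB yB_wB by (simp add: algebra_simps)
      hence "S'.N yB wB = l * M" by (rule mult_left_cancel[THEN iffD1, rotated]) (use \<beta>(1) in simp)
      thus ?thesis using T_eq nbr_sum_nonneg[of xA wB] by simp
    next
      case False
      hence "S'.N yB wB = l * M + S'.N xA wB" using ev[OF wB_V] xwB yB_wB \<beta>(2) by simp
      thus ?thesis using T_eq le2 by simp
    qed
  qed
  \<comment> \<open>The neighbours of \<open>wB\<close> that keep their contribution. Of the branch
    at most \<open>u\<^sub>1\<close> was a neighbour in \<open>T\<close>, while the new tree gains
    at least \<open>m\<close> neighbours of value \<open>M / l\<close>; with \<open>up\<close> this
    contradicts \<open>cut_strict\<close>.\<close>
  let ?R = "{u \<in> E `` {wB}. u \<notin> Lam \<and> x u < 0}"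
  have finR: "finite ?R" by (rule finite_subset[OF _ fin_nbrs[of wB]]) auto
  have low: "(\<Sum>u\<in>?R. xB u) + real m * M / l \<le> S'.N yB wB"
  proof -
    have R: "(wB, u) \<in> ?E \<and> yB u = xB u" if "u \<in> ?R" for u
    proof -
      have u: "(wB, u) \<in> E" "u \<notin> Lam" "x u < 0" using that by auto
      have "u \<in> V" "u \<noteq> wB" "pB u = wB" by (rule rooted_edgeE[OF rootB u(1)]; simp)+
      hence "S.parent j u = wB" using parB[of u] u by auto
      thus ?thesis using rootedD(7)[OF rB' \<open>u \<in> V\<close> \<open>u \<noteq> wB\<close>] u(2) by (simp add: yB_def)
    qed
    have K: "(wB, u) \<in> ?E \<and> yB u = M / l" if "u \<in> K" for u
    proof -
      have u: "u \<in> V" "u \<notin> S.S" "u \<in> Lam" using that Lam_V by (auto simp: K_def)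
      have "h u = j" using Lam_nonpos[OF u(3)] by (simp add: h_def)
      hence "(wB, u) \<in> ?E" using u s0 unfolding S.arcs_eq by force
      thus ?thesis using u by (simp add: yB_def)
    qed
    have "real m * M / l \<le> real (card K) * (M / l)" using cardK Ml by (simp add: mult_right_mono flip: times_divide_eq_right)
    also have "\<dots> = (\<Sum>u\<in>K. yB u)" using K by simp
    finally have "(\<Sum>u\<in>?R. xB u) + real m * M / l \<le> (\<Sum>u\<in>?R. yB u) + (\<Sum>u\<in>K. yB u)" using R by simp
    also have "\<dots> = (\<Sum>u\<in>?R \<union> K. yB u)"
      by (rule sum.union_disjoint[symmetric]) (use finR finK in \<open>auto simp: K_def\<close>)
    also have "\<dots> \<le> S'.N yB wB"
      unfolding nbr_sum_def by (rule sum_mono2[OF S'.fin_nbrs]) (use R K yB0 in auto)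
    finally show ?thesis .
  qed
  have "N xB wB \<le> (\<Sum>u\<in>?R. xB u) + xB u\<^sub>1"
  proof -
    have "N xB wB = (\<Sum>u\<in>{u \<in> E `` {wB}. x u < 0}. xB u)"
      unfolding nbr_sum_def by (rule sum.mono_neutral_right) (use fin_nbrs[of wB] in auto)
    also have "\<dots> \<le> (\<Sum>u\<in>insert u\<^sub>1 ?R. xB u)"
    proof (rule sum_mono2)
      show "{u \<in> E `` {wB}. x u < 0} \<subseteq> insert u\<^sub>1 ?R"
      proof
        fix u assume u: "u \<in> {u \<in> E `` {wB}. x u < 0}"
        hence "(u, wB) \<in> E" using E_sym by blast
        hence "u \<in> Lam \<Longrightarrow> u = u\<^sub>1" using Lam_boundary(1)[of u wB] Lam_not(2) by blast
        thus "u \<in> insert u\<^sub>1 ?R" using u by auto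
      qed
    qed (use finR in auto)
    also have "\<dots> \<le> (\<Sum>u\<in>?R. xB u) + xB u\<^sub>1" using finR u1(4) by (simp add: sum.insert)
    finally show ?thesis .
  qed
  thus False using up low cut_strict by linarith
qed

context extremal_tree
begin

lemma path_meets_A:
  assumes prA: "projects pA rA p" and prB: "projects pB rB q"
  shows "0 < x (v p)"
proof (rule ccontr)
  assume no: "\<not> 0 < x (v p)"
  show False
  proof (cases "p \<le> q")
    case True
    have "missing_A T V E d l x wA pA rA wB pB rB v p q"
      by (intro missing_A.intro missing_A_axioms.intro extremal_tree_axioms prA prB True) (use no in simp)
    thus False by (rule missing_A.contradiction)
  next
    case False
    have "d - p \<le> d - q" using False by simp
    moreover have "\<not> 0 < x (v (d - (d - p)))" using no projectsD(1)[OF prA] by simp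
    ultimately have "missing_A T V E d l x wA pA rA wB pB rB (\<lambda>t. v (d - t)) (d - p) (d - q)"
      by (intro missing_A.intro missing_A_axioms.intro extremal_tree_rev[OF extremal_tree_axioms] projects_rev prA prB) simp_all
    thus False by (rule missing_A.contradiction)
  qed
qed

end

subsection \<open>Balancing the two hubs\<close>

text \<open>For \<open>l < 2\<close> the comparison of \<open>X (i - 1)\<close> with
  \<open>X i\<close> suffices. For \<open>2 \<le> l\<close> the recurrence makes the values increase
  from the end of the path, so the first summand of \<open>l * X (i - 1) = X (i - 2) + X i\<close>
  is below \<open>X i\<close>.\<close>

lemma recurrence_tail:
  fixes X :: "nat \<Rightarrow> real"
  assumes l: "0 < l" and X0: "l * X 0 = X 1"
    and rec: "\<And>t. 1 \<le> t \<Longrightarrow> t < i \<Longrightarrow> l * X t = X (t - 1) + X (Suc t)"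
    and i: "1 \<le> i" and pos: "0 < X i" and le: "2 \<le> i \<Longrightarrow> X (i - 1) \<le> X i"
  shows "l * X (i - 1) < 2 * X i"
proof (cases "i = 1")
  case True thus ?thesis using X0 pos by simp
next
  case False
  hence i2: "2 \<le> i" using i by simp
  show ?thesis
  proof (cases "l < 2")
    case True
    have "l * X (i - 1) \<le> l * X i" using le[OF i2] l by simp
    also have "\<dots> < 2 * X i" using True pos by simp
    finally show ?thesis .
  next
    case False
    hence l2: "2 \<le> l" by simp
    \<comment> \<open>Both signs of \<open>X 0\<close> are followed; the nonpositive one will
      contradict \<open>0 < X i\<close>.\<close>
    have mono: "(0 < X 0 \<longrightarrow> X t < X (Suc t) \<and> 0 < X t) \<and> (X 0 \<le> 0 \<longrightarrow> X (Suc t) \<le> X t \<and> X t \<le> 0)"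
      if "t < i" for t
      using that
    proof (induct t)
      case 0
      have "0 < X 0 \<Longrightarrow> 2 * X 0 \<le> l * X 0" "X 0 \<le> 0 \<Longrightarrow> l * X 0 \<le> 2 * X 0"
        using l2 by (auto intro: mult_right_mono mult_right_mono_neg)
      thus ?case using X0 by auto
    next
      case (Suc t)
      have r: "l * X (Suc t) = X t + X (Suc (Suc t))" using rec[of "Suc t"] Suc(2) by simp
      have "0 < X (Suc t) \<Longrightarrow> 2 * X (Suc t) \<le> l * X (Suc t)" "X (Suc t) \<le> 0 \<Longrightarrow> l * X (Suc t) \<le> 2 * X (Suc t)"
        using l2 by (auto intro: mult_right_mono mult_right_mono_neg)
      thus ?case using Suc r by auto
    qed
    have "0 < X 0"
    proof (rule ccontr)
      assume "\<not> 0 < X 0"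
      thus False using mono[of "i - 1"] i2 pos by simp
    qed
    hence "X (i - 2) < X (i - 1)" "X (i - 1) < X i"
      using mono[of "i - 2"] mono[of "i - 1"] i2 by (auto simp: Suc_diff_le numeral_2_eq_2 Suc_diff_Suc)
    moreover have "l * X (i - 1) = X (i - 2) + X i"
      using rec[of "i - 1"] i2 by (simp add: numeral_2_eq_2 Suc_diff_Suc)
    ultimately show ?thesis by simp
  qed
qed

text \<open>
  Between the two hubs: subtract from \<open>p\<close> its reflection, scaled so that the values at \<open>0\<close> agree. The
  difference \<open>D\<close> starts upwards and stays positive up to \<open>k\<close>, as it does not oscillate faster than the
  backward differences of \<open>p\<close>.
\<close>

lemma recurrence_between_hubs:
  fixes p :: "nat \<Rightarrow> real"
  assumes l: "0 < l" and k: "1 \<le> k"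
    and rec: "\<And>t. 1 \<le> t \<Longrightarrow> t < k \<Longrightarrow> l * p t = p (t - 1) + p (Suc t)"
    and p0: "0 < p 0" and pk: "p k < 0" and p1: "p 1 \<le> p 0"
    and sgn: "\<And>t. t < k \<Longrightarrow> 0 < p (Suc t) \<Longrightarrow> 0 < p t"
    and slope: "p (k - 1) / p k < p 1 / p 0"
    and sharp: "l < 2 \<Longrightarrow> p (k - 1) / p k < l - 1"
  shows "(p k)\<^sup>2 < (p 0)\<^sup>2"
proof -
  \<comment> \<open>The scaling gives \<open>D 0 = 0\<close>, and \<open>0 < D k\<close> becomes the
    claim after multiplication with \<open>p k < 0\<close>.\<close>
  define c where "c = p 0 / p k"
  define D where "D t = p t - p (k - t) * c" for t
  have D0: "D 0 = 0" using pk by (simp add: D_def c_def)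
  have D1: "0 < D 1"
  proof -
    have "D 1 = p 0 * (p 1 / p 0 - p (k - 1) / p k)" using p0 by (simp add: D_def c_def field_simps)
    thus ?thesis using slope p0 by simp
  qed
  have Drec: "l * D t = D (t - 1) + D (Suc t)" if t: "1 \<le> t" "t < k" for t
  proof -
    have "l * p (k - t) = p (k - Suc t) + p (k - (t - 1))"
    proof -
      have "Suc (k - t) = k - (t - 1)" "k - t - 1 = k - Suc t" using t by auto
      thus ?thesis using rec[of "k - t"] t by simp
    qed
    note r = this
    have "l * D t = l * p t - (l * p (k - t)) * c" by (simp add: D_def algebra_simps)
    also have "\<dots> = D (t - 1) + D (Suc t)" unfolding r rec[OF t] by (simp add: D_def algebra_simps)
    finally show ?thesis .
  qed
  have "0 < D t" if "1 \<le> t" "t \<le> k" for t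
  proof (cases "l < 2")
    case False
    hence l2: "2 \<le> l" by simp
    \<comment> \<open>For \<open>2 \<le> l\<close> a solution that starts at 0 and increases once
      keeps increasing.\<close>
    have "0 < D (Suc u) \<and> D u < D (Suc u)" if "Suc u \<le> k" for u
      using that
    proof (induct u)
      case 0 thus ?case using D0 D1 by simp
    next
      case (Suc u)
      have "l * D (Suc u) = D u + D (Suc (Suc u))" using Drec[of "Suc u"] Suc(2) by simp
      moreover have "2 * D (Suc u) \<le> l * D (Suc u)" using Suc l2 by (intro mult_right_mono) auto
      ultimately show ?case using Suc by simp
    qed
    from this[of "t - 1"] that show ?thesis by simp
  next
    case True
    \<comment> \<open>\<open>q\<close> continues \<open>p\<close> by one further step of the
      recurrence, so that the difference \<open>F k\<close> makes sense; \<open>sharp\<close> says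
      that it is positive.\<close>
    define q where "q t = (if t = Suc k then l * p k - p (k - 1) else p t)" for t
    define F where "F t = q t - q (Suc t)" for t
    have qrec: "l * q t = q (t - 1) + q (Suc t)" if "1 \<le> t" "t \<le> k" for t
      using rec[of t] that by (cases "t = k") (auto simp: q_def)
    have qp: "q t = p t" if "t \<le> k" for t using that by (simp add: q_def)
    have Fk: "0 < F k"
    proof -
      have "(l - 1) * p k < p (k - 1)" using sharp[OF True] pk by (simp add: field_simps)
      thus ?thesis by (simp add: F_def q_def algebra_simps)
    qed
    \<comment> \<open>\<open>F\<close> increases while \<open>p\<close> is positive and does not
      increase afterwards; it is nonnegative at 0 and positive at \<open>k\<close>. Since
      \<open>sgn\<close> allows only one change of sign of \<open>p\<close>, \<open>F\<close> is
      positive in between.\<close>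
    have F_step: "F t = F (t - 1) + (2 - l) * q t" if "1 \<le> t" "t \<le> k" for t
      using qrec[OF that] that by (simp add: F_def algebra_simps)
    have F_pos: "0 \<le> F t \<and> (1 \<le> t \<longrightarrow> 0 < F t)" if "t \<le> k" "0 < p t" for t
      using that
    proof (induct t)
      case 0 thus ?case using p1 k by (simp add: F_def q_def)
    next
      case (Suc t)
      have "0 < p t" using sgn[of t] Suc by simp
      hence "0 \<le> F t" using Suc by simp
      moreover have "0 < (2 - l) * q (Suc t)" using Suc True qp[of "Suc t"] by simp
      ultimately show ?case using F_step[of "Suc t"] Suc(2) by simp
    qed
    have F_neg: "F k \<le> F t" if "t \<le> k" "p t \<le> 0" for t
      using that
    proof (induct "k - t" arbitrary: t)
      case 0 thus ?case by simp
    next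
      case (Suc n)
      hence "\<not> 0 < p (Suc t)" using sgn[of t] by force
      hence le: "p (Suc t) \<le> 0" by simp
      have "F k \<le> F (Suc t)" using Suc(1)[of "Suc t"] Suc(2) le by simp
      moreover have "(2 - l) * q (Suc t) \<le> 0"
        using le True qp[of "Suc t"] Suc(2) by (simp add: mult_nonneg_nonpos)
      ultimately show ?case using F_step[of "Suc t"] Suc(2) by simp
    qed
    have F: "0 < F t" if "1 \<le> t" "t \<le> k" for t
      using F_pos[of t] F_neg[of t] Fk that by (cases "0 < p t") auto
    have F0: "0 \<le> F 0" using F_pos[of 0] p0 by simp
    have Frec: "l * F t = F (t - 1) + F (Suc t)" if "1 \<le> t" "t < k" for t
      using qrec[of t] qrec[of "Suc t"] that by (simp add: F_def algebra_simps)
    \<comment> \<open>\<open>D\<close> and \<open>F\<close> solve the same recurrence, so their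
      Casoratian is constant. Its nonnegative value carries positivity from \<open>F\<close> over to
      \<open>D\<close>, as in Sturm comparison.\<close>
    have cas: "D (Suc u) * F u - D u * F (Suc u) = D 1 * F 0" if "u < k" for u
      using that
    proof (induct u)
      case 0 thus ?case using D0 by simp
    next
      case (Suc u)
      have a: "l * D (Suc u) = D u + D (Suc (Suc u))" "l * F (Suc u) = F u + F (Suc (Suc u))"
        using Drec[of "Suc u"] Frec[of "Suc u"] Suc(2) by simp_all
      hence b: "D (Suc (Suc u)) = l * D (Suc u) - D u" "F (Suc (Suc u)) = l * F (Suc u) - F u" by simp_all
      have "D (Suc (Suc u)) * F (Suc u) - D (Suc u) * F (Suc (Suc u)) = D (Suc u) * F u - D u * F (Suc u)"
        unfolding b by (simp add: algebra_simps)
      thus ?case using Suc by simp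
    qed
    have "0 < D (Suc u)" if "Suc u \<le> k" for u
      using that
    proof (induct u)
      case 0 thus ?case using D1 by simp
    next
      case (Suc u)
      have "0 \<le> D 1 * F 0" using D1 F0 by simp
      hence "D (Suc u) * F (Suc (Suc u)) \<le> D (Suc (Suc u)) * F (Suc u)" using cas[of "Suc u"] Suc(2) by simp
      moreover have "0 < D (Suc u) * F (Suc (Suc u))" using Suc F[of "Suc (Suc u)"] by simp
      ultimately have "0 < D (Suc (Suc u)) * F (Suc u)" by simp
      thus ?case using F[of "Suc u"] Suc(2) by (simp add: zero_less_mult_iff)
    qed
    from this[of "t - 1"] that show ?thesis by simp
  qed
  from this[of k] have "0 < p k - p 0 * (p 0 / p k)" using k by (simp add: D_def c_def)
  hence "(p k - p 0 * (p 0 / p k)) * p k < 0" using pk by (simp add: mult_pos_neg)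
  thus ?thesis using pk by (simp add: algebra_simps power2_eq_square)
qed

context spine
begin

lemma finite_leaves: "finite {e \<in> V - S. h e = t}"
  using finV by simp

lemma nbr_sum_leaf: "e \<in> V \<Longrightarrow> e \<notin> S \<Longrightarrow> nbr_sum (parcs G) y e = y (s (h e))"
  by (simp add: nbr_sum_def nbrs_leaf)

lemma nbr_sum_spine:
  assumes t: "t \<le> d"
  shows "nbr_sum (parcs G) y (s t) = (if t = 0 then 0 else y (s (t - 1))) + (if t < d then y (s (Suc t)) else 0)
    + (\<Sum>e\<in>{e \<in> V - S. h e = t}. y e)"
proof -
  let ?P = "{s u |u. u \<le> d \<and> (u = Suc t \<or> t = Suc u)}"
  have P: "?P = (if t = 0 then {} else {s (t - 1)}) \<union> (if t < d then {s (Suc t)} else {})"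
    using t by (cases t) auto
  have "nbr_sum (parcs G) y (s t) = (\<Sum>u\<in>?P. y u) + (\<Sum>e\<in>{e \<in> V - S. h e = t}. y e)"
    unfolding nbr_sum_def nbrs_spine[OF t]
    by (rule sum.union_disjoint) (use finite_leaves P in auto)
  also have "(\<Sum>u\<in>?P. y u) = (if t = 0 then 0 else y (s (t - 1))) + (if t < d then y (s (Suc t)) else 0)"
    unfolding P using t by (auto simp: Suc_le_eq)
  finally show ?thesis .
qed

end

locale two_hubs = extremal_tree +
  fixes h :: "'a \<Rightarrow> nat" and i j :: nat
  assumes spine_h: "spine V d v h" and E_spine: "E = parcs (spine_tree V d v h)"
    and hubs: "v i = wA" "v j = wB" "1 \<le> i" "i < j" "j < d"
    and prA: "projects pA rA i" and prB: "projects pB rB j"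
    and leaves: "\<And>e. e \<in> V \<Longrightarrow> e \<notin> v ` {..d} \<Longrightarrow> h e = i \<and> 0 < x e \<or> h e = j \<and> x e < 0"
begin

sublocale S: spine V d v h by (rule spine_h)

abbreviation "leaves_at t \<equiv> {e \<in> V - v ` {..d}. h e = t}"
abbreviation "X t \<equiv> x (v t)"

definition a where "a = card (leaves_at i)"
definition b where "b = card (leaves_at j)"

lemma l_pos: "0 < l" using l_ge(1) by simp

lemma leaf_value: "e \<in> V \<Longrightarrow> e \<notin> v ` {..d} \<Longrightarrow> x e = X (h e) / l"
  using eig[of e] S.nbr_sum_leaf[of e x] l_pos unfolding E_spine by (simp add: field_simps)

text \<open>The hung vertices are eliminated through their value \<open>X t / l\<close>, which
  leaves a recurrence along the spine.\<close>

lemma spine_eq: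
  assumes "t \<le> d"
  shows "l * X t = (if t = 0 then 0 else X (t - 1)) + (if t < d then X (Suc t) else 0)
    + real (card (leaves_at t)) * X t / l"
proof -
  have "(\<Sum>e\<in>leaves_at t. x e) = (\<Sum>e\<in>leaves_at t. X t / l)"
    by (rule sum.cong) (auto simp: leaf_value)
  thus ?thesis using S.nbr_sum_spine[OF assms, of x] eig[OF v_in[OF assms]] unfolding E_spine by simp
qed

lemma no_leaves: "t \<noteq> i \<Longrightarrow> t \<noteq> j \<Longrightarrow> card (leaves_at t) = 0"
proof -
  assume "t \<noteq> i" "t \<noteq> j"
  hence "leaves_at t = {}" using leaves by blast
  thus ?thesis by (simp only: card.empty)
qed

lemma spine_rec:
  assumes "1 \<le> t" "t < d" "t \<noteq> i" "t \<noteq> j"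
  shows "l * X t = X (t - 1) + X (Suc t)"
proof -
  note c = no_leaves[OF assms(3,4)]
  show ?thesis using spine_eq[of t] assms by (simp only: c) simp
qed

lemma spine_ends: "l * X 0 = X 1" "l * X d = X (d - 1)"
proof -
  have "card (leaves_at 0) = 0" "card (leaves_at d) = 0" using no_leaves[of 0] no_leaves[of d] hubs by simp_all
  note c = this
  show "l * X 0 = X 1" using spine_eq[of 0] d3 by (simp only: c) simp
  show "l * X d = X (d - 1)" using spine_eq[of d] d3 by (simp only: c) simp
qed

lemma hub_eq: "l * X i = X (i - 1) + X (Suc i) + real a * X i / l"
  "l * X j = X (j - 1) + X (Suc j) + real b * X j / l"
  using spine_eq[of i] spine_eq[of j] hubs by (simp_all add: a_def b_def)

lemma Xij: "0 < X i" "X j < 0" using posA negB hubs by auto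

lemma X_le: "1 \<le> t \<Longrightarrow> t < d \<Longrightarrow> X t \<le> X i"
proof -
  assume t: "1 \<le> t" "t < d"
  have "{v (t - 1), v (Suc t)} \<subseteq> E `` {v t}"
    using v_edge[OF t(2)] E_sym[OF v_edge[of "t - 1"]] t by simp
  hence "card {v (t - 1), v (Suc t)} \<le> card (E `` {v t})" by (rule card_mono[OF fin_nbrs])
  moreover have "v (t - 1) \<noteq> v (Suc t)" using t by simp
  ultimately have "2 \<le> card (E `` {v t})" by simp
  thus "X t \<le> X i" using A_max[of "v t"] v_in t hubs(1) by simp
qed

lemma right_nonpos: "j < t \<Longrightarrow> t \<le> d \<Longrightarrow> X t \<le> 0"
proof (rule ccontr)
  assume t: "j < t" "t \<le> d" "\<not> X t \<le> 0"
  hence "0 < X j" using A_toward[OF prA, of t j] hubs by simp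
  thus False using Xij by simp
qed

text \<open>The outer ends of the path enter the balancing argument only through the ratios
  \<open>gA\<close> and \<open>gB\<close>.\<close>

definition gA where "gA = X (i - 1) / X i"
definition gB where "gB = X (Suc j) / X j"

lemma gA_lt: "gA < 2 / l"
proof -
  have "l * X (i - 1) < 2 * X i"
  proof (rule recurrence_tail[of l "\<lambda>t. X t" i])
    show "l * X t = X (t - 1) + X (Suc t)" if "1 \<le> t" "t < i" for t
      using spine_rec[of t] that hubs by simp
    show "2 \<le> i \<Longrightarrow> X (i - 1) \<le> X i" using X_le[of "i - 1"] hubs by simp
  qed (use l_pos spine_ends Xij hubs in auto)
  thus ?thesis using l_pos Xij by (simp add: gA_def field_simps)
qed

text \<open>Beyond \<open>j\<close> no value is positive, so the recurrence gives
  \<open>l * X (Suc j) \<le> X j\<close>; dividing by \<open>X j < 0\<close> reverses the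
  inequality.\<close>

lemma gB_ge: "1 / l \<le> gB"
proof -
  have "l * X (Suc j) \<le> X j"
  proof (cases "Suc j = d")
    case True thus ?thesis using spine_ends(2) by auto
  next
    case False
    hence "l * X (Suc j) = X j + X (Suc (Suc j))" using spine_rec[of "Suc j"] hubs by simp
    moreover have "X (Suc (Suc j)) \<le> 0" using right_nonpos[of "Suc (Suc j)"] False hubs by simp
    ultimately show ?thesis by simp
  qed
  thus ?thesis using l_pos Xij by (simp add: gB_def field_simps)
qed

lemma hub_slopes: "X (Suc i) / X i = l - real a / l - gA" "X (j - 1) / X j = l - real b / l - gB"
  using hub_eq Xij by (auto simp: gA_def gB_def field_simps)

text \<open>A surplus of two leaves outweighs the outer ratios, as \<open>gA < 2 / l\<close> and
  \<open>1 / l \<le> gB\<close>, even when \<open>1 / l\<close> is subtracted for the leaf to be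
  moved. This compares the inner slopes at the hubs and so gives the first claim by
  \<open>recurrence_between_hubs\<close>.\<close>

lemma hub_values:
  assumes ab: "a + 2 \<le> b"
  shows "(X j)\<^sup>2 < (X i)\<^sup>2" "0 < real b / l + gB - real a / l - gA - 1 / l"
proof -
  have "real a + 2 \<le> real b" using ab by linarith
  hence "real a / l + 2 / l \<le> real b / l" using l_pos by (simp add: add_divide_distrib[symmetric] divide_right_mono)
  moreover have "2 / l = 1 / l + 1 / l" by (simp flip: add_divide_distrib)
  ultimately show delta: "0 < real b / l + gB - real a / l - gA - 1 / l"
    using gA_lt gB_ge by linarith
  have ij: "i + (j - i) = j" using hubs by simp
  have "(X (i + (j - i)))\<^sup>2 < (X (i + 0))\<^sup>2"
  proof (rule recurrence_between_hubs[of l "j - i" "\<lambda>t. X (i + t)"])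
    show "l * X (i + t) = X (i + (t - 1)) + X (i + Suc t)" if "1 \<le> t" "t < j - i" for t
    proof -
      have "i + t - 1 = i + (t - 1)" using that by simp
      thus ?thesis using spine_rec[of "i + t"] that hubs by simp
    qed
    show "0 < X (i + t)" if "t < j - i" "0 < X (i + Suc t)" for t
      using A_toward[OF prA, of "i + Suc t" "i + t"] that hubs by simp
    have e: "i + (j - i - 1) = j - 1" using hubs by simp
    have "0 < 1 / l" using l_pos by simp
    hence "l - real b / l - gB < l - real a / l - gA" using delta by linarith
    thus "X (i + (j - i - 1)) / X (i + (j - i)) < X (i + 1) / X (i + 0)"
      unfolding e ij using hub_slopes by simp
    \<comment> \<open>Here \<open>2 \<le> b\<close> and \<open>1 / l \<le> gB\<close> give at least
      \<open>3 / l\<close>, which exceeds 1 for \<open>l < 2\<close>.\<close>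
    show "X (i + (j - i - 1)) / X (i + (j - i)) < l - 1" if "l < 2"
    proof -
      have "3 / l \<le> real b / l + 1 / l"
        using ab l_pos by (simp add: add_divide_distrib[symmetric] divide_right_mono)
      moreover have "1 < 3 / l" using l_pos that by simp
      ultimately have "1 < real b / l + gB" using gB_ge by linarith
      thus ?thesis using hub_slopes(2) unfolding e ij by simp
    qed
    show "X (i + 1) \<le> X (i + 0)" using X_le[of "Suc i"] hubs by simp
  qed (use l_pos hubs Xij ij in auto)
  thus "(X j)\<^sup>2 < (X i)\<^sup>2" by (simp add: ij)
qed

text \<open>
  Moving a leaf from \<open>j\<close> to \<open>i\<close>, test with the span of the profile \<open>X\<close> and of \<open>Y\<close>, which is \<open>X\<close> reversed between the
  hubs and rescaled outside. Both satisfy the eigenvector equation away from the hubs, so the form only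
  sees the residuals there.
\<close>

lemma leaf_counts_balanced: "b < a + 2"
proof (rule ccontr)
  assume "\<not> b < a + 2"
  hence ab: "a + 2 \<le> b" by simp
  note hv = hub_values[OF ab]
  define \<delta> where "\<delta> = real b / l + gB - real a / l - gA - 1 / l"
  have \<delta>: "0 < \<delta>" using hv(2) by (simp add: \<delta>_def)
  have finL: "finite (leaves_at t)" for t using fin by simp
  have "leaves_at j \<noteq> {}"
  proof
    assume "leaves_at j = {}"
    hence "b = 0" unfolding b_def by (simp only: card.empty)
    thus False using ab by simp
  qed
  then obtain e0 where e0: "e0 \<in> leaves_at j" by blast
  define h' where "h' = h(e0 := i)"
  have sp: "spine V d v h'"
    by (intro spine.intro) (use S.finV S.d2 S.inj S.sV S.h hubs e0 in \<open>auto simp: h'_def\<close>)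
  interpret S': spine V d v h' by (rule sp)
  let ?E = "parcs S'.G"
  let ?L = "\<lambda>t. {e \<in> V - v ` {..d}. h' e = t}"
  have Li: "?L i = insert e0 (leaves_at i)" and Lj: "?L j = leaves_at j - {e0}"
    using e0 hubs by (auto simp: h'_def)
  have "e0 \<notin> leaves_at i" using e0 hubs by auto
  hence cards: "real (card (?L i)) = real a + 1" "real (card (?L j)) = real b - 1"
    unfolding Li Lj using e0 finL ab by (simp_all add: a_def b_def card_Diff_singleton of_nat_diff)
  have Lt: "card (?L t) = 0" if "t \<noteq> i" "t \<noteq> j" for t
  proof -
    have "?L t = {}" using leaves that by (auto simp: h'_def split: if_splits)
    thus ?thesis by (simp only: card.empty)
  qed
  \<comment> \<open>The values at hung vertices are chosen so that the eigenvector equation holds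
    there automatically.\<close>
  define ext where "ext g u = (if u \<in> v ` {..d} then g (S'.ix u) else g (h' u) / l)" for g :: "nat \<Rightarrow> real" and u
  have ext_v: "ext g (v t) = g t" if "t \<le> d" for g t using that by (simp add: ext_def)
  define res where "res g t = nbr_sum ?E (ext g) (v t) - l * g t" for g t
  have res: "res g t = (if t = 0 then 0 else g (t - 1)) + (if t < d then g (Suc t) else 0)
      + real (card (?L t)) * g t / l - l * g t" if t: "t \<le> d" for g t
  proof -
    have "(\<Sum>e\<in>?L t. ext g e) = (\<Sum>e\<in>?L t. g t / l)" by (rule sum.cong) (auto simp: ext_def)
    thus ?thesis using S'.nbr_sum_spine[OF t, of "ext g"] t by (simp add: res_def ext_v)
  qed
  define good where "good g \<longleftrightarrow> l * g 0 = g 1 \<and> l * g d = g (d - 1) \<and>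
    (\<forall>t. 1 \<le> t \<and> t < d \<and> t \<noteq> i \<and> t \<noteq> j \<longrightarrow> l * g t = g (t - 1) + g (Suc t))" for g :: "nat \<Rightarrow> real"
  have form: "(\<Sum>u\<in>V. ext g u * (nbr_sum ?E (ext g) u - l * ext g u)) = g i * res g i + g j * res g j"
    if g: "good g" for g
  proof -
    have zero: "ext g u * (nbr_sum ?E (ext g) u - l * ext g u) = 0" if u: "u \<in> V - {v i, v j}" for u
    proof (cases "u \<in> v ` {..d}")
      case False
      hence "h' u \<le> d" using S'.h[of u] u by auto
      hence "nbr_sum ?E (ext g) u = g (h' u)" using S'.nbr_sum_leaf[of u "ext g"] False u by (simp add: ext_v)
      thus ?thesis using False l_pos by (simp add: ext_def)
    next
      case True
      then obtain t where t: "t \<le> d" "u = v t" by auto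
      hence tij: "t \<noteq> i" "t \<noteq> j" using u by auto
      have "res g t = 0"
      proof (cases "t = 0 \<or> t = d")
        case True
        thus ?thesis using res[OF t(1), of g] Lt[OF tij] g d3 unfolding good_def by auto
      next
        case False
        hence "1 \<le> t \<and> t < d" using t by auto
        hence "l * g t = g (t - 1) + g (Suc t)" using g tij unfolding good_def by blast
        thus ?thesis using res[OF t(1), of g] Lt[OF tij] False t by simp
      qed
      thus ?thesis using t by (simp add: res_def ext_v)
    qed
    have "(\<Sum>u\<in>V. ext g u * (nbr_sum ?E (ext g) u - l * ext g u)) =
        (\<Sum>u\<in>{v i, v j}. ext g u * (nbr_sum ?E (ext g) u - l * ext g u))"
      by (rule sum.mono_neutral_right) (use fin v_in hubs zero in auto)
    also have "\<dots> = g i * res g i + g j * res g j"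
    proof -
      have le: "i \<le> d" "j \<le> d" and ne: "i \<noteq> j" using hubs by auto
      hence "v i \<noteq> v j" by simp
      thus ?thesis by (simp add: ext_v[OF le(1)] ext_v[OF le(2)] res_def)
    qed
    finally show ?thesis .
  qed
  \<comment> \<open>The outer factors make the three pieces match at the hubs, where
    \<open>Y i = X j\<close> and \<open>Y j = X i\<close>.\<close>
  define Y where "Y t = (if t \<le> i then X t * (X j / X i) else if t \<le> j then X (i + j - t) else X t * (X i / X j))" for t
  have Yi: "Y i = X j" "Y j = X i" using Xij hubs by (auto simp: Y_def)
  have gX: "good (\<lambda>t. X t)" unfolding good_def using spine_ends spine_rec by blast
  have gY: "good Y"
    unfolding good_def
  proof (intro conjI allI impI)
    have "l * (X 0 * (X j / X i)) = X 1 * (X j / X i)" using spine_ends(1) by (simp add: mult.assoc[symmetric])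
    thus "l * Y 0 = Y 1" using hubs by (simp add: Y_def)
    have "l * (X d * (X i / X j)) = X (d - 1) * (X i / X j)" using spine_ends(2) by (simp add: mult.assoc[symmetric])
    moreover have "Y (d - 1) = X (d - 1) * (X i / X j)"
      using hubs Xij Yi by (cases "d - 1 = j") (auto simp: Y_def)
    ultimately show "l * Y d = Y (d - 1)" using hubs by (simp add: Y_def)
    fix t assume t: "1 \<le> t \<and> t < d \<and> t \<noteq> i \<and> t \<noteq> j"
    consider "t < i" | "i < t" "t < j" | "j < t" using t by linarith
    thus "l * Y t = Y (t - 1) + Y (Suc t)"
    proof cases
      case 1
      define c where "c = X j / X i"
      have "Y t = X t * c" "Y (t - 1) = X (t - 1) * c" "Y (Suc t) = X (Suc t) * c"
        using 1 by (auto simp: Y_def c_def)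
      thus ?thesis using spine_rec[of t] t by (simp add: distrib_right[symmetric] mult.assoc[symmetric])
    next
      case 2
      have r: "l * X (i + j - t) = X (i + j - t - 1) + X (Suc (i + j - t))"
        by (rule spine_rec) (use 2 hubs in auto)
      have "Suc (i + j - t) = i + j - (t - 1)" "i + j - t - 1 = i + j - Suc t" using 2 by auto
      moreover have "Y (t - 1) = X (i + j - (t - 1))" using 2 Yi by (cases "t - 1 = i") (auto simp: Y_def)
      moreover have "Y (Suc t) = X (i + j - Suc t)" "Y t = X (i + j - t)" using 2 by (auto simp: Y_def)
      ultimately show ?thesis using r by simp
    next
      case 3
      define c where "c = X i / X j"
      have "Y (t - 1) = X (t - 1) * c" using 3 Yi Xij hubs by (cases "t - 1 = j") (auto simp: Y_def c_def)
      moreover have "Y (Suc t) = X (Suc t) * c" "Y t = X t * c" using 3 hubs by (auto simp: Y_def c_def)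
      ultimately show ?thesis using spine_rec[of t] t
        by (simp add: distrib_right[symmetric] mult.assoc[symmetric])
    qed
  qed
  have good_comb: "good (\<lambda>t. \<alpha> * X t + \<beta> * Y t)" for \<alpha> \<beta>
    using gX gY unfolding good_def by (simp add: algebra_simps)
  \<comment> \<open>\<open>X\<close> solved the old equations, so the residuals are just the leaf
    gained at \<open>i\<close> and the leaf lost at \<open>j\<close>.\<close>
  have resX: "res (\<lambda>t. X t) i = X i / l" "res (\<lambda>t. X t) j = - X j / l"
    using res[of i "\<lambda>t. X t"] res[of j "\<lambda>t. X t"] hub_eq hubs cards by (auto simp: distrib_right left_diff_distrib add_divide_distrib diff_divide_distrib)
  have sl: "X (Suc i) = X i * (l - real a / l - gA)" "X (j - 1) = X j * (l - real b / l - gB)"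
    "X (i - 1) = X i * gA" "X (Suc j) = X j * gB"
    using hub_slopes Xij by (auto simp: gA_def gB_def divide_eq_eq mult.commute)
  \<comment> \<open>The reflection exchanges the inner slopes of the hubs while the outer ratios
    stay in place; the mismatch is the constant from \<open>hub_values\<close>.\<close>
  have resY: "res Y i = - \<delta> * X j" "res Y j = \<delta> * X i"
  proof -
    have "Y (i - 1) = X j * gA" using sl(3) Xij hubs by (simp add: Y_def)
    moreover have "Y (Suc i) = X (j - 1)" using hubs Yi by (cases "Suc i = j") (auto simp: Y_def)
    ultimately have "res Y i = X j * gA + X (j - 1) + (real a + 1) * X j / l - l * X j"
      using res[of i Y] hubs cards Yi by simp
    also have "\<dots> = - \<delta> * X j" unfolding sl(2) \<delta>_def
      by (simp add: algebra_simps add_divide_distrib diff_divide_distrib)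
    finally show "res Y i = - \<delta> * X j" .
    have "Y (Suc j) = X i * gB" using sl(4) Xij hubs by (simp add: Y_def)
    moreover have "Y (j - 1) = X (Suc i)" using hubs Yi by (cases "j - 1 = i") (auto simp: Y_def)
    ultimately have "res Y j = X (Suc i) + X i * gB + (real b - 1) * X i / l - l * X i"
      using res[of j Y] hubs cards Yi by simp
    also have "\<dots> = \<delta> * X i" unfolding sl(1) \<delta>_def
      by (simp add: algebra_simps add_divide_distrib diff_divide_distrib)
    finally show "res Y j = \<delta> * X i" .
  qed
  have ext_comb: "\<alpha> * ext (\<lambda>t. X t) u + \<beta> * ext Y u = ext (\<lambda>t. \<alpha> * X t + \<beta> * Y t) u" for \<alpha> \<beta> u
    by (simp add: ext_def add_divide_distrib)
  have res_comb: "res (\<lambda>t. \<alpha> * X t + \<beta> * Y t) t = \<alpha> * res (\<lambda>t. X t) t + \<beta> * res Y t" for \<alpha> \<beta> t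
    unfolding res_def ext_comb[symmetric] by (simp add: nbr_sum_linear algebra_simps)
  \<comment> \<open>The mixed terms in \<open>\<alpha> * \<beta>\<close> cancel, so definiteness
    reduces to \<open>\<delta> > 0\<close> and to the comparison of the hub values.\<close>
  have Q: "(\<Sum>u\<in>V. z u * (nbr_sum ?E z u - l * z u)) = (\<alpha>\<^sup>2 / l + \<beta>\<^sup>2 * \<delta>) * ((X i)\<^sup>2 - (X j)\<^sup>2)"
    if z: "\<And>u. z u = \<alpha> * ext (\<lambda>t. X t) u + \<beta> * ext Y u" for z \<alpha> \<beta>
  proof -
    have "z = ext (\<lambda>t. \<alpha> * X t + \<beta> * Y t)" using z ext_comb by (simp add: fun_eq_iff)
    hence "(\<Sum>u\<in>V. z u * (nbr_sum ?E z u - l * z u)) =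
      (\<alpha> * X i + \<beta> * X j) * (\<alpha> * (X i / l) + \<beta> * (- \<delta> * X j)) +
      (\<alpha> * X j + \<beta> * X i) * (\<alpha> * (- X j / l) + \<beta> * (\<delta> * X i))"
      using form[OF good_comb] by (simp add: res_comb resX resY Yi)
    also have "\<dots> = (\<alpha>\<^sup>2 / l + \<beta>\<^sup>2 * \<delta>) * ((X i)\<^sup>2 - (X j)\<^sup>2)"
      by (simp add: algebra_simps power2_eq_square diff_divide_distrib add_divide_distrib)
    finally show ?thesis .
  qed
  have Qpos: "0 < (\<alpha>\<^sup>2 / l + \<beta>\<^sup>2 * \<delta>) * ((X i)\<^sup>2 - (X j)\<^sup>2)" if "\<alpha> \<noteq> 0 \<or> \<beta> \<noteq> 0" for \<alpha> \<beta>
  proof -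
    have "0 < \<alpha>\<^sup>2 / l + \<beta>\<^sup>2 * \<delta>"
      using that l_pos \<delta> by (cases "\<alpha> = 0") (auto intro: add_pos_nonneg)
    thus ?thesis using hv(1) by simp
  qed
  have Q0: "\<alpha> = 0 \<and> \<beta> = 0"
    if "\<And>u. u \<in> V \<Longrightarrow> nbr_sum ?E (\<lambda>v. \<alpha> * ext (\<lambda>t. X t) v + \<beta> * ext Y v) u
        = l * (\<alpha> * ext (\<lambda>t. X t) u + \<beta> * ext Y u)" for \<alpha> \<beta>
  proof (rule ccontr)
    assume no: "\<not> ?thesis"
    have "(\<Sum>u\<in>V. (\<alpha> * ext (\<lambda>t. X t) u + \<beta> * ext Y u) *
       (nbr_sum ?E (\<lambda>v. \<alpha> * ext (\<lambda>t. X t) v + \<beta> * ext Y v) u - l * (\<alpha> * ext (\<lambda>t. X t) u + \<beta> * ext Y u))) = 0"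
      using that by simp
    thus False using Q[of "\<lambda>u. \<alpha> * ext (\<lambda>t. X t) u + \<beta> * ext Y u" \<alpha> \<beta>, OF refl] Qpos[of \<alpha> \<beta>] no by auto
  qed
  have indep: "\<alpha> = 0 \<and> \<beta> = 0" if z: "\<And>u. u \<in> pverts S'.G \<Longrightarrow> \<alpha> * ext (\<lambda>t. X t) u + \<beta> * ext Y u = 0" for \<alpha> \<beta>
  proof (rule Q0)
    fix u assume u: "u \<in> V"
    have "nbr_sum ?E (\<lambda>v. \<alpha> * ext (\<lambda>t. X t) v + \<beta> * ext Y v) u = 0"
      unfolding nbr_sum_def
      by (rule sum.neutral) (use z conn_graph.nbrs_in[OF S'.conn_graph_G, of u] in auto)
    thus "nbr_sum ?E (\<lambda>v. \<alpha> * ext (\<lambda>t. X t) v + \<beta> * ext Y v) u = l * (\<alpha> * ext (\<lambda>t. X t) u + \<beta> * ext Y u)"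
      using z u by simp
  qed
  have nonneg: "0 \<le> (\<Sum>u\<in>pverts S'.G. z u * (nbr_sum ?E z u - l * z u))"
    if "\<And>u. z u = \<alpha> * ext (\<lambda>t. X t) u + \<beta> * ext Y u" for z \<alpha> \<beta>
    using Q[OF that] Qpos[of \<alpha> \<beta>] by (cases "\<alpha> = 0 \<and> \<beta> = 0") auto
  have card2: "2 \<le> card (pverts S'.G)" unfolding S'.pverts_G using card_ge2 unfolding V_eq .
  note td = two_dim_lambda2_ge[OF S'.graph_G card2, where x = "ext (\<lambda>t. X t)" and y = "ext Y" and \<mu> = l]
  \<comment> \<open>The bound itself is not strict. Together with maximality it gives equality, and
    the resulting eigenvector in the plane would have form 0, which \<open>Q0\<close>
    excludes.\<close>
  have "l \<le> lambda2 S'.G" by (rule td(1)) (erule indep nonneg)+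
  moreover have "lambda2 S'.G \<le> l" by (rule maximal[OF S'.in_trees_of_diameter])
  ultimately have eq: "lambda2 S'.G = l" by simp
  have "\<exists>\<alpha> \<beta>. (\<alpha> \<noteq> 0 \<or> \<beta> \<noteq> 0) \<and> (\<forall>u\<in>pverts S'.G. nbr_sum ?E (\<lambda>v. \<alpha> * ext (\<lambda>t. X t) v + \<beta> * ext Y v) u
        = l * (\<alpha> * ext (\<lambda>t. X t) u + \<beta> * ext Y u))"
    by (rule td(2)) (erule indep nonneg | rule eq)+
  then obtain \<alpha> \<beta> where "\<alpha> \<noteq> 0 \<or> \<beta> \<noteq> 0" "\<And>u. u \<in> V \<Longrightarrow> nbr_sum ?E (\<lambda>v. \<alpha> * ext (\<lambda>t. X t) v + \<beta> * ext Y v) u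
        = l * (\<alpha> * ext (\<lambda>t. X t) u + \<beta> * ext Y u)" by auto
  thus False using Q0 by blast
qed

end

section \<open>Choosing the orientation of the spine\<close>

lemma image_rev_atMost: "(\<lambda>t. s (d - t)) ` {..d} = s ` {..d :: nat}"
proof (intro equalityI subsetI)
  fix u assume "u \<in> s ` {..d}"
  then obtain t where "t \<le> d" "u = s (d - (d - t))" by auto
  thus "u \<in> (\<lambda>t. s (d - t)) ` {..d}" by (intro image_eqI[of _ _ "d - t"]) simp_all
qed auto

lemma (in spine) spine_rev: "spine V d (\<lambda>t. s (d - t)) (\<lambda>e. d - h e)"
proof
  show "finite V" "2 \<le> d" by (fact finV d2)+
  show "inj_on (\<lambda>t. s (d - t)) {..d}" by (rule inj_onI) auto
  show "(\<lambda>t. s (d - t)) ` {..d} \<subseteq> V" unfolding image_rev_atMost by (rule sV)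
  show "1 \<le> d - h e \<and> d - h e < d" if "e \<in> V" "e \<notin> (\<lambda>t. s (d - t)) ` {..d}" for e
    using h[of e] that unfolding image_rev_atMost by auto
qed

lemma (in spine) spine_tree_rev: "spine_tree V d (\<lambda>t. s (d - t)) (\<lambda>e. d - h e) = G"
proof -
  interpret R: spine V d "\<lambda>t. s (d - t)" "\<lambda>e. d - h e" by (rule spine_rev)
  have pairs: "{f (d - t) (d - Suc t) |t. t < d} = {f (Suc t) t |t. t < d}" for f :: "nat \<Rightarrow> nat \<Rightarrow> 'a \<times> 'a"
  proof (rule equalityI; rule subsetI)
    fix y assume "y \<in> {f (d - t) (d - Suc t) |t. t < d}"
    then obtain t where "t < d" "y = f (d - t) (d - Suc t)" by blast
    thus "y \<in> {f (Suc t) t |t. t < d}" by (intro CollectI exI[of _ "d - Suc t"]) (simp add: Suc_diff_Suc)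
  next
    fix y assume "y \<in> {f (Suc t) t |t. t < d}"
    then obtain t where "t < d" "y = f (Suc t) t" by blast
    thus "y \<in> {f (d - t) (d - Suc t) |t. t < d}" by (intro CollectI exI[of _ "d - Suc t"]) simp
  qed
  note half = pairs[of "\<lambda>t u. (s t, s u)"] pairs[of "\<lambda>t u. (s u, s t)"]
  have "s (d - (d - h e)) = s (h e)" if "e \<in> V - S" for e using h[of e] that by auto
  hence leaf: "{(e, s (d - (d - h e))) |e. e \<in> V - S} = {(e, s (h e)) |e. e \<in> V - S}"
    "{(s (d - (d - h e)), e) |e. e \<in> V - S} = {(s (h e), e) |e. e \<in> V - S}" by force+
  have "parcs R.G = parcs G" unfolding R.arcs_eq arcs_eq image_rev_atMost half leaf by blast
  thus ?thesis by (simp add: spine_tree_def)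
qed

context two_hubs
begin

text \<open>Reversal of the path goes together with the change of sign, so that the first hub is
  again the positive one.\<close>

lemma two_hubs_rev:
  "two_hubs T V E d l (\<lambda>u. - x u) wB pB rB wA pA rA (\<lambda>t. v (d - t)) (\<lambda>e. d - h e) (d - j) (d - i)"
proof -
  interpret R: extremal_tree T V E d l "\<lambda>u. - x u" wB pB rB wA pA rA "\<lambda>t. v (d - t)"
    by (rule extremal_tree_rev[OF extremal_tree_swap[OF extremal_tree_axioms]])
  show ?thesis
  proof (intro two_hubs.intro two_hubs_axioms.intro R.extremal_tree_axioms)
    show "spine V d (\<lambda>t. v (d - t)) (\<lambda>e. d - h e)" by (rule S.spine_rev)
    show "E = parcs (spine_tree V d (\<lambda>t. v (d - t)) (\<lambda>e. d - h e))" unfolding S.spine_tree_rev by (rule E_spine)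
    show "v (d - (d - j)) = wB" "v (d - (d - i)) = wA" "1 \<le> d - j" "d - j < d - i" "d - i < d" using hubs by simp_all
    show "R.projects pB rB (d - j)" "R.projects pA rA (d - i)" by (rule projects_rev, fact prB prA)+
    show "d - h e = d - j \<and> 0 < - x e \<or> d - h e = d - i \<and> - x e < 0"
      if "e \<in> V" "e \<notin> (\<lambda>t. v (d - t)) ` {..d}" for e using leaves[of e] that unfolding image_rev_atMost by auto
  qed
qed

lemma leaves_at_rev:
  assumes "k \<le> d"
  shows "{e \<in> V - (\<lambda>t. v (d - t)) ` {..d}. d - h e = d - k} = leaves_at k"
proof -
  have "d - h e = d - k \<longleftrightarrow> h e = k" if "e \<in> V - v ` {..d}" for e
    using S.h[of e] that assms by auto
  thus ?thesis unfolding image_rev_atMost by auto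
qed

end

lemma two_hubs_exists:
  assumes "extremal_tree T V E d l x wA pA rA wB pB rB v"
  obtains x' wA' pA' rA' wB' pB' rB' v' h i j
  where "two_hubs T V E d l x' wA' pA' rA' wB' pB' rB' v' h i j"
proof -
  interpret extremal_tree T V E d l x wA pA rA wB pB rB v by fact
  interpret W: extremal_tree T V E d l "\<lambda>u. - x u" wB pB rB wA pA rA v
    by (rule extremal_tree_swap[OF extremal_tree_axioms])
  obtain qA where prA: "projects pA rA qA" using projection_exists[OF rootA degA] by blast
  obtain qB where prB: "projects pB rB qB" using projection_exists[OF rootB degB] by blast
  have A: "0 < x (v qA)" by (rule path_meets_A[OF prA prB])
  have B: "x (v qB) < 0" using W.path_meets_A[OF prB prA] by simp
  have ne: "qA \<noteq> qB" using A B by auto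
  show thesis
  proof (cases "qA < qB")
    case True
    from path_meets_both[OF prA prB A B True] obtain h where
      "spine V d v h" "E = parcs (spine_tree V d v h)" "v qA = wA" "v qB = wB" "1 \<le> qA" "qB < d"
      "\<forall>e\<in>V - v ` {..d}. h e = qA \<and> 0 < x e \<or> h e = qB \<and> x e < 0" by blast
    hence "two_hubs T V E d l x wA pA rA wB pB rB v h qA qB"
      by (intro two_hubs.intro two_hubs_axioms.intro extremal_tree_axioms True prA prB) auto
    thus thesis by (rule that)
  next
    case False
    interpret R: extremal_tree T V E d l x wA pA rA wB pB rB "\<lambda>t. v (d - t)"
      by (rule extremal_tree_rev[OF extremal_tree_axioms])
    note q = projectsD(1)[OF prA] projectsD(1)[OF prB]
    note pr = projects_rev[OF prA] projects_rev[OF prB]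
    have lt: "d - qA < d - qB" using False ne q by simp
    have AB: "0 < x (v (d - (d - qA)))" "x (v (d - (d - qB))) < 0" using A B q by simp_all
    from R.path_meets_both[OF pr AB lt] obtain h where
      "spine V d (\<lambda>t. v (d - t)) h" "E = parcs (spine_tree V d (\<lambda>t. v (d - t)) h)"
      "v (d - (d - qA)) = wA" "v (d - (d - qB)) = wB" "1 \<le> d - qA" "d - qB < d"
      "\<forall>e\<in>V - (\<lambda>t. v (d - t)) ` {..d}. h e = d - qA \<and> 0 < x e \<or> h e = d - qB \<and> x e < 0" by blast
    hence "two_hubs T V E d l x wA pA rA wB pB rB (\<lambda>t. v (d - t)) h (d - qA) (d - qB)"
      by (intro two_hubs.intro two_hubs_axioms.intro R.extremal_tree_axioms lt pr) auto
    thus thesis by (rule that)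
  qed
qed

lemma maximizer_two_hubs:
  fixes T :: "'a pair_pre_digraph"
  assumes "3 \<le> d" "lambda2_maximizer n d T"
  obtains v h i j where "spine (pverts T) d v h" "T = spine_tree (pverts T) d v h"
    "1 \<le> i" "i < j" "j < d"
    "\<And>e. e \<in> pverts T - v ` {..d} \<Longrightarrow> h e = i \<or> h e = j"
    "card {e \<in> pverts T - v ` {..d}. h e = i} \<le> card {e \<in> pverts T - v ` {..d}. h e = j}"
    "card {e \<in> pverts T - v ` {..d}. h e = j} \<le> Suc (card {e \<in> pverts T - v ` {..d}. h e = i})"
proof -
  obtain x0 wA0 pA0 rA0 wB0 pB0 rB0 v0 where
    "extremal_tree T (pverts T) (parcs T) d (lambda2 T) x0 wA0 pA0 rA0 wB0 pB0 rB0 v0"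
    using maximizer_extremal_tree[OF assms] by blast
  then obtain x wA pA rA wB pB rB v h i j where
    "two_hubs T (pverts T) (parcs T) d (lambda2 T) x wA pA rA wB pB rB v h i j"
    by (rule two_hubs_exists)
  then interpret H: two_hubs T "pverts T" "parcs T" d "lambda2 T" x wA pA rA wB pB rB v h i j .
  note result = that
  \<comment> \<open>The smaller number of leaves is to sit at the smaller index; if necessary the
    tree is read backwards.\<close>
  have wlog: thesis if hyp: "two_hubs T (pverts T) (parcs T) d (lambda2 T) y uA qA sA uB qB sB s g k m"
    and le: "card {e \<in> pverts T - s ` {..d}. g e = k} \<le> card {e \<in> pverts T - s ` {..d}. g e = m}"
    for y uA qA sA uB qB sB s g k m
  proof -
    interpret K: two_hubs T "pverts T" "parcs T" d "lambda2 T" y uA qA sA uB qB sB s g k m by (rule hyp)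
    have T: "T = spine_tree (pverts T) d s g"
      by (intro pair_pre_digraph.equality K.E_spine) (simp_all add: K.S.pverts_G)
    have off: "g e = k \<or> g e = m" if "e \<in> pverts T - s ` {..d}" for e using K.leaves[of e] that by auto
    have le': "card {e \<in> pverts T - s ` {..d}. g e = m} \<le> Suc (card {e \<in> pverts T - s ` {..d}. g e = k})"
      using K.leaf_counts_balanced unfolding K.a_def K.b_def by simp
    show thesis by (rule result[OF K.spine_h T K.hubs(3-5)]; (erule off | rule le | rule le'))
  qed
  show thesis
  proof (cases "H.a \<le> H.b")
    case True
    thus thesis using wlog[OF H.two_hubs_axioms] unfolding H.a_def H.b_def by blast
  next
    case False
    interpret R: two_hubs T "pverts T" "parcs T" d "lambda2 T" "\<lambda>u. - x u" wB pB rB wA pA rA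
      "\<lambda>t. v (d - t)" "\<lambda>e. d - h e" "d - j" "d - i" by (rule H.two_hubs_rev)
    have "R.a = H.b" "R.b = H.a" unfolding R.a_def R.b_def H.a_def H.b_def
      using H.leaves_at_rev[of i] H.leaves_at_rev[of j] H.hubs by simp_all
    hence "R.a \<le> R.b" using False by simp
    thus thesis using wlog[OF R.two_hubs_axioms] unfolding R.a_def R.b_def by blast
  qed
qed

subsection \<open>Shape of the maximizer\<close>

lemma digraph_iso_pairI:
  fixes G :: "('a, 'a \<times> 'a) pre_digraph" and H :: "'b pair_pre_digraph"
  assumes "tail G = fst" "head G = snd" "arcs G \<subseteq> verts G \<times> verts G"
    and inj: "inj_on g (verts G)" and "g ` verts G = pverts H" "map_prod g g ` arcs G = parcs H"
  shows "digraph_iso G (with_proj H)"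
proof -
  let ?f = "\<lparr>iso_verts = g, iso_arcs = map_prod g g, iso_head = snd, iso_tail = fst\<rparr>"
  have "wf_digraph G" by unfold_locales (use assms in auto)
  moreover have "inj_on (map_prod g g) (arcs G)"
    by (rule inj_on_subset[OF map_prod_inj_on[OF inj inj] assms(3)])
  ultimately have "pre_digraph.digraph_isomorphism G ?f"
    unfolding pre_digraph.digraph_isomorphism_def using assms by simp
  moreover have "with_proj H = app_iso ?f G"
    unfolding app_iso_def with_proj_def using assms by simp
  ultimately show ?thesis unfolding digraph_iso_def by blast
qed

lemma out_degree_eq_card_nbrs: "out_degree (with_proj G) u = card (parcs G `` {u})"
proof -
  have "out_arcs (with_proj G) u = Pair u ` (parcs G `` {u})" by (auto simp: out_arcs_def)
  thus ?thesis unfolding out_degree_def by (simp add: card_image inj_on_def)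
qed

context spine
begin

lemma degree_leaf: "e \<in> V \<Longrightarrow> e \<notin> S \<Longrightarrow> out_degree (with_proj G) e = 1"
  by (simp add: out_degree_eq_card_nbrs nbrs_leaf)

lemma degree_ends: "out_degree (with_proj G) (s 0) = 1" "out_degree (with_proj G) (s d) = 1"
proof -
  have "{s u |u. u \<le> d \<and> (u = Suc 0 \<or> 0 = Suc u)} \<union> {e \<in> V - S. h e = 0} = {s 1}"
    using h d2 by force
  thus "out_degree (with_proj G) (s 0) = 1" unfolding out_degree_eq_card_nbrs nbrs_spine[OF le0] by simp
  have "{s u |u. u \<le> d \<and> (u = Suc d \<or> d = Suc u)} \<union> {e \<in> V - S. h e = d} = {s (d - 1)}"
    using h d2 by force
  thus "out_degree (with_proj G) (s d) = 1" unfolding out_degree_eq_card_nbrs nbrs_spine[OF le_refl] by simp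
qed

lemma nbrs_inner:
  assumes "1 \<le> t" "t < d"
  shows "parcs G `` {s t} = {s (t - 1), s (Suc t)} \<union> {e \<in> V - S. h e = t}"
proof -
  have "u \<le> d \<and> (u = Suc t \<or> t = Suc u) \<longleftrightarrow> u = t - 1 \<or> u = Suc t" for u using assms by auto
  thus ?thesis using nbrs_spine[of t] assms by auto
qed

lemma degree_inner:
  assumes t: "1 \<le> t" "t < d"
  shows "2 \<le> out_degree (with_proj G) (s t)"
    and "(\<And>e. e \<in> V - S \<Longrightarrow> h e \<noteq> t) \<Longrightarrow> out_degree (with_proj G) (s t) = 2"
proof -
  have "s (t - 1) \<noteq> s (Suc t)" using t by simp
  hence c: "card {s (t - 1), s (Suc t)} = 2" by simp
  have "card {s (t - 1), s (Suc t)} \<le> card (parcs G `` {s t})"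
    unfolding nbrs_inner[OF t] by (rule card_mono) (use finV in auto)
  thus "2 \<le> out_degree (with_proj G) (s t)" unfolding out_degree_eq_card_nbrs c .
  assume "\<And>e. e \<in> V - S \<Longrightarrow> h e \<noteq> t"
  hence "{e \<in> V - S. h e = t} = {}" by blast
  thus "out_degree (with_proj G) (s t) = 2" unfolding out_degree_eq_card_nbrs nbrs_inner[OF t]
    by (simp only: Un_empty_right c)
qed

lemma non_pendant: "{u \<in> V. out_degree (with_proj G) u \<noteq> 1} = s ` {1..<d}"
proof (intro equalityI subsetI)
  fix u assume "u \<in> {u \<in> V. out_degree (with_proj G) u \<noteq> 1}"
  hence u: "u \<in> V" "out_degree (with_proj G) u \<noteq> 1" by auto
  have "u \<in> S" using degree_leaf[OF u(1)] u(2) by blast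
  then obtain t where t: "t \<le> d" "u = s t" by auto
  have "t \<noteq> 0" "t \<noteq> d" using degree_ends u(2) unfolding t(2) by (intro notI; simp)+
  thus "u \<in> s ` {1..<d}" using t by auto
next
  fix u assume "u \<in> s ` {1..<d}"
  then obtain t where t: "1 \<le> t" "t < d" "u = s t" by auto
  thus "u \<in> {u \<in> V. out_degree (with_proj G) u \<noteq> 1}" using degree_inner(1)[OF t(1,2)] s_in(1)[of t] by simp
qed

lemma caterpillar_G: "caterpillar G"
proof -
  let ?W = "s ` {1..<d}" and ?g = "\<lambda>u. ix u - 1"
  let ?I = "with_proj G \<restriction> ?W"
  have st: "s t \<in> ?W \<longleftrightarrow> 1 \<le> t \<and> t < d" if "t \<le> d" for t using that by auto
  have leaf: "e \<notin> ?W" if "e \<in> V - S" for e using that by auto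
  have arcs: "arcs ?I = {(s t, s (Suc t)) |t. 1 \<le> t \<and> Suc t < d} \<union> {(s (Suc t), s t) |t. 1 \<le> t \<and> Suc t < d}"
  proof (intro equalityI subsetI)
    fix p assume "p \<in> arcs ?I"
    then obtain a b where p: "p = (a, b)" "(a, b) \<in> parcs G" "a \<in> ?W" "b \<in> ?W"
      by (cases p) auto
    from p(2) show "p \<in> {(s t, s (Suc t)) |t. 1 \<le> t \<and> Suc t < d} \<union> {(s (Suc t), s t) |t. 1 \<le> t \<and> Suc t < d}"
      unfolding arcs_eq p(1) using p(3,4) st leaf by auto
  next
    fix p assume "p \<in> {(s t, s (Suc t)) |t. 1 \<le> t \<and> Suc t < d} \<union> {(s (Suc t), s t) |t. 1 \<le> t \<and> Suc t < d}"
    then obtain t where t: "1 \<le> t" "Suc t < d" "p = (s t, s (Suc t)) \<or> p = (s (Suc t), s t)" by blast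
    have "(s t, s (Suc t)) \<in> parcs G" "(s (Suc t), s t) \<in> parcs G" using t unfolding arcs_eq by auto
    moreover have "s t \<in> ?W" "s (Suc t) \<in> ?W" using t by auto
    ultimately show "p \<in> arcs ?I" using t(3) by auto
  qed
  \<comment> \<open>The inner positions \<open>1\<close>, ..., \<open>d - 1\<close> are shifted to
    \<open>0\<close>, ..., \<open>d - 2\<close>.\<close>
  have "digraph_iso ?I (with_proj (path_graph (d - 2)))"
  proof (rule digraph_iso_pairI[where g = ?g])
    show "arcs ?I \<subseteq> verts ?I \<times> verts ?I" unfolding arcs by auto
    show "inj_on ?g (verts ?I)" by (rule inj_onI) auto
    have "?g ` verts ?I = (\<lambda>t. t - 1) ` {1..<d}" by (simp add: image_image)
    also have "\<dots> = {0..d - 2}"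
    proof (intro equalityI subsetI)
      fix u assume "u \<in> {0..d - 2}"
      thus "u \<in> (\<lambda>t. t - 1) ` {1..<d}" using d2 by (intro image_eqI[of _ _ "Suc u"]) auto
    qed auto
    finally show "?g ` verts ?I = pverts (path_graph (d - 2))" by (simp add: path_graph_def)
    have "map_prod ?g ?g ` arcs ?I = {(t - 1, t) |t. 1 \<le> t \<and> Suc t < d} \<union> {(t, t - 1) |t. 1 \<le> t \<and> Suc t < d}"
      unfolding arcs image_Un
    proof (intro arg_cong2[of _ _ _ _ "(\<union>)"] equalityI subsetI)
    qed force+
    also have "\<dots> = path_arcs (d - 2) \<union> (path_arcs (d - 2))\<inverse>"
    proof -
      have "{(t - 1, t) |t. 1 \<le> t \<and> Suc t < d} = path_arcs (d - 2)"
      proof (intro equalityI subsetI)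
        fix p assume "p \<in> path_arcs (d - 2)"
        then obtain l where "l < d - 2" "p = (l, Suc l)" by (auto simp: path_arcs_def)
        thus "p \<in> {(t - 1, t) |t. 1 \<le> t \<and> Suc t < d}" by (intro CollectI exI[of _ "Suc l"]) auto
      qed (auto simp: path_arcs_def)
      moreover have "{(t, t - 1) |t. 1 \<le> t \<and> Suc t < d} = {(t - 1, t) |t. 1 \<le> t \<and> Suc t < d}\<inverse>" by auto
      ultimately show ?thesis by simp
    qed
    finally show "map_prod ?g ?g ` arcs ?I = parcs (path_graph (d - 2))" by (simp add: path_graph_def)
  qed simp_all
  thus ?thesis unfolding caterpillar_def pverts_G non_pendant using tree_G by blast
qed

text \<open>Enumerations of the two leaf sets onto consecutive blocks behind the spine are glued to
  the position map; their disjoint images make the result injective.\<close>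

lemma iso_path_with_leaves:
  assumes ij: "i < j" "j < d" and hub: "\<And>e. e \<in> V - S \<Longrightarrow> h e = i \<or> h e = j"
    and k1: "card {e \<in> V - S. h e = i} = k1" and k2: "card {e \<in> V - S. h e = j} = k2"
  shows "digraph_iso (with_proj G) (with_proj (path_with_leaves d i k1 j k2))"
proof -
  define A B where "A = {e \<in> V - S. h e = i}" and "B = {e \<in> V - S. h e = j}"
  have "finite A" "finite B" using finV by (simp_all add: A_def B_def)
  then obtain f1 f2 where f1: "bij_betw f1 A {d<..d + k1}" and f2: "bij_betw f2 B {d + k1<..d + k1 + k2}"
    using finite_same_card_bij[of A "{d<..d + k1}"] finite_same_card_bij[of B "{d + k1<..d + k1 + k2}"] k1 k2
    unfolding A_def B_def by auto
  have V: "V = S \<union> A \<union> B" using hub sV by (auto simp: A_def B_def)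
  define g where "g e = (if e \<in> S then ix e else if e \<in> A then f1 e else f2 e)" for e
  have gS: "g (s t) = t" if "t \<le> d" for t using that by (simp add: g_def)
  have gA: "g e = f1 e" if "e \<in> A" for e using that by (auto simp: g_def A_def)
  have gB: "g e = f2 e" if "e \<in> B" for e using that ij by (auto simp: g_def A_def B_def)
  have imgS: "g ` S = {..d}" using gS by (simp add: image_image)
  have imgA: "g ` A = {d<..d + k1}" using gA f1 by (simp add: bij_betw_def)
  have imgB: "g ` B = {d + k1<..d + k1 + k2}" using gB f2 by (simp add: bij_betw_def)
  have injS: "inj_on g S" by (rule inj_onI) (auto simp: gS)
  have injA: "inj_on g A" using f1 gA by (simp add: bij_betw_def cong: inj_on_cong)
  have injB: "inj_on g B" using f2 gB by (simp add: bij_betw_def cong: inj_on_cong)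
  have disj: "g ` S \<inter> g ` A = {}" "(g ` S \<union> g ` A) \<inter> g ` B = {}" unfolding imgS imgA imgB by auto
  have "inj_on g (S \<union> A)" unfolding inj_on_Un using injS injA disj(1) by blast
  hence inj': "inj_on g V" unfolding V inj_on_Un[of _ _ B] using injB disj(2) by blast
  have half: "map_prod g g ` {(s t, s (Suc t)) |t. t < d} = path_arcs d"
  proof -
    have "map_prod g g ` {(s t, s (Suc t)) |t. t < d} = (\<lambda>t. (g (s t), g (s (Suc t)))) ` {..<d}" by auto
    also have "\<dots> = (\<lambda>t. (t, Suc t)) ` {..<d}" by (rule image_cong) (simp_all add: gS)
    finally show ?thesis by (auto simp: path_arcs_def)
  qed
  have lf: "map_prod g g ` {(s (h e), e) |e. e \<in> V - S} = {i} \<times> {d<..d + k1} \<union> {j} \<times> {d + k1<..d + k1 + k2}"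
  proof -
    have VS: "V - S = A \<union> B" using V by (auto simp: A_def B_def)
    have "map_prod g g ` {(s (h e), e) |e. e \<in> V - S} = (\<lambda>e. (g (s (h e)), g e)) ` (A \<union> B)" unfolding VS by auto
    also have "\<dots> = (\<lambda>e. (i, g e)) ` A \<union> (\<lambda>e. (j, g e)) ` B"
      unfolding image_Un using ij by (intro arg_cong2[of _ _ _ _ "(\<union>)"] image_cong) (auto simp: gS A_def B_def)
    also have "\<dots> = {i} \<times> g ` A \<union> {j} \<times> g ` B" by auto
    finally show ?thesis unfolding imgA imgB .
  qed
  define F where "F = {(s t, s (Suc t)) |t. t < d} \<union> {(s (h e), e) |e. e \<in> V - S}"
  have F: "parcs G = F \<union> F\<inverse>" unfolding arcs_eq F_def by auto
  have imgF: "map_prod g g ` F = path_arcs d \<union> {i} \<times> {d<..d + k1} \<union> {j} \<times> {d + k1<..d + k1 + k2}"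
    unfolding F_def image_Un half lf by blast
  have "map_prod g g ` F\<inverse> = (map_prod g g ` F)\<inverse>" by force
  hence arcs: "map_prod g g ` parcs G = parcs (path_with_leaves d i k1 j k2)"
    unfolding F image_Un by (simp only: imgF path_with_leaves_def Let_def pair_pre_digraph.simps)
  have verts: "g ` V = pverts (path_with_leaves d i k1 j k2)"
    unfolding V image_Un imgS imgA imgB by (auto simp: path_with_leaves_def Let_def)
  interpret pair_graph G by (rule graph_G)
  show ?thesis
    by (rule digraph_iso_pairI[where g = g]) (use inj' arcs verts in_arcsD1 in_arcsD2 in \<open>auto\<close>)
qed

lemma card_branching:
  assumes "\<And>e. e \<in> V - S \<Longrightarrow> h e = i \<or> h e = j"
  shows "card {u \<in> V. 2 < out_degree (with_proj G) u} \<le> 2"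
proof -
  have "{u \<in> V. 2 < out_degree (with_proj G) u} \<subseteq> {s i, s j}"
  proof
    fix u assume u: "u \<in> {u \<in> V. 2 < out_degree (with_proj G) u}"
    hence "u \<in> s ` {1..<d}" unfolding non_pendant[symmetric] by auto
    then obtain t where t: "1 \<le> t" "t < d" "u = s t" by auto
    show "u \<in> {s i, s j}"
    proof (rule ccontr)
      assume "u \<notin> {s i, s j}"
      hence "t \<noteq> i" "t \<noteq> j" using t(3) by auto
      hence "h e \<noteq> t" if "e \<in> V - S" for e using assms[OF that] by auto
      hence "out_degree (with_proj G) (s t) = 2" by (rule degree_inner(2)[OF t(1,2)])
      thus False using u t(3) by simp
    qed
  qed
  hence "card {u \<in> V. 2 < out_degree (with_proj G) u} \<le> card {s i, s j}" by (rule card_mono[rotated]) simp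
  also have "\<dots> \<le> 2" by (simp add: card_insert_if)
  finally show ?thesis .
qed

lemma card_leaves:
  assumes "i \<noteq> j" "\<And>e. e \<in> V - S \<Longrightarrow> h e = i \<or> h e = j"
  shows "card {e \<in> V - S. h e = i} + card {e \<in> V - S. h e = j} = card V - d - 1"
proof -
  have "card {e \<in> V - S. h e = i} + card {e \<in> V - S. h e = j} =
      card ({e \<in> V - S. h e = i} \<union> {e \<in> V - S. h e = j})"
    by (rule card_Un_disjoint[symmetric]) (use finV assms(1) in auto)
  also have "{e \<in> V - S. h e = i} \<union> {e \<in> V - S. h e = j} = V - S" using assms(2) by blast
  also have "card (V - S) = card V - d - 1"
    using card_Diff_subset[OF finite_subset[OF sV finV] sV] card_image[OF inj] by simp
  finally show ?thesis .
qed

end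

lemma nat_floor_ceiling_half:
  fixes a b :: nat
  assumes "a \<le> b" "b \<le> Suc a"
  shows "nat \<lfloor>real (a + b) / 2\<rfloor> = a" "nat \<lceil>real (a + b) / 2\<rceil> = b"
proof -
  have "\<lfloor>real (a + b) / 2\<rfloor> = int a" unfolding floor_eq_iff using assms by auto
  thus "nat \<lfloor>real (a + b) / 2\<rfloor> = a" by simp
  have "\<lceil>real (a + b) / 2\<rceil> = int b" unfolding ceiling_eq_iff using assms by auto
  thus "nat \<lceil>real (a + b) / 2\<rceil> = b" by simp
qed

theorem theorem1p4:
  fixes T :: "'a pair_pre_digraph" and n d :: nat
  assumes "3 \<le> d" and "d + 1 \<le> n" and "lambda2_maximizer n d T"
  shows "caterpillar T \<and>
         card {v \<in> pverts T. 2 < out_degree (with_proj T) v} \<le> 2 \<and>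
         (\<exists>i j. 1 \<le> i \<and> i < j \<and> j \<le> d - 1 \<and>
            digraph_iso (with_proj T)
              (with_proj (path_with_leaves d
                 i (nat \<lfloor>real (n - d - 1) / 2\<rfloor>)
                 j (nat \<lceil>real (n - d - 1) / 2\<rceil>))))"
proof -
  obtain v h i j where
    sp: "spine (pverts T) d v h" and T: "T = spine_tree (pverts T) d v h"
    and ij: "1 \<le> i" "i < j" "j < d"
    and hub: "\<And>e. e \<in> pverts T - v ` {..d} \<Longrightarrow> h e = i \<or> h e = j"
    and le: "card {e \<in> pverts T - v ` {..d}. h e = i} \<le> card {e \<in> pverts T - v ` {..d}. h e = j}"
      "card {e \<in> pverts T - v ` {..d}. h e = j} \<le> Suc (card {e \<in> pverts T - v ` {..d}. h e = i})"
    by (rule maximizer_two_hubs[OF assms(1,3)]) (rule that; assumption)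
  interpret spine "pverts T" d v h by (rule sp)
  have n: "card (pverts T) = n" using assms(3) by (simp add: lambda2_maximizer_def trees_of_diameter_def)
  have sum: "n - d - 1 = card {e \<in> pverts T - S. h e = i} + card {e \<in> pverts T - S. h e = j}"
    using card_leaves[of i j] hub ij n by simp
  have k: "card {e \<in> pverts T - S. h e = i} = nat \<lfloor>real (n - d - 1) / 2\<rfloor>"
    "card {e \<in> pverts T - S. h e = j} = nat \<lceil>real (n - d - 1) / 2\<rceil>"
    using nat_floor_ceiling_half[OF le] unfolding sum by simp_all
  have "digraph_iso (with_proj G) (with_proj (path_with_leaves d
      i (nat \<lfloor>real (n - d - 1) / 2\<rfloor>) j (nat \<lceil>real (n - d - 1) / 2\<rceil>)))"
    by (rule iso_path_with_leaves[OF ij(2,3) _ k]) (rule hub)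
  moreover have "j \<le> d - 1" using ij by simp
  ultimately show ?thesis
    using ij caterpillar_G card_branching[of i j] hub unfolding T[symmetric] by blast
qed

end
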